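(* Let $X$ and $Y$ be two continuous semimartingales on a common filtered probability space $(\Omega,\mathcal{F},(\mathcal{F}_t)_{t\ge 0},\mathbb{P})$ satisfying the usual conditions, such that (1) $\{s\ge 0: X_s=0\}\subset\{s\ge 0: Y_s=0\}$, and (2) $X_s^+\le Y_s^+$ for all $s\ge 0$. Then the (random) measure $dL^0_t(X)$ is absolutely continuous with respect to the measure $dL^0_t(Y)$, i.e. $dL^0_t(X)\ll dL^0_t(Y)$, and there exists a predictable process $(\theta_s)_{s\ge 0}$ with $\theta_s\in[0,1]$ such that $$L^0_t(X)=\int_0^t\theta_s\,dL^0_s(Y),\qquad t\ge 0.$$
   Context: For a continuous semimartingale $Z$, $L^0(Z)$ denotes its right local time at $0$, i.e. the continuous nondecreasing adapted process defined by $\frac12 L^0_t(Z)=Z_t^+-Z_0^+-\int_0^t 1_{\{Z_s>0\}}\,dZ_s$; $dL^0_t(Z)$ is the associated random Stieltjes measure on $[0,\infty)$. Here $x^+=\max(x,0)$. Statements about paths are understood almost surely. *)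

theory Defs
  imports "HOL-Probability.Probability"
begin

text \<open>
  Processes are functions of time and outcome. Time is \<^typ>\<open>real\<close>, but only its restriction to
  \<open>[0,\<infinity>)\<close> matters: every condition below is relativised to nonnegative times, so the values of a
  filtration or a process at negative times are irrelevant. The members \<open>F t\<close> of a filtration only
  serve as sigma-algebras; the probability is always that of \<open>M\<close>.
\<close>

type_synonym 'a process = "real \<Rightarrow> 'a \<Rightarrow> real"

locale usual_filtered_prob_space = prob_space M + complete_measure M
  for M :: "'a measure" and F :: "real \<Rightarrow> 'a measure" +
  assumes subalgebra_F: "\<And>t. 0 \<le> t \<Longrightarrow> subalgebra M (F t)"
    and F_mono: "\<And>s t. 0 \<le> s \<Longrightarrow> s \<le> t \<Longrightarrow> sets (F s) \<subseteq> sets (F t)"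
    and F_complete: "null_sets M \<subseteq> sets (F 0)"
    and F_right_continuous: "\<And>t. 0 \<le> t \<Longrightarrow> sets (F t) = (\<Inter>s\<in>{t<..}. sets (F s))"

definition adapted :: "(real \<Rightarrow> 'a measure) \<Rightarrow> 'a process \<Rightarrow> bool" where
  "adapted F Z \<longleftrightarrow> (\<forall>t\<ge>0. Z t \<in> borel_measurable (F t))"

definition continuous_paths :: "'a measure \<Rightarrow> 'a process \<Rightarrow> bool" where
  "continuous_paths M Z \<longleftrightarrow> (AE \<omega> in M. continuous_on {0..} (\<lambda>t. Z t \<omega>))"

definition indistinguishable :: "'a measure \<Rightarrow> 'a process \<Rightarrow> 'a process \<Rightarrow> bool" where
  "indistinguishable M U V \<longleftrightarrow> (AE \<omega> in M. \<forall>t\<ge>0. U t \<omega> = V t \<omega>)"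

subsection \<open>Continuous semimartingales\<close>

definition martingale :: "'a measure \<Rightarrow> (real \<Rightarrow> 'a measure) \<Rightarrow> 'a process \<Rightarrow> bool" where
  "martingale M F Z \<longleftrightarrow> adapted F Z \<and> (\<forall>t\<ge>0. integrable M (Z t)) \<and>
     (\<forall>s\<ge>0. \<forall>t\<ge>s. AE \<omega> in M. real_cond_exp M (F s) (Z t) \<omega> = Z s \<omega>)"

text \<open>Stopping times may take the value \<open>\<infinity>\<close>, and are tested at times in \<open>[0,\<infinity>)\<close> only.\<close>

definition is_stopping_time :: "'a measure \<Rightarrow> (real \<Rightarrow> 'a measure) \<Rightarrow> ('a \<Rightarrow> ennreal) \<Rightarrow> bool" where
  "is_stopping_time M F \<tau> \<longleftrightarrow> (\<forall>t\<ge>0. {\<omega> \<in> space M. \<tau> \<omega> \<le> ennreal t} \<in> sets (F t))"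

definition stopped :: "('a \<Rightarrow> ennreal) \<Rightarrow> 'a process \<Rightarrow> 'a process" where
  "stopped \<tau> Z = (\<lambda>t \<omega>. Z (enn2real (min (ennreal t) (\<tau> \<omega>))) \<omega>)"

definition continuous_local_martingale ::
    "'a measure \<Rightarrow> (real \<Rightarrow> 'a measure) \<Rightarrow> 'a process \<Rightarrow> bool" where
  "continuous_local_martingale M F N \<longleftrightarrow> adapted F N \<and> continuous_paths M N \<and>
     (\<exists>\<tau> :: nat \<Rightarrow> 'a \<Rightarrow> ennreal.
        (\<forall>n. is_stopping_time M F (\<tau> n)) \<and>
        (AE \<omega> in M. incseq (\<lambda>n. \<tau> n \<omega>) \<and> (\<lambda>n. \<tau> n \<omega>) \<longlonglongrightarrow> \<infinity>) \<and>
        (\<forall>n. martingale M F (stopped (\<tau> n) (\<lambda>t \<omega>. N t \<omega> - N 0 \<omega>))))"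

definition locally_bounded_variation :: "(real \<Rightarrow> real) \<Rightarrow> bool" where
  "locally_bounded_variation f \<longleftrightarrow>
     (\<forall>t\<ge>0. \<exists>C. \<forall>(n::nat) u. (\<forall>i\<le>n. u i \<in> {0..t}) \<and> (\<forall>i<n. u i \<le> u (Suc i)) \<longrightarrow>
        (\<Sum>i<n. \<bar>f (u (Suc i)) - f (u i)\<bar>) \<le> C)"

definition continuous_semimartingale ::
    "'a measure \<Rightarrow> (real \<Rightarrow> 'a measure) \<Rightarrow> 'a process \<Rightarrow> bool" where
  "continuous_semimartingale M F Z \<longleftrightarrow> adapted F Z \<and> continuous_paths M Z \<and>
     (\<exists>N A. continuous_local_martingale M F N \<and> (\<forall>\<omega>\<in>space M. N 0 \<omega> = 0) \<and>
        adapted F A \<and> continuous_paths M A \<and> (\<forall>\<omega>\<in>space M. A 0 \<omega> = 0) \<and>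
        (AE \<omega> in M. locally_bounded_variation (\<lambda>t. A t \<omega>)) \<and>
        indistinguishable M Z (\<lambda>t \<omega>. Z 0 \<omega> + N t \<omega> + A t \<omega>))"

subsection \<open>Predictable processes\<close>

definition predictable_sigma :: "'a measure \<Rightarrow> (real \<Rightarrow> 'a measure) \<Rightarrow> (real \<times> 'a) measure" where
  "predictable_sigma M F = sigma ({0..} \<times> space M)
     ({{0} \<times> A | A. A \<in> sets (F 0)} \<union>
      {{s<..t} \<times> A | s t A. 0 \<le> s \<and> s < t \<and> A \<in> sets (F s)})"

definition predictable :: "'a measure \<Rightarrow> (real \<Rightarrow> 'a measure) \<Rightarrow> 'a process \<Rightarrow> bool" where
  "predictable M F H \<longleftrightarrow> (\<lambda>(t, \<omega>). H t \<omega>) \<in> borel_measurable (predictable_sigma M F)"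

definition bounded_predictable :: "'a measure \<Rightarrow> (real \<Rightarrow> 'a measure) \<Rightarrow> 'a process \<Rightarrow> bool" where
  "bounded_predictable M F H \<longleftrightarrow> predictable M F H \<and>
     (\<exists>C. \<forall>t\<ge>0. \<forall>\<omega>\<in>space M. \<bar>H t \<omega>\<bar> \<le> C)"

subsection \<open>The stochastic integral of bounded predictable processes\<close>

text \<open>
  The integral with respect to a continuous semimartingale \<open>Z\<close> is the extension of the elementary
  integral, \<open>1\<^bsub>(r,s]\<^esub> U \<mapsto> U (Z\<^bsub>s\<and>t\<^esub> - Z\<^bsub>r\<and>t\<^esub>)\<close> with \<open>U\<close> bounded and \<open>F r\<close>-measurable, to a linear map
  from bounded predictable processes to continuous adapted processes that satisfies dominated
  convergence in probability. For a continuous semimartingale there is such an extension, and it is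
  unique up to indistinguishability (see e.g. Jacod and Shiryaev, Limit Theorems for Stochastic
  Processes, Theorem I.4.31). Integrals over \<open>[0,t]\<close> carry no mass at time \<open>0\<close>.
\<close>

definition integral_operator ::
    "'a measure \<Rightarrow> (real \<Rightarrow> 'a measure) \<Rightarrow> 'a process \<Rightarrow> ('a process \<Rightarrow> 'a process) \<Rightarrow> bool" where
  "integral_operator M F Z J \<longleftrightarrow>
     (\<forall>H. bounded_predictable M F H \<longrightarrow> adapted F (J H) \<and> continuous_paths M (J H)) \<and>
     (\<forall>U. U \<in> borel_measurable (F 0) \<and> (\<exists>C. \<forall>\<omega>\<in>space M. \<bar>U \<omega>\<bar> \<le> C) \<longrightarrow>
        indistinguishable M (J (\<lambda>t \<omega>. indicator {0} t * U \<omega>)) (\<lambda>t \<omega>. 0)) \<and>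
     (\<forall>r s U. 0 \<le> r \<and> r < s \<and> U \<in> borel_measurable (F r) \<and> (\<exists>C. \<forall>\<omega>\<in>space M. \<bar>U \<omega>\<bar> \<le> C) \<longrightarrow>
        indistinguishable M (J (\<lambda>t \<omega>. indicator {r<..s} t * U \<omega>))
          (\<lambda>t \<omega>. U \<omega> * (Z (min s t) \<omega> - Z (min r t) \<omega>))) \<and>
     (\<forall>a b H K. bounded_predictable M F H \<and> bounded_predictable M F K \<longrightarrow>
        indistinguishable M (J (\<lambda>t \<omega>. a * H t \<omega> + b * K t \<omega>)) (\<lambda>t \<omega>. a * J H t \<omega> + b * J K t \<omega>)) \<and>
     (\<forall>(H :: nat \<Rightarrow> 'a process) K C.
        (\<forall>n. predictable M F (H n)) \<and> predictable M F K \<and>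
        (\<forall>n. \<forall>t\<ge>0. \<forall>\<omega>\<in>space M. \<bar>H n t \<omega>\<bar> \<le> C) \<and>
        (\<forall>t\<ge>0. \<forall>\<omega>\<in>space M. (\<lambda>n. H n t \<omega>) \<longlonglongrightarrow> K t \<omega>) \<longrightarrow>
        (\<forall>t\<ge>0. \<forall>\<epsilon>>0. (\<lambda>n. measure M {\<omega>\<in>space M. \<epsilon> < \<bar>J (H n) t \<omega> - J K t \<omega>\<bar>}) \<longlonglongrightarrow> 0))"

text \<open>
  \<open>I\<close> is a version of the process \<open>\<integral>\<^sub>0\<^sup>t H dZ\<close>. Since paths are only almost surely continuous, an
  integrand such as \<open>1\<^bsub>{Z>0}\<^esub>\<close> is in general only indistinguishable from a predictable process.
\<close>

definition stochastic_integral ::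
    "'a measure \<Rightarrow> (real \<Rightarrow> 'a measure) \<Rightarrow> 'a process \<Rightarrow> 'a process \<Rightarrow> 'a process \<Rightarrow> bool" where
  "stochastic_integral M F Z H I \<longleftrightarrow>
     (\<exists>J K. integral_operator M F Z J \<and> bounded_predictable M F K \<and>
        indistinguishable M H K \<and> indistinguishable M I (J K))"

subsection \<open>Right local time at 0\<close>

text \<open>\<open>L\<close> is a version of the local time; any two versions are indistinguishable.\<close>

definition local_time ::
    "'a measure \<Rightarrow> (real \<Rightarrow> 'a measure) \<Rightarrow> 'a process \<Rightarrow> 'a process \<Rightarrow> bool" where
  "local_time M F Z L \<longleftrightarrow>
     adapted F L \<and> continuous_paths M L \<and> (AE \<omega> in M. mono_on {0..} (\<lambda>t. L t \<omega>)) \<and>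
     (\<exists>I. stochastic_integral M F Z (\<lambda>s \<omega>. indicator {0<..} (Z s \<omega>)) I \<and>
        (AE \<omega> in M. \<forall>t\<ge>0. 1/2 * L t \<omega> = max (Z t \<omega>) 0 - max (Z 0 \<omega>) 0 - I t \<omega>))"

text \<open>
  The Stieltjes measure on \<open>[0,\<infinity>)\<close> of a continuous nondecreasing function on \<open>[0,\<infinity>)\<close>, which is
  extended to the left by its value at \<open>0\<close>, so that there is no atom at \<open>0\<close>.
\<close>

definition stieltjes :: "(real \<Rightarrow> real) \<Rightarrow> real measure" where
  "stieltjes f = restrict_space (interval_measure (\<lambda>t. f (max t 0))) {0..}"

end

(*
  Let D = Y^+ - X^+ >= 0, which vanishes where X does. The key claim is that LY - LX is nondecreasing.
  Fix e > 0 and let W be the left-continuous adapted weight that, on each excursion of X away from 0, is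
  1 until |X| exceeds e and then 0 until the excursion ends. As LX is constant on excursions of X, it has
  the same increments as the integral of W dLX, whereas the integral of W dLY is at most the increment
  of LY. So it suffices to bound the integral of W against d(LY - LX)/2 = dD - 1_{Y>0} dY + 1_{X>0} dX
  from below. The dD-part is nonnegative up to a boundary term that vanishes as e -> 0, since W jumps up
  only at zeros of X, where D = 0. The other two parts vanish as e -> 0, because W tends to 0 off the
  zeros of X, while 1_{X>0} and 1_{Y>0} are 0 at these zeros. All integrals are limits of Riemann sums,
  so neither Ito's formula nor the semimartingale decomposition is needed.

  Hence dLX <= dLY. The limit of left difference quotients of LX by LY is predictable, and it is a density
  because the generalized inverse of LY turns it into the left derivative of a Lipschitz function.
*)

theory Submission
  imports Defs
begin

text \<open>The natural integrand would be the indicator of the zeros of X, but its left-endpoint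
  sums need not converge to its integral. W is a left-continuous adapted substitute, for which they
  do. Summing by parts costs an error only in grid cells where W may switch up, and uniform
  continuity bounds the number of such cells independently of the mesh.

  The integral is known only through \<open>integral_operator\<close>: its values on elementary
  integrands, linearity, and dominated convergence. The local times contain integrals of 1_{X>0} and
  1_{Y>0}, so sums against an integral J K have to be identified with integrals of W K; this
  associativity is derived by a monotone class argument.

  For the density, quotients are taken from the left because these look only at the past. Their
  convergence rests on the Vitali covering theorem. An upper bound for the quotients is enough,
  since it applies to a function \<phi> and to x - \<phi> x alike.\<close>

section \<open>Stieltjes measures of continuous monotone functions\<close>

lemma emeasure_interval_measure_Ioc_cont:
  fixes F :: "real \<Rightarrow> real"
  assumes "mono F" "continuous_on UNIV F" "a \<le> b"
  shows "emeasure (interval_measure F) {a<..b} = ennreal (F b - F a)"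
  using assms
  by (intro emeasure_interval_measure_Ioc)
     (auto simp: mono_def intro: continuous_within_subset simp: continuous_on_eq_continuous_within)

lemma sets_borel_Ioc: "sets (borel :: real measure) = sigma_sets UNIV (range (\<lambda>(a, b). {a<..b}))"
  by (simp add: borel_sigma_sets_Ioc)

lemma Int_stable_Ioc: "Int_stable (range (\<lambda>(a, b). {a<..b::real}))"
  by (force simp: Int_stable_def)

lemma borel_measure_eqI_Ioc:
  fixes N :: "real measure"
  assumes "sets M = sets borel" "sets N = sets borel"
    and eq: "\<And>a b. a \<le> b \<Longrightarrow> emeasure M {a<..b} = emeasure N {a<..b}"
    and fin: "\<And>a b. a \<le> b \<Longrightarrow> emeasure M {a<..b} \<noteq> \<infinity>"
  shows "M = N"
proof (rule measure_eqI_generator_eq[where \<Omega> = UNIV and A = "\<lambda>i. {-real i<..real i}"])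
  show "Int_stable (range (\<lambda>(a, b). {a<..b::real}))"
    by (rule Int_stable_Ioc)
  fix X assume "X \<in> range (\<lambda>(a, b). {a<..b::real})"
  then obtain a b where X: "X = {a<..b}" by auto
  show "emeasure M X = emeasure N X"
    using eq[of a b] by (cases "a \<le> b") (auto simp: X)
next
  show "(\<Union>i. {-real i<..real i}) = UNIV"
  proof -
    have "\<exists>i. - real i < x \<and> x \<le> real i" for x
      using reals_Archimedean2[of "\<bar>x\<bar>"] by (metis abs_less_iff less_eq_real_def minus_less_iff)
    then show ?thesis by auto
  qed
qed (use assms fin sets_borel_Ioc in auto)

lemma interval_measure_eqI:
  fixes F :: "real \<Rightarrow> real"
  assumes "mono F" "continuous_on UNIV F" "sets M = sets borel"
    and "\<And>a b. a \<le> b \<Longrightarrow> emeasure M {a<..b} = ennreal (F b - F a)"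
  shows "M = interval_measure F"
  using assms by (intro borel_measure_eqI_Ioc) (auto simp: emeasure_interval_measure_Ioc_cont)

text \<open>The sum of the two measures is built as \<open>K\<close> and recognized by its values on
  half-open intervals, where the increments of \<open>F\<close> and \<open>H\<close> add up.\<close>

lemma interval_measure_add:
  fixes F H :: "real \<Rightarrow> real"
  assumes F: "mono F" "continuous_on UNIV F" and H: "mono H" "continuous_on UNIV H"
    and E: "E \<in> sets borel"
  shows "emeasure (interval_measure (\<lambda>x. F x + H x)) E =
    emeasure (interval_measure F) E + emeasure (interval_measure H) E"
proof -
  define \<mu> where "\<mu> E = emeasure (interval_measure F) E + emeasure (interval_measure H) E" for E
  define K where "K = measure_of UNIV (sets borel) \<mu>"
  have K: "emeasure K A = \<mu> A" if "A \<in> sets borel" for A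
    unfolding K_def
  proof (rule emeasure_measure_of_sigma)
    show "sigma_algebra UNIV (sets (borel :: real measure))"
      using sets.sigma_algebra_axioms[of "borel :: real measure"] by simp
    show "positive (sets borel) \<mu>" by (simp add: positive_def \<mu>_def)
    show "countably_additive (sets borel) \<mu>"
    proof (rule countably_additiveI)
      fix A :: "nat \<Rightarrow> real set"
      assume A: "range A \<subseteq> sets borel" "disjoint_family A"
      then show "(\<Sum>i. \<mu> (A i)) = \<mu> (\<Union>i. A i)"
        by (simp add: \<mu>_def suminf_add[symmetric] suminf_emeasure)
    qed
  qed (fact that)
  have "K = interval_measure (\<lambda>x. F x + H x)"
  proof (rule interval_measure_eqI)
    show "mono (\<lambda>x. F x + H x)" using F H by (auto simp: mono_def intro!: add_mono)
    show "continuous_on UNIV (\<lambda>x. F x + H x)" using F H by (intro continuous_intros) auto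
    show "sets K = sets borel"
      using sets.sigma_sets_eq[of "borel :: real measure"] by (simp add: K_def)
    fix a b :: real assume "a \<le> b"
    with F H show "emeasure K {a<..b} = ennreal (F b + H b - (F a + H a))"
      by (simp add: K \<mu>_def emeasure_interval_measure_Ioc_cont ennreal_plus[symmetric] mono_def
          algebra_simps del: ennreal_plus)
  qed
  then show ?thesis using K[OF E] by (simp add: \<mu>_def)
qed

text \<open>Write \<open>G\<close> as \<open>F\<close> plus the monotone function
  \<open>G - F\<close>. This turns the monotonicity of LY - LX into domination of measures.\<close>

lemma interval_measure_mono:
  fixes F G :: "real \<Rightarrow> real"
  assumes F: "mono F" "continuous_on UNIV F" and G: "continuous_on UNIV G" "mono (\<lambda>x. G x - F x)"
    and E: "E \<in> sets borel"
  shows "emeasure (interval_measure F) E \<le> emeasure (interval_measure G) E"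
  using interval_measure_add[OF F G(2) _ E] F G by (simp add: continuous_intros)

subsection \<open>One-sided differentiation of Lipschitz functions\<close>

text \<open>Vitali covering argument. The intervals on which \<phi> grows faster than
  \<open>q\<close> cover the set finely, and a countable disjoint selection with union
  \<open>U\<close> covers almost all of it. On \<open>U\<close> the measure of \<phi> is at least
  q|U|, whereas its density is below \<open>p\<close> except on a small set; so |U| is
  small.\<close>

lemma upper_left_quotient_bound:
  fixes \<phi> h :: "real \<Rightarrow> real"
  assumes \<phi>: "mono \<phi>" "continuous_on UNIV \<phi>"
    and h: "h \<in> borel_measurable borel" "\<And>x. 0 \<le> h x" "\<And>x. h x \<le> 1"
    and dens: "density lborel (\<lambda>x. ennreal (h x)) = interval_measure \<phi>"
    and pq: "0 \<le> p" "p < q"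
  shows "negligible {x \<in> {-n<..<n}. h x < p \<and>
    (\<forall>d>0. \<exists>y\<in>{x-d<..<x}. q * (x - y) < \<phi> x - \<phi> y)}" (is "negligible ?E")
  unfolding negligible_outer_le
proof (intro allI impI)
  fix e :: real assume "e > 0"
  define A where "A = {x \<in> {-n<..<n}. h x < p}"
  have [measurable]: "h \<in> borel_measurable borel" by fact
  have A[measurable]: "A \<in> sets borel" unfolding A_def by measurable
  \<comment> \<open>The final estimate is u * (q - p) \<le> \<eta>, so this choice yields u \<le>
    e.\<close>
  define \<eta> where "\<eta> = e * (q - p)"
  have \<eta>: "\<eta> > 0" using \<open>e > 0\<close> pq by (simp add: \<eta>_def)
  obtain O' where O': "open O'" "A \<subseteq> O'" "emeasure lborel (O' - A) < ennreal \<eta>"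
    using outer_regular_lborel[OF A \<eta>] by blast
  \<comment> \<open>Bounded, so that |U| is finite and p|U| can be subtracted at the end.\<close>
  define Q where "Q = O' \<inter> {-n<..<n}"
  have Q: "open Q" "A \<subseteq> Q" using O' by (auto simp: Q_def A_def)
  have [measurable]: "Q \<in> sets borel" "O' \<in> sets borel" using Q(1) O'(1) by auto
  have QA: "emeasure lborel (Q - A) \<le> ennreal \<eta>"
    using O'(3) by (intro order_trans[OF emeasure_mono[of "Q - A" "O' - A" lborel]]) (auto simp: Q_def)
  define K where "K = {(y, x). y < x \<and> {y..x} \<subseteq> Q \<and> q * (x - y) < \<phi> x - \<phi> y}"
  \<comment> \<open>Midpoint and radius turn [y,x] into a closed ball, the form that the covering
    theorem takes. The point to be covered is an endpoint of its interval, not the centre.\<close>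
  define m where "m = (\<lambda>(y, x). (x + y) / 2 :: real)"
  define r where "r = (\<lambda>(y, x). (x - y) / 2 :: real)"
  have cb: "cball (m (y, x)) (r (y, x)) = {y..x}" for y x
    by (auto simp: m_def r_def cball_eq_atLeastAtMost field_simps)
  have cov: "\<exists>i. i \<in> K \<and> x \<in> cball (m i) (r i) \<and> r i < d" if xE: "x \<in> ?E" "d > 0" for x d
  proof -
    have "x \<in> Q" using xE Q by (auto simp: A_def)
    then obtain d' where d': "d' > 0" "ball x d' \<subseteq> Q" using Q(1) openE by blast
    have "min d d' > 0" using xE d' by simp
    then obtain y where y: "y \<in> {x - min d d'<..<x}" "q * (x - y) < \<phi> x - \<phi> y"
      using xE(1) by blast
    have "{y..x} \<subseteq> ball x d'" using y by (auto simp: dist_real_def)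
    with y d' have "(y, x) \<in> K" by (auto simp: K_def)
    moreover have "x \<in> cball (m (y, x)) (r (y, x))" using y by (simp add: cb)
    moreover have "r (y, x) < d" using y xE by (auto simp: r_def)
    ultimately show ?thesis by blast
  qed
  have r: "0 < r i" if "i \<in> K" for i using that by (auto simp: K_def r_def)
  obtain C where C: "countable C" "C \<subseteq> K"
     "pairwise (\<lambda>i j. disjnt (cball (m i) (r i)) (cball (m j) (r j))) C"
     "negligible (?E - (\<Union>i \<in> C. cball (m i) (r i)))"
    using Vitali_covering_theorem_cballs[of K r ?E m, OF r cov] by blast
  define I where "I i = cball (m i) (r i)" for i
  define U where "U = (\<Union>i\<in>C. I i)"
  have [measurable]: "I i \<in> sets borel" for i by (simp add: I_def)
  have U[measurable]: "U \<in> sets borel" unfolding U_def using C(1) by (intro sets.countable_UN'') auto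
  have UQ: "U \<subseteq> Q"
  proof
    fix z assume "z \<in> U"
    then obtain i where i: "i \<in> C" "z \<in> I i" by (auto simp: U_def)
    obtain y x where yx: "i = (y, x)" by (cases i)
    with i have "z \<in> {y..x}" by (simp only: I_def cb)
    moreover have "{y..x} \<subseteq> Q" using i(1) yx C(2) by (auto simp: K_def)
    ultimately show "z \<in> Q" by blast
  qed
  have dj: "disjoint_family_on I C"
    using C(3) by (auto simp: disjoint_family_on_def pairwise_def disjnt_def I_def)
  let ?\<nu> = "interval_measure \<phi>"
  have \<nu>: "emeasure ?\<nu> B = (\<integral>\<^sup>+x. ennreal (h x) * indicator B x \<partial>lborel)" if "B \<in> sets borel" for B
    using that unfolding dens[symmetric] by (subst emeasure_density) auto
  have "ennreal q * emeasure lborel U = (\<integral>\<^sup>+i. ennreal q * emeasure lborel (I i) \<partial>count_space C)"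
    unfolding U_def using C(1) dj by (subst emeasure_UN_countable) (auto simp: nn_integral_cmult)
  also have "\<dots> \<le> (\<integral>\<^sup>+i. emeasure ?\<nu> (I i) \<partial>count_space C)"
  proof (rule nn_integral_mono)
    fix i assume "i \<in> space (count_space C)"
    then obtain y x where i: "i = (y, x)" "(y, x) \<in> K" using C(2) by (cases i) auto
    have "ennreal q * emeasure lborel (I i) = ennreal (q * (x - y))"
      using i pq by (simp add: I_def cb K_def ennreal_mult)
    also have "\<dots> \<le> ennreal (\<phi> x - \<phi> y)" using i by (intro ennreal_leI) (auto simp: K_def)
    also have "\<dots> = emeasure ?\<nu> (I i)" 
      using i \<phi> by (simp add: I_def cb K_def emeasure_interval_measure_Icc mono_def)
    finally show "ennreal q * emeasure lborel (I i) \<le> emeasure ?\<nu> (I i)" .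
  qed
  also have "\<dots> = emeasure ?\<nu> U"
    unfolding U_def using C(1) dj by (subst emeasure_UN_countable) auto
  also have "\<dots> \<le> emeasure ?\<nu> (U \<inter> A) + emeasure ?\<nu> (Q - A)"
    using UQ by (subst plus_emeasure) (auto intro!: emeasure_mono)
  also have "\<dots> \<le> ennreal p * emeasure lborel U + ennreal \<eta>"
  proof (rule add_mono)
    have "emeasure ?\<nu> (U \<inter> A) \<le> (\<integral>\<^sup>+x. ennreal p * indicator (U \<inter> A) x \<partial>lborel)"
      by (subst \<nu>) (auto intro!: nn_integral_mono ennreal_leI simp: A_def split: split_indicator)
    also have "\<dots> = ennreal p * emeasure lborel (U \<inter> A)" by (simp add: nn_integral_cmult_indicator)
    also have "\<dots> \<le> ennreal p * emeasure lborel U" by (intro mult_left_mono emeasure_mono) auto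
    finally show "emeasure ?\<nu> (U \<inter> A) \<le> ennreal p * emeasure lborel U" .
    \<comment> \<open>Here h \<le> 1 enters: the measure of \<phi> is at most Lebesgue
      measure.\<close>
    have "emeasure ?\<nu> (Q - A) \<le> (\<integral>\<^sup>+x. indicator (Q - A) x \<partial>lborel)"
      using h(3) by (subst \<nu>) (auto intro!: nn_integral_mono simp: ennreal_le_1 simp del: nn_integral_indicator split: split_indicator)
    also have "\<dots> \<le> ennreal \<eta>" using QA by simp
    finally show "emeasure ?\<nu> (Q - A) \<le> ennreal \<eta>" .
  qed
  finally have le: "ennreal q * emeasure lborel U \<le> ennreal p * emeasure lborel U + ennreal \<eta>" .
  have "emeasure lborel U \<le> emeasure lborel {-n..n}"
    using UQ by (intro emeasure_mono) (auto simp: Q_def)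
  also have "\<dots> < \<infinity>" by (simp add: emeasure_lborel_Icc_eq)
  finally have fin: "emeasure lborel U < \<infinity>" .
  then obtain u where u: "emeasure lborel U = ennreal u" "u \<ge> 0"
    by (metis enn2real_nonneg ennreal_enn2real infinity_ennreal_def)
  have "q * u \<le> p * u + \<eta>"
    using le pq u \<eta> by (simp add: ennreal_mult[symmetric] ennreal_plus[symmetric] del: ennreal_plus)
  then have "u * (q - p) \<le> e * (q - p)" by (simp add: \<eta>_def algebra_simps)
  then have "u \<le> e" using pq by simp
  have Un: "negligible (?E - U)" using C(4) by (simp add: U_def I_def)
  have UL: "U \<in> lmeasurable" using fin by (intro fmeasurableI) auto
  show "\<exists>T. ?E \<subseteq> T \<and> T \<in> lmeasurable \<and> measure lebesgue T \<le> e"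
  proof (intro exI conjI)
    show "?E \<subseteq> U \<union> (?E - U)" by auto
    show "U \<union> (?E - U) \<in> lmeasurable"
      using fmeasurable.Un[OF UL negligible_imp_measurable[OF Un]] .
    have "measure lebesgue (U \<union> (?E - U)) \<le> measure lebesgue U + measure lebesgue (?E - U)"
      using UL Un by (intro measure_Un_le) (auto intro: negligible_imp_sets)
    also have "\<dots> = u" unfolding negligible_imp_measure0[OF Un] using u by (simp add: measure_def)
    also note \<open>u \<le> e\<close>
    finally show "measure lebesgue (U \<union> (?E - U)) \<le> e" .
  qed
qed

text \<open>Both functions are monotone and add up to the identity, so both measures are dominated
  by Lebesgue measure and their densities add up to 1 almost everywhere. Hence one function
  \<open>h\<close> describes both.\<close>

lemma interval_measure_density:
  fixes \<phi> :: "real \<Rightarrow> real"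
  assumes \<phi>: "mono \<phi>" "continuous_on UNIV \<phi>" "mono (\<lambda>x. x - \<phi> x)"
  obtains h :: "real \<Rightarrow> real" where "h \<in> borel_measurable borel" "\<And>x. 0 \<le> h x" "\<And>x. h x \<le> 1"
    "density lborel (\<lambda>x. ennreal (h x)) = interval_measure \<phi>"
    "density lborel (\<lambda>x. ennreal (1 - h x)) = interval_measure (\<lambda>x. x - \<phi> x)"
proof -
  have RN: "\<exists>f \<in> borel_measurable lborel. density lborel f = interval_measure F"
    if F: "mono F" "continuous_on UNIV F" "mono (\<lambda>x. x - F x)" for F :: "real \<Rightarrow> real"
  proof (rule sigma_finite_measure.Radon_Nikodym[OF sigma_finite_lborel])
    show "absolutely_continuous lborel (interval_measure F)"
      using interval_measure_mono[OF F(1,2) continuous_on_id F(3)]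
      unfolding absolutely_continuous_def null_sets_def
      by (auto simp: lborel_eq_real[symmetric]) (metis le_zero_eq)
  qed simp
  obtain f where f: "f \<in> borel_measurable lborel" "density lborel f = interval_measure \<phi>"
    using RN[OF \<phi>] by blast
  have \<phi>': "mono (\<lambda>x. x - \<phi> x)" "continuous_on UNIV (\<lambda>x. x - \<phi> x)"
    using \<phi> by (auto intro!: continuous_intros)
  obtain g where g: "g \<in> borel_measurable lborel" "density lborel g = interval_measure (\<lambda>x. x - \<phi> x)"
    using RN[OF \<phi>'] \<phi>(1) by auto
  have "density lborel (\<lambda>x. f x + g x) = (lborel :: real measure)"
  proof (rule measure_eqI)
    fix E :: "real set" assume "E \<in> sets (density lborel (\<lambda>x. f x + g x))"
    then have E: "E \<in> sets borel" by simp
    have "emeasure (density lborel (\<lambda>x. f x + g x)) E = emeasure (density lborel f) E + emeasure (density lborel g) E"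
      using E f(1) g(1) by (simp add: emeasure_density nn_integral_add distrib_right)
    also have "\<dots> = emeasure lborel E"
      using interval_measure_add[OF \<phi>(1,2) \<phi>' E] by (simp only: f(2) g(2)) (simp add: lborel_eq_real)
    finally show "emeasure (density lborel (\<lambda>x. f x + g x)) E = emeasure lborel E" .
  qed simp
  then have "density lborel (\<lambda>x. f x + g x) = density lborel (\<lambda>x::real. 1)"
    by (simp add: density_1)
  then have fg: "AE x in lborel. f x + g x = 1"
    using f g by (subst (asm) sigma_finite_measure.density_unique_iff[OF sigma_finite_lborel]) auto
  \<comment> \<open>Cutting at 1 makes the bounds hold everywhere instead of almost everywhere; it
    changes \<open>f\<close> only on a null set.\<close>
  define h where "h x = enn2real (min (f x) 1)" for x
  have le: "min (f x) 1 < top" for x by (auto simp: min_less_iff_disj)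
  have 1: "h \<in> borel_measurable borel" unfolding h_def using f by simp
  have 2: "0 \<le> h x" for x by (simp add: h_def)
  have 3: "h x \<le> 1" for x
    unfolding h_def using enn2real_mono[of "min (f x) 1" 1] by simp
  have hf: "AE x in lborel. ennreal (h x) = f x"
    using fg
  proof eventually_elim
    case (elim x)
    have "f x \<le> f x + g x" by simp
    then have "f x \<le> 1" using elim by simp
    then show ?case using le[of x] by (simp add: h_def min_def)
  qed
  have hg: "AE x in lborel. ennreal (1 - h x) = g x"
    using fg hf
  proof eventually_elim
    case (elim x)
    have "ennreal (1 - h x) = 1 - f x" using 2[of x] elim by (simp add: ennreal_minus[symmetric])
    also have "\<dots> = (f x + g x) - f x" using elim by simp
    also have "\<dots> = g x" using elim by (intro ennreal_add_diff_cancel_left) auto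
    finally show ?case .
  qed
  show thesis
  proof (rule that[OF 1 2 3])
    show "density lborel (\<lambda>x. ennreal (h x)) = interval_measure \<phi>"
      using hf 1 f by (subst f(2)[symmetric], intro density_cong) auto
    show "density lborel (\<lambda>x. ennreal (1 - h x)) = interval_measure (\<lambda>x. x - \<phi> x)"
      using hg 1 g by (subst g(2)[symmetric], intro density_cong) auto
  qed
qed

text \<open>If the bound fails at x for some e, rationals p < q fit strictly between h x and h x +
  e, and x lies in one of countably many null sets.\<close>

lemma upper_left_quotient_AE:
  fixes \<phi> h :: "real \<Rightarrow> real"
  assumes \<phi>: "mono \<phi>" "continuous_on UNIV \<phi>"
    and h: "h \<in> borel_measurable borel" "\<And>x. 0 \<le> h x" "\<And>x. h x \<le> 1"
    and dens: "density lborel (\<lambda>x. ennreal (h x)) = interval_measure \<phi>"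
  shows "AE x in lebesgue. \<forall>e>0. \<exists>d>0. \<forall>y\<in>{x-d<..<x}. \<phi> x - \<phi> y \<le> (h x + e) * (x - y)"
proof -
  let ?B = "\<lambda>p q n. {x \<in> {- n<..<n}. h x < p \<and> (\<forall>d>0. \<exists>y\<in>{x-d<..<x}. q * (x - y) < \<phi> x - \<phi> y)}"
  have "AE x in lebesgue. \<forall>n::nat. \<forall>p\<in>\<rat>. \<forall>q\<in>\<rat>. 0 \<le> p \<and> p < q \<longrightarrow> x \<notin> ?B p q (real n)"
  proof (intro AE_all_countable[THEN iffD2] AE_ball_countable'[OF _ countable_rat] allI AE_impI)
    fix n :: nat and p q :: real assume "0 \<le> p \<and> p < q"
    then have "negligible (?B p q (real n))"
      using upper_left_quotient_bound[OF \<phi> h dens] by blast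
    then show "AE x in lebesgue. x \<notin> ?B p q (real n)"
      by (intro AE_not_in) (simp add: negligible_iff_null_sets)
  qed
  then show ?thesis
  proof eventually_elim
    case (elim x)
    show ?case
    proof (intro allI impI)
      fix e :: real assume "e > 0"
      obtain p where p: "p \<in> \<rat>" "h x < p" "p < h x + e / 2" using Rats_dense_in_real[of "h x" "h x + e/2"] \<open>e > 0\<close> by auto
      obtain q where q: "q \<in> \<rat>" "p < q" "q < h x + e" using Rats_dense_in_real[of p "h x + e"] p \<open>e > 0\<close> by auto
      obtain n where n: "\<bar>x\<bar> < real n" using reals_Archimedean2 by blast
      have "0 \<le> p" using h(2)[of x] p by simp
      then have "x \<notin> ?B p q (real n)" using elim p q by blast
      then obtain d where d: "d > 0" "\<And>y. y \<in> {x-d<..<x} \<Longrightarrow> \<phi> x - \<phi> y \<le> q * (x - y)"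
        using p n by (auto simp: not_less)
      have "q * (x - y) \<le> (h x + e) * (x - y)" if "y \<in> {x-d<..<x}" for y
        using q that by (intro mult_right_mono) auto
      then show "\<exists>d>0. \<forall>y\<in>{x-d<..<x}. \<phi> x - \<phi> y \<le> (h x + e) * (x - y)"
        using d by (meson order_trans)
    qed
  qed
qed

text \<open>The upper bound is used twice, for \<phi> with density h and for x - \<phi> x with
  density 1 - h; the second instance is a lower bound for the quotients of \<phi>.\<close>

proposition left_quotient_tendsto_density:
  fixes \<phi> :: "real \<Rightarrow> real"
  assumes \<phi>: "mono \<phi>" "continuous_on UNIV \<phi>" "mono (\<lambda>x. x - \<phi> x)"
  obtains h :: "real \<Rightarrow> real" where "h \<in> borel_measurable borel" "\<And>x. 0 \<le> h x" "\<And>x. h x \<le> 1"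
    "density lborel (\<lambda>x. ennreal (h x)) = interval_measure \<phi>"
    "AE x in lborel. ((\<lambda>y. (\<phi> x - \<phi> y) / (x - y)) \<longlongrightarrow> h x) (at_left x)"
proof -
  obtain h where h: "h \<in> borel_measurable borel" "\<And>x. 0 \<le> h x" "\<And>x. h x \<le> 1"
    "density lborel (\<lambda>x. ennreal (h x)) = interval_measure \<phi>"
    "density lborel (\<lambda>x. ennreal (1 - h x)) = interval_measure (\<lambda>x. x - \<phi> x)"
    using interval_measure_density[OF \<phi>] by blast
  have up: "AE x in lebesgue. \<forall>e>0. \<exists>d>0. \<forall>y\<in>{x-d<..<x}. \<phi> x - \<phi> y \<le> (h x + e) * (x - y)"
    using upper_left_quotient_AE[OF \<phi>(1,2) h(1-4)] .
  have lo: "AE x in lebesgue. \<forall>e>0. \<exists>d>0. \<forall>y\<in>{x-d<..<x}.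
      (x - \<phi> x) - (y - \<phi> y) \<le> ((1 - h x) + e) * (x - y)"
    using \<phi> h by (intro upper_left_quotient_AE) (auto intro!: continuous_intros)
  have "AE x in lebesgue. ((\<lambda>y. (\<phi> x - \<phi> y) / (x - y)) \<longlongrightarrow> h x) (at_left x)"
    using up lo
  proof eventually_elim
    case (elim x)
    show ?case
    proof (rule tendstoI)
      fix e :: real assume "e > 0"
      then have "e / 2 > 0" by simp
      obtain d1 where d1: "d1 > 0" "\<And>y. y \<in> {x-d1<..<x} \<Longrightarrow> \<phi> x - \<phi> y \<le> (h x + e / 2) * (x - y)"
        using elim(1) \<open>e / 2 > 0\<close> by meson
      obtain d2 where d2: "d2 > 0" "\<And>y. y \<in> {x-d2<..<x} \<Longrightarrow> (x - \<phi> x) - (y - \<phi> y) \<le> ((1 - h x) + e / 2) * (x - y)"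
        using elim(2) \<open>e / 2 > 0\<close> by meson
      have "\<forall>\<^sub>F y in at_left x. y \<in> {x - min d1 d2<..<x}"
        using d1(1) d2(1) by (intro eventually_at_left_real) auto
      then show "\<forall>\<^sub>F y in at_left x. dist ((\<phi> x - \<phi> y) / (x - y)) (h x) < e"
      proof eventually_elim
        case (elim y)
        then have xy: "x - y > 0" by simp
        have "(\<phi> x - \<phi> y) / (x - y) \<le> h x + e / 2"
          using d1(2)[of y] elim xy by (simp add: divide_le_eq)
        moreover have "h x - e / 2 \<le> (\<phi> x - \<phi> y) / (x - y)"
          using d2(2)[of y] elim xy by (simp add: le_divide_eq) (simp add: algebra_simps)
        ultimately show ?case using \<open>e > 0\<close> by (simp add: dist_real_def abs_le_iff abs_less_iff)
      qed
    qed
  qed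
  then have "AE x in lborel. ((\<lambda>y. (\<phi> x - \<phi> y) / (x - y)) \<longlongrightarrow> h x) (at_left x)"
    by (simp only: AE_completion_iff)
  with h show thesis using that by blast
qed

subsection \<open>Densities of Stieltjes measures\<close>

text \<open>A derivative of \<open>f\<close> with respect to \<open>g\<close> that sees only the
  past of \<open>s\<close>. The clamping to [0,1] gives bounds even where the quotients diverge and
  \<open>lim\<close> is unspecified; the inner maximum keeps the arguments in the half-line.\<close>

definition left_density :: "(real \<Rightarrow> real) \<Rightarrow> (real \<Rightarrow> real) \<Rightarrow> real \<Rightarrow> real" where
  "left_density f g s = max 0 (min 1 (lim (\<lambda>n.
     (f s - f (max 0 (s - 1 / Suc n))) / (g s - g (max 0 (s - 1 / Suc n))))))"

lemma left_density_bounds: "0 \<le> left_density f g s" "left_density f g s \<le> 1"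
  by (auto simp: left_density_def)

lemma extension_cont_mono:
  fixes f :: "real \<Rightarrow> real"
  assumes "continuous_on {0..} f" "mono_on {0..} f"
  shows "continuous_on UNIV (\<lambda>t. f (max t 0))" "mono (\<lambda>t. f (max t 0))"
proof -
  show "continuous_on UNIV (\<lambda>t. f (max t 0))"
    by (rule continuous_on_compose2[OF assms(1)]) (auto intro!: continuous_intros)
  show "mono (\<lambda>t. f (max t 0))"
    using assms(2) by (auto simp: mono_def intro!: mono_onD[OF assms(2)])
qed

lemma absolutely_continuous_stieltjes:
  fixes f g :: "real \<Rightarrow> real"
  assumes f: "continuous_on {0..} f" "mono_on {0..} f" and g: "continuous_on {0..} g"
    and gf: "mono_on {0..} (\<lambda>t. g t - f t)"
  shows "absolutely_continuous (stieltjes g) (stieltjes f)"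
proof -
  have "continuous_on {0..} (\<lambda>t. g t - f t)" using f g by (intro continuous_intros)
  note ext = extension_cont_mono[OF f] extension_cont_mono[OF this gf]
  have g': "continuous_on UNIV (\<lambda>t. g (max t 0))"
    by (rule continuous_on_compose2[OF g]) (auto intro!: continuous_intros)
  have "emeasure (interval_measure (\<lambda>t. f (max t 0))) E \<le> emeasure (interval_measure (\<lambda>t. g (max t 0))) E"
    if "E \<in> sets borel" for E
    using interval_measure_mono[OF ext(2,1) g' ext(4) that] by simp
  then show ?thesis
    unfolding absolutely_continuous_def null_sets_def stieltjes_def
    by (auto simp: sets_restrict_space emeasure_restrict_space)
       (metis borel_closed closed_atLeast le_zero_eq sets.Int)
qed

text \<open>
  The generalized inverse of \<open>g\<close>, which maps Lebesgue measure to the Stieltjes measure of \<open>g\<close>; the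
  disjunct \<open>T \<le> u\<close> makes it total.
\<close>

definition time_change :: "(real \<Rightarrow> real) \<Rightarrow> real \<Rightarrow> real \<Rightarrow> real" where
  "time_change g T x = Inf {u. 0 \<le> u \<and> (x \<le> g u \<or> T \<le> u)}"

context
  fixes g :: "real \<Rightarrow> real" and T :: real
  assumes g: "continuous_on {0..} g" "mono_on {0..} g" and T: "0 \<le> T"
begin

text \<open>The infimum is attained: continuity of \<open>g\<close> makes the set closed, and
  \<open>T\<close> belongs to it.\<close>

lemma time_change_in: "0 \<le> time_change g T x \<and> (x \<le> g (time_change g T x) \<or> T \<le> time_change g T x)"
proof -
  let ?S = "{u. 0 \<le> u \<and> (x \<le> g u \<or> T \<le> u)}"
  have "?S = ({0..} \<inter> g -` {x..}) \<union> {T..}" using T by auto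
  moreover have "closed ({0..} \<inter> g -` {x..})"
    using g(1) by (intro continuous_closed_preimage) auto
  ultimately have "closed ?S" by auto
  moreover have "T \<in> ?S" using T by simp
  moreover have "bdd_below ?S" by (rule bdd_belowI[of _ 0]) auto
  ultimately have "Inf ?S \<in> ?S" by (intro closed_contains_Inf) auto
  then show ?thesis by (auto simp: time_change_def)
qed

text \<open>The Galois connection between \<open>g\<close> and its inverse, which yields the other
  properties. For x > g T it forces the value T.\<close>

lemma time_change_le_iff:
  assumes "0 \<le> u"
  shows "time_change g T x \<le> u \<longleftrightarrow> x \<le> g u \<or> T \<le> u"
proof
  assume *: "time_change g T x \<le> u"
  then have "g (time_change g T x) \<le> g u"
    using time_change_in[of x] assms by (intro mono_onD[OF g(2)]) auto
  then show "x \<le> g u \<or> T \<le> u" using time_change_in[of x] * by auto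
next
  assume "x \<le> g u \<or> T \<le> u"
  then show "time_change g T x \<le> u"
    unfolding time_change_def using assms by (intro cInf_lower bdd_belowI[of _ 0]) auto
qed

lemma time_change_mono: "mono (time_change g T)"
proof (rule monoI)
  fix x y :: real assume "x \<le> y"
  then show "time_change g T x \<le> time_change g T y"
    using time_change_in[of y] by (subst time_change_le_iff) auto
qed

lemma time_change_measurable[measurable]: "time_change g T \<in> borel_measurable borel"
  by (rule borel_measurable_mono[OF time_change_mono])

lemma time_change_bounds: "0 \<le> time_change g T x" "time_change g T x \<le> T"
  using time_change_in[of x] time_change_le_iff[OF T, of x] by auto

text \<open>A continuous \<open>g\<close> skips no level between g 0 and g T, so the inverse is a
  right inverse there; other levels are clipped.\<close>

lemma g_time_change: "g (time_change g T x) = max (g 0) (min x (g T))"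
proof -
  let ?c = "time_change g T x"
  have gm: "g u \<le> g v" if "0 \<le> u" "u \<le> v" for u v using that by (intro mono_onD[OF g(2)]) auto
  consider "x \<le> g 0" | "g 0 < x" "x \<le> g T" | "g T < x" by linarith
  then show ?thesis
  proof cases
    case 1
    then have "?c \<le> 0" by (subst time_change_le_iff) auto
    then have "?c = 0" using time_change_bounds[of x] by simp
    then show ?thesis using 1 gm[OF order_refl T] by simp
  next
    case 2
    have "continuous_on {0..T} g" using g(1) by (rule continuous_on_subset) auto
    then obtain u where u: "0 \<le> u" "u \<le> T" "g u = x" using IVT'[of g 0 x T] 2 T by auto
    then have "?c \<le> u" by (subst time_change_le_iff) auto
    then have "g ?c \<le> x" using gm time_change_bounds[of x] u by metis
    moreover have "x \<le> g ?c" using time_change_in[of x] time_change_bounds[of x] 2 by (metis order_antisym)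
    ultimately show ?thesis using 2 by simp
  next
    case 3
    have "T \<le> ?c"
      using time_change_in[of x] time_change_bounds[of x] 3 gm[of ?c T] by linarith
    then have "?c = T" using time_change_bounds[of x] by simp
    then show ?thesis using 3 gm[OF order_refl T] by simp
  qed
qed

text \<open>By the Galois connection, the preimage of (a,b] within (g 0, g T] is a half-open
  interval whose endpoints are the values of \<open>g\<close> at a and b clipped to [0,T]. Its
  length is the mass that \<open>g\<close> gives to the part of (a,b] in (0,T].\<close>

lemma distr_time_change:
  "density (interval_measure (\<lambda>t. g (max t 0))) (indicator {0<..T}) =
   distr (density lborel (indicator {g 0<..g T})) borel (time_change g T)"
proof (rule borel_measure_eqI_Ioc)
  note ext = extension_cont_mono[OF g]
  have gm: "g u \<le> g v" if "0 \<le> u" "u \<le> v" for u v using that by (intro mono_onD[OF g(2)]) auto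
  fix a b :: real assume ab: "a \<le> b"
  define u v where "u = min (max a 0) T" and "v = min (max b 0) T"
  have uv: "0 \<le> u" "u \<le> v" "v \<le> T" using ab T by (auto simp: u_def v_def)
  have "emeasure (density (interval_measure (\<lambda>t. g (max t 0))) (indicator {0<..T})) {a<..b} =
      (\<integral>\<^sup>+x. indicator {u<..v} x \<partial>interval_measure (\<lambda>t. g (max t 0)))"
    by (subst emeasure_density)
       (auto intro!: nn_integral_cong simp: u_def v_def simp del: nn_integral_indicator split: split_indicator)
  then have L: "emeasure (density (interval_measure (\<lambda>t. g (max t 0))) (indicator {0<..T})) {a<..b} = ennreal (g v - g u)"
    using emeasure_interval_measure_Ioc_cont[OF ext(2,1) uv(2)] uv by (simp add: max_absorb1)
  have "time_change g T -` {a<..b} \<inter> {g 0<..g T} = {g u<..g v}"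
  proof -
    have "time_change g T x \<le> b \<longleftrightarrow> x \<le> g v" if x: "g 0 < x" "x \<le> g T" and that: "v = min (max b 0) T" for x b v
    proof (cases "0 \<le> b")
      case True
      then show ?thesis using x that gm[OF T] gm[of b T] by (auto simp: time_change_le_iff min_def)
    next
      case False
      then have "v = 0" using that T by simp
      then show ?thesis using x False time_change_bounds[of x] by auto
    qed
    note * = this[OF _ _ u_def] this[OF _ _ v_def]
    show ?thesis
      using * gm[OF uv(1) order_trans[OF uv(2,3)]] gm[OF order_refl uv(1)] gm[OF order_refl order_trans[OF uv(1,2)]] gm[OF order_trans[OF uv(1,2)] uv(3)]
      by (auto simp: not_le[symmetric])
  qed
  then have *: "indicator {g 0<..g T} x * indicator (time_change g T -` {a<..b}) x = (indicator {g u<..g v} x :: ennreal)" for x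
    by (auto simp: indicator_inter_arith[symmetric] Int_commute)
  have [measurable]: "time_change g T -` {a<..b} \<in> sets borel"
    using measurable_sets_borel[OF time_change_measurable, of "{a<..b}"] by simp
  have "emeasure (distr (density lborel (indicator {g 0<..g T})) borel (time_change g T)) {a<..b} =
      (\<integral>\<^sup>+x. indicator {g 0<..g T} x * indicator (time_change g T -` {a<..b}) x \<partial>lborel)"
    using time_change_measurable by (simp add: emeasure_distr emeasure_density del: nn_integral_indicator)
  also have "\<dots> = ennreal (g v - g u)"
    using gm[OF uv(1,2)] by (simp add: *)
  finally have "emeasure (distr (density lborel (indicator {g 0<..g T})) borel (time_change g T)) {a<..b} = ennreal (g v - g u)" .
  with L show "emeasure (density (interval_measure (\<lambda>t. g (max t 0))) (indicator {0<..T})) {a<..b} =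
    emeasure (distr (density lborel (indicator {g 0<..g T})) borel (time_change g T)) {a<..b}"
    by simp
  show "emeasure (density (interval_measure (\<lambda>t. g (max t 0))) (indicator {0<..T})) {a<..b} \<noteq> \<infinity>"
    using L by simp
qed simp_all

end

text \<open>The composite \<phi> of \<open>f\<close> with the inverse of \<open>g\<close> is
  Lipschitz, as increments of \<open>f\<close> are dominated by those of \<open>g\<close>, and
  \<open>g\<close> undoes its inverse. The quotients in \<open>left_density\<close> at
  \<open>time_change g T x\<close> are left quotients of \<phi> at x, which converge to the density
  of \<phi>.\<close>

lemma left_density_time_change:
  fixes f g :: "real \<Rightarrow> real"
  assumes f: "continuous_on {0..} f" "mono_on {0..} f" and g: "continuous_on {0..} g" "mono_on {0..} g"
    and gf: "mono_on {0..} (\<lambda>t. g t - f t)" and T: "0 \<le> T"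
  obtains h where "h \<in> borel_measurable borel" "\<And>x. 0 \<le> h x" "\<And>x. h x \<le> 1"
    "(LINT x|lborel. h x * indicator {g 0<..g T} x) = f T - f 0"
    "AE x in lborel. x \<in> {g 0<..g T} \<longrightarrow> left_density f g (time_change g T x) = h x"
proof -
  let ?c = "time_change g T"
  define \<phi> where "\<phi> x = f (?c x)" for x
  note tc = time_change_bounds[OF g T] g_time_change[OF g T] time_change_mono[OF g T]
  have fm: "f u \<le> f v" if "0 \<le> u" "u \<le> v" for u v using that by (intro mono_onD[OF f(2)]) auto
  have gm: "g u \<le> g v" if "0 \<le> u" "u \<le> v" for u v using that by (intro mono_onD[OF g(2)]) auto
  have gfm: "f v - f u \<le> g v - g u" if "0 \<le> u" "u \<le> v" for u v
    using mono_onD[OF gf, of u v] that by auto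
  have \<phi>: "mono \<phi>" using tc fm by (auto simp: \<phi>_def mono_def)
  have lip: "\<phi> y - \<phi> x \<le> y - x" if "x \<le> y" for x y
  proof -
    have "\<phi> y - \<phi> x \<le> g (?c y) - g (?c x)"
      unfolding \<phi>_def using that tc by (intro gfm) (auto simp: mono_def)
    also have "\<dots> \<le> y - x" using that gm[OF order_refl T] by (simp add: tc(3))
    finally show ?thesis .
  qed
  then have \<phi>': "mono (\<lambda>x. x - \<phi> x)" by (auto simp: mono_def algebra_simps)
  have "1-lipschitz_on UNIV \<phi>"
  proof (rule lipschitz_onI)
    fix x y :: real
    show "dist (\<phi> x) (\<phi> y) \<le> 1 * dist x y"
      using lip[of x y] lip[of y x] monoD[OF \<phi>, of x y] monoD[OF \<phi>, of y x]
      by (cases "x \<le> y") (auto simp: dist_real_def)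
  qed simp
  then have \<phi>c: "continuous_on UNIV \<phi>" by (rule lipschitz_on_continuous_on)
  \<comment> \<open>The first time that \<open>g\<close> reaches g u may lie before u, but
    \<open>g\<close> is flat in between, and \<open>f\<close>, having smaller increments, is flat
    there too.\<close>
  have \<phi>g: "\<phi> (g u) = f u" if "0 \<le> u" "u \<le> T" for u
  proof -
    have "?c (g u) \<le> u" using that by (subst time_change_le_iff[OF g T]) auto
    moreover have "g (?c (g u)) = g u" using gm[of 0 u] gm[of u T] that by (simp add: tc(3))
    ultimately show ?thesis using gfm[of "?c (g u)" u] fm[of "?c (g u)" u] tc(1) by (simp add: \<phi>_def)
  qed
  obtain h where h: "h \<in> borel_measurable borel" "\<And>x. 0 \<le> h x" "\<And>x. h x \<le> 1"
    "density lborel (\<lambda>x. ennreal (h x)) = interval_measure \<phi>"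
    "AE x in lborel. ((\<lambda>y. (\<phi> x - \<phi> y) / (x - y)) \<longlongrightarrow> h x) (at_left x)"
    using left_quotient_tendsto_density[OF \<phi> \<phi>c \<phi>'] by blast
  show thesis
  proof (rule that[OF h(1-3)])
    have "(LINT x|lborel. h x * indicator {g 0<..g T} x) = (LINT x|density lborel (\<lambda>x. ennreal (h x)). indicator {g 0<..g T} x)"
      using h by (subst integral_density) auto
    also have "\<dots> = measure (interval_measure \<phi>) {g 0<..g T}" by (simp add: h(4))
    also have "\<dots> = \<phi> (g T) - \<phi> (g 0)"
      using emeasure_interval_measure_Ioc_cont[OF \<phi> \<phi>c gm[OF order_refl T]] monoD[OF \<phi> gm[OF order_refl T]]
      by (simp add: measure_def)
    finally show "(LINT x|lborel. h x * indicator {g 0<..g T} x) = f T - f 0" using \<phi>g T by simp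
    show "AE x in lborel. x \<in> {g 0<..g T} \<longrightarrow> left_density f g (?c x) = h x"
      using h(5)
    proof (eventually_elim, intro impI)
      fix x assume lim: "((\<lambda>y. (\<phi> x - \<phi> y) / (x - y)) \<longlongrightarrow> h x) (at_left x)" and x: "x \<in> {g 0<..g T}"
      define b where "b n = max 0 (?c x - 1 / Suc n)" for n
      have gc: "g (?c x) = x" using x by (simp add: tc(3))
      have pos: "?c x > 0" using gc x tc(1)[of x] by (cases "?c x = 0") auto
      have b: "0 \<le> b n" "b n < ?c x" for n using pos by (auto simp: b_def)
      have "(\<lambda>n. max 0 (?c x - 1 / Suc n)) \<longlonglongrightarrow> max 0 (?c x - 0)"
        by (intro tendsto_intros LIMSEQ_Suc[OF lim_1_over_n])
      then have "b \<longlonglongrightarrow> ?c x" using pos by (simp add: b_def[abs_def])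
      then have "(\<lambda>n. g (b n)) \<longlonglongrightarrow> g (?c x)"
        using b pos by (intro continuous_on_tendsto_compose[OF g(1)]) (auto intro!: always_eventually)
      \<comment> \<open>Strict, because the time change is the first time that \<open>g\<close>
        reaches x; so no denominator vanishes and x is approached from the left.\<close>
      moreover have "g (b n) < x" for n
        using b[of n] time_change_le_iff[OF g T b(1), of x n] by auto
      ultimately have "filterlim (\<lambda>n. g (b n)) (at_left x) sequentially"
        using gc by (auto simp: filterlim_at less_imp_neq intro!: always_eventually)
      then have "(\<lambda>n. (\<phi> x - \<phi> (g (b n))) / (x - g (b n))) \<longlonglongrightarrow> h x"
        by (rule filterlim_compose[OF lim])
      moreover have "\<phi> x = f (?c x)" by (simp add: \<phi>_def)
      moreover have "\<phi> (g (b n)) = f (b n)" for n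
        using b[of n] tc(2)[of x] by (intro \<phi>g) auto
      ultimately have "(\<lambda>n. (f (?c x) - f (b n)) / (g (?c x) - g (b n))) \<longlonglongrightarrow> h x"
        using gc by simp
      then have "lim (\<lambda>n. (f (?c x) - f (b n)) / (g (?c x) - g (b n))) = h x" by (rule limI)
      then show "left_density f g (?c x) = h x"
        using h(2,3)[of x] by (simp add: left_density_def b_def)
    qed
  qed
qed

lemma left_density_measurable:
  fixes f g :: "real \<Rightarrow> real"
  assumes f: "continuous_on {0..} f" and g: "continuous_on {0..} g"
  shows "(\<lambda>s. left_density f g (max s 0)) \<in> borel_measurable borel"
proof -
  have "(\<lambda>s. F (max 0 (max s 0 - r))) \<in> borel_measurable borel" "(\<lambda>s. F (max s 0)) \<in> borel_measurable borel"
    if "continuous_on {0..} F" for F :: "real \<Rightarrow> real" and r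
    by (intro borel_measurable_continuous_onI continuous_on_compose2[OF that] continuous_intros; force)+
  note [measurable] = this[OF f] this[OF g]
  show ?thesis unfolding left_density_def by measurable
qed

text \<open>The inverse of \<open>g\<close> carries the integral to Lebesgue measure on (g 0, g T],
  where \<open>left_density\<close> becomes \<open>h\<close> almost everywhere; the integral of
  \<open>h\<close> is the increment of \<open>f\<close>.\<close>

proposition stieltjes_left_density:
  fixes f g :: "real \<Rightarrow> real"
  assumes f: "continuous_on {0..} f" "mono_on {0..} f" and g: "continuous_on {0..} g" "mono_on {0..} g"
    and gf: "mono_on {0..} (\<lambda>t. g t - f t)" and T: "0 \<le> T"
  shows "(LINT s:{0..T}|stieltjes g. left_density f g s) = f T - f 0"
proof -
  let ?G = "interval_measure (\<lambda>t. g (max t 0))"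
  let ?c = "time_change g T"
  define \<theta> where "\<theta> s = left_density f g (max s 0)" for s
  have [measurable]: "\<theta> \<in> borel_measurable borel"
    unfolding \<theta>_def using f g by (intro left_density_measurable)
  note [measurable] = time_change_measurable[OF g T]
  obtain h where h: "h \<in> borel_measurable borel" "\<And>x. 0 \<le> h x" "\<And>x. h x \<le> 1"
    "(LINT x|lborel. h x * indicator {g 0<..g T} x) = f T - f 0"
    "AE x in lborel. x \<in> {g 0<..g T} \<longrightarrow> left_density f g (?c x) = h x"
    using left_density_time_change[OF f g gf T] by blast
  have [measurable]: "h \<in> borel_measurable borel" by fact
  \<comment> \<open>The point 0 has no mass, so [0,T] may be replaced by (0,T], the set that the
    image measure describes.\<close>
  have z: "emeasure ?G {0..0} = 0"
    using extension_cont_mono[OF g] by (subst emeasure_interval_measure_Icc) (auto simp: mono_def)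
  have z: "AE s in ?G. s \<noteq> 0"
    by (rule AE_I[where N = "{0}"]) (use z in auto)
  have "(LINT s:{0..T}|stieltjes g. left_density f g s) =
    (LINT s|?G. indicator {0..} s *\<^sub>R indicator {0..T} s *\<^sub>R left_density f g s)"
    unfolding stieltjes_def set_lebesgue_integral_def by (subst integral_restrict_space) auto
  also have "\<dots> = (LINT s|?G. indicator {0..T} s *\<^sub>R \<theta> s)"
    by (intro Bochner_Integration.integral_cong) (auto simp: \<theta>_def split: split_indicator)
  also have "\<dots> = (LINT s|?G. indicator {0<..T} s *\<^sub>R \<theta> s)"
    using z by (intro integral_cong_AE) (auto split: split_indicator)
  also have "\<dots> = (LINT s|density ?G (indicator {0<..T}). \<theta> s)"
    using integral_density[of \<theta> ?G "indicator {0<..T}"] by (simp add: ennreal_indicator)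
  also have "\<dots> = (LINT x|density lborel (indicator {g 0<..g T}). \<theta> (?c x))"
    unfolding distr_time_change[OF g T] by (subst integral_distr) auto
  also have "\<dots> = (LINT x|lborel. indicator {g 0<..g T} x *\<^sub>R \<theta> (?c x))"
    using integral_density[of "\<lambda>x. \<theta> (?c x)" lborel "indicator {g 0<..g T}"] by (simp add: ennreal_indicator)
  also have "\<dots> = (LINT x|lborel. h x * indicator {g 0<..g T} x)"
  proof (rule integral_cong_AE)
    show "AE x in lborel. indicator {g 0<..g T} x *\<^sub>R \<theta> (?c x) = h x * indicator {g 0<..g T} x"
      using h(5) time_change_bounds(1)[OF g T]
      by (auto simp: \<theta>_def max_absorb1 split: split_indicator)
  qed auto
  finally show ?thesis using h(4) by simp
qed

subsection \<open>The hysteresis weight along a path\<close>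

text \<open>The condition does not look at time \<open>t\<close> itself, so a large excursion that
  ends at \<open>t\<close> still counts. The weight therefore jumps up only just after a zero, which
  makes it left-continuous.\<close>

definition hysteresis :: "real \<Rightarrow> (real \<Rightarrow> real) \<Rightarrow> real \<Rightarrow> real" where
  "hysteresis \<epsilon> x t = (if \<exists>s\<ge>0. s < t \<and> \<epsilon> < \<bar>x s\<bar> \<and> (\<forall>u\<in>{s..<t}. x u \<noteq> 0) then 0 else 1)"

lemma hysteresis_cases: "hysteresis \<epsilon> x t = 0 \<or> hysteresis \<epsilon> x t = 1"
  by (simp add: hysteresis_def)

lemma hysteresis_bounds: "0 \<le> hysteresis \<epsilon> x t" "hysteresis \<epsilon> x t \<le> 1"
  by (auto simp: hysteresis_def)

lemma hysteresis_eq_0D: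
  assumes "hysteresis \<epsilon> x t = 0"
  obtains s where "0 \<le> s" "s < t" "\<epsilon> < \<bar>x s\<bar>" "\<And>u. s \<le> u \<Longrightarrow> u < t \<Longrightarrow> x u \<noteq> 0"
  using assms unfolding hysteresis_def by (auto split: if_splits)

lemma hysteresis_eq_0I:
  assumes "0 \<le> s" "s < t" "\<epsilon> < \<bar>x s\<bar>" "\<And>u. s \<le> u \<Longrightarrow> u < t \<Longrightarrow> x u \<noteq> 0"
  shows "hysteresis \<epsilon> x t = 0"
  using assms unfolding hysteresis_def by auto

lemma continuous_on_halfline_near_left:
  fixes x :: "real \<Rightarrow> real"
  assumes x: "continuous_on {0..} x" and t: "0 < t" and e: "0 < e"
  obtains s where "0 \<le> s" "s < t" "\<And>u. s \<le> u \<Longrightarrow> u \<le> t \<Longrightarrow> \<bar>x u - x t\<bar> < e"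
proof -
  obtain d where d: "d > 0" "\<And>u. 0 \<le> u \<Longrightarrow> dist u t < d \<Longrightarrow> dist (x u) (x t) < e"
    using x t e unfolding continuous_on_iff by (metis atLeast_iff less_imp_le)
  show thesis
    by (rule that[of "max 0 (t - d / 2)"]) (use d t in \<open>auto simp: dist_real_def max_def split: if_splits\<close>)
qed

text \<open>A weight 0 extends to the left as far as its witness. If the weight at t is 1 and x t =
  0, then |x| < \<epsilon> just before t, so no new witness arises there and a zero must have
  cancelled any old one. If x t is nonzero, a witness for a time shortly before t would also be one
  for t.\<close>

lemma hysteresis_left_continuous:
  fixes x :: "real \<Rightarrow> real"
  assumes x: "continuous_on {0..} x" and \<epsilon>: "0 < \<epsilon>" and t: "0 < t"
  shows "(hysteresis \<epsilon> x \<longlongrightarrow> hysteresis \<epsilon> x t) (at_left t)"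
proof -
  have "\<exists>s<t. \<forall>u\<in>{s<..<t}. hysteresis \<epsilon> x u = hysteresis \<epsilon> x t"
  proof (cases "hysteresis \<epsilon> x t = 0")
    case True
    then obtain s where s: "0 \<le> s" "s < t" "\<epsilon> < \<bar>x s\<bar>" "\<And>u. s \<le> u \<Longrightarrow> u < t \<Longrightarrow> x u \<noteq> 0"
      by (rule hysteresis_eq_0D) blast
    then have "hysteresis \<epsilon> x u = 0" if "u \<in> {s<..<t}" for u
      using that by (intro hysteresis_eq_0I[of s]) auto
    then show ?thesis using s True by auto
  next
    case False
    then have 1: "hysteresis \<epsilon> x t = 1" using hysteresis_cases by blast
    show ?thesis
    proof (cases "x t = 0")
      case True
      obtain s where s: "0 \<le> s" "s < t" "\<And>u. s \<le> u \<Longrightarrow> u \<le> t \<Longrightarrow> \<bar>x u - x t\<bar> < \<epsilon>"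
        using continuous_on_halfline_near_left[OF x t \<epsilon>] by blast
      show ?thesis
      proof (cases "\<exists>v\<in>{s<..<t}. hysteresis \<epsilon> x v = 0")
        case True
        then obtain v where v: "s < v" "v < t" "hysteresis \<epsilon> x v = 0" by auto
        obtain s' where s': "0 \<le> s'" "s' < v" "\<epsilon> < \<bar>x s'\<bar>" "\<And>u. s' \<le> u \<Longrightarrow> u < v \<Longrightarrow> x u \<noteq> 0"
          using v(3) by (rule hysteresis_eq_0D) blast
        \<comment> \<open>The witness \<open>s'\<close> for v fails at t, so x has a zero z in
          between. A witness for a time after z would have to lie beyond z, where |x| <
          \<epsilon>.\<close>
        obtain z where z: "s' \<le> z" "z < t" "x z = 0"
          using hysteresis_eq_0I[of s' t \<epsilon> x] s' v 1 by force
        have "v \<le> z" using s'(4)[of z] z by force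
        have "hysteresis \<epsilon> x u = 1" if "u \<in> {z<..<t}" for u
        proof (rule ccontr)
          assume "hysteresis \<epsilon> x u \<noteq> 1"
          then have "hysteresis \<epsilon> x u = 0" using hysteresis_cases by blast
          then obtain r where r: "0 \<le> r" "r < u" "\<epsilon> < \<bar>x r\<bar>" "\<And>w. r \<le> w \<Longrightarrow> w < u \<Longrightarrow> x w \<noteq> 0"
            by (rule hysteresis_eq_0D) blast
          have "r < s" using r s(3)[of r] \<open>x t = 0\<close> that by force
          then show False using r(4)[of z] z that \<open>v \<le> z\<close> v by auto
        qed
        then show ?thesis using z 1 by auto
      next
        case False
        then show ?thesis using s 1 hysteresis_cases by (metis)
      qed
    next
      case False
      then have "\<bar>x t\<bar> > 0" by simp
      then obtain s where s: "0 \<le> s" "s < t" "\<And>u. s \<le> u \<Longrightarrow> u \<le> t \<Longrightarrow> \<bar>x u - x t\<bar> < \<bar>x t\<bar>"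
        using continuous_on_halfline_near_left[OF x t] by blast
      have "hysteresis \<epsilon> x u = 1" if u: "u \<in> {s<..<t}" for u
      proof (rule ccontr)
        assume "hysteresis \<epsilon> x u \<noteq> 1"
        then have "hysteresis \<epsilon> x u = 0" using hysteresis_cases by blast
        then obtain r where r: "0 \<le> r" "r < u" "\<epsilon> < \<bar>x r\<bar>" "\<And>w. r \<le> w \<Longrightarrow> w < u \<Longrightarrow> x w \<noteq> 0"
          by (rule hysteresis_eq_0D) blast
        have "x w \<noteq> 0" if "r \<le> w" "w < t" for w
          using r(4)[of w] s(3)[of w] u that by (cases "w < u") auto
        then have "hysteresis \<epsilon> x t = 0" using r u by (intro hysteresis_eq_0I[of r]) auto
        then show False using 1 by simp
      qed
      then show ?thesis using s 1 by auto
    qed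
  qed
  then obtain s where s: "s < t" "\<And>u. u \<in> {s<..<t} \<Longrightarrow> hysteresis \<epsilon> x u = hysteresis \<epsilon> x t" by blast
  show ?thesis
    using eventually_at_left_real[OF s(1)] by (intro tendsto_eventually) (auto elim!: eventually_mono intro: s(2))
qed

text \<open>Just before t the path stays nonzero with modulus above |x t| / 2, so a single time is a
  witness for all thresholds below |x t| / 2.\<close>

lemma hysteresis_tendsto_0:
  fixes x :: "real \<Rightarrow> real"
  assumes x: "continuous_on {0..} x" and t: "0 < t" and "x t \<noteq> 0"
  shows "(\<lambda>m. hysteresis (1 / Suc m) x t) \<longlonglongrightarrow> 0"
proof -
  have "\<bar>x t\<bar> / 2 > 0" using assms by simp
  then obtain s where s: "0 \<le> s" "s < t" "\<And>u. s \<le> u \<Longrightarrow> u \<le> t \<Longrightarrow> \<bar>x u - x t\<bar> < \<bar>x t\<bar> / 2"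
    using continuous_on_halfline_near_left[OF x t] by blast
  have "\<forall>\<^sub>F m in sequentially. 1 / Suc m < \<bar>x t\<bar> / 2"
    using LIMSEQ_Suc[OF lim_1_over_n] \<open>\<bar>x t\<bar> / 2 > 0\<close> by (rule order_tendstoD)
  then have "\<forall>\<^sub>F m in sequentially. hysteresis (1 / Suc m) x t = 0"
  proof eventually_elim
    case (elim m)
    have "x u \<noteq> 0" if "s \<le> u" "u < t" for u using s(3)[of u] that assms by auto
    moreover have "1 / Suc m < \<bar>x s\<bar>" using s(3)[of s] s(2) elim by linarith
    ultimately show ?case using s by (intro hysteresis_eq_0I[of s]) auto
  qed
  then show ?thesis by (rule tendsto_eventually)
qed

section \<open>Left-endpoint sums on uniform grids\<close>

definition grid :: "real \<Rightarrow> real \<Rightarrow> nat \<Rightarrow> nat \<Rightarrow> real" where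
  "grid a b n k = a + (b - a) * real k / real (Suc n)"

definition riemann_sum :: "real \<Rightarrow> real \<Rightarrow> nat \<Rightarrow> (real \<Rightarrow> real) \<Rightarrow> (real \<Rightarrow> real) \<Rightarrow> real" where
  "riemann_sum a b n W g =
     (\<Sum>k<Suc n. W (grid a b n k) * (g (grid a b n (Suc k)) - g (grid a b n k)))"

lemma grid_0 [simp]: "grid a b n 0 = a"
  by (simp add: grid_def)

lemma grid_Suc_n [simp]: "grid a b n (Suc n) = b"
  by (simp add: grid_def del: of_nat_Suc)

lemma grid_Suc: "grid a b n (Suc k) = grid a b n k + (b - a) / real (Suc n)"
  by (simp add: grid_def field_simps add_divide_distrib[symmetric] del: of_nat_Suc) (simp add: algebra_simps)

lemma grid_less: "a < b \<Longrightarrow> k < l \<Longrightarrow> grid a b n k < grid a b n l"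
  by (simp add: grid_def divide_strict_right_mono del: of_nat_Suc)

lemma grid_le: "a < b \<Longrightarrow> k \<le> l \<Longrightarrow> grid a b n k \<le> grid a b n l"
  using grid_less[of a b k l n] by (cases "k = l") auto

lemma grid_bounds: "a < b \<Longrightarrow> a \<le> grid a b n k" "a < b \<Longrightarrow> k \<le> Suc n \<Longrightarrow> grid a b n k \<le> b"
  using grid_le[of a b 0 k n] grid_le[of a b k "Suc n" n] by auto

lemma riemann_sum_const: "riemann_sum a b n (\<lambda>_. c) g = c * (g b - g a)"
  using sum_lessThan_telescope[of "\<lambda>k. g (grid a b n k)" "Suc n"]
  by (simp add: riemann_sum_def sum_distrib_left[symmetric])

text \<open>Between two such cells x travels from 0 to beyond \<epsilon>, which by uniform
  continuity takes at least a time \<eta> independent of the grid. So the left endpoints of these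
  cells are \<eta>-separated.\<close>

lemma card_hysteresis_switches:
  fixes x :: "real \<Rightarrow> real"
  assumes x: "continuous_on {0..} x" and \<epsilon>: "0 < \<epsilon>" and ab: "0 \<le> a" "a < b"
  obtains N where "\<And>n. card {k. k < Suc n \<and> hysteresis \<epsilon> x (grid a b n k) = 0 \<and>
    (\<exists>z\<in>{grid a b n k..<grid a b n (Suc k)}. x z = 0)} \<le> N"
proof -
  have "uniformly_continuous_on {0..b} x"
    using x by (intro compact_uniformly_continuous) (auto intro: continuous_on_subset)
  then obtain \<eta> where \<eta>: "\<eta> > 0" "\<And>u v. u \<in> {0..b} \<Longrightarrow> v \<in> {0..b} \<Longrightarrow> dist u v < \<eta> \<Longrightarrow> dist (x u) (x v) < \<epsilon>"
    using \<epsilon> unfolding uniformly_continuous_on_def by metis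
  show thesis
  proof (rule that[of "card {..nat \<lfloor>b / \<eta>\<rfloor>}"])
    fix n
    let ?t = "grid a b n"
    let ?S = "{k. k < Suc n \<and> hysteresis \<epsilon> x (?t k) = 0 \<and> (\<exists>z\<in>{?t k..<?t (Suc k)}. x z = 0)}"
    \<comment> \<open>Points at distance at least \<eta> have different values of floor (t /
      \<eta>), and in [0,b] only finitely many values occur.\<close>
    let ?f = "\<lambda>k. nat \<lfloor>?t k / \<eta>\<rfloor>"
    have t0: "0 \<le> ?t k" for k using grid_bounds(1)[OF ab(2), of n k] ab by linarith
    have "?f k < ?f k'" if kk: "k \<in> ?S" "k' \<in> ?S" "k < k'" for k k'
    proof -
      obtain z where z: "?t k \<le> z" "z < ?t (Suc k)" "x z = 0" using kk(1) by auto
      obtain s where s: "0 \<le> s" "s < ?t k'" "\<epsilon> < \<bar>x s\<bar>" "\<And>u. s \<le> u \<Longrightarrow> u < ?t k' \<Longrightarrow> x u \<noteq> 0"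
        using kk(2) by (auto elim: hysteresis_eq_0D)
      have "?t (Suc k) \<le> ?t k'" using kk ab by (intro grid_le) auto
      then have "z < s" using s(4)[of z] z by force
      have "\<not> dist s z < \<eta>"
      proof
        assume "dist s z < \<eta>"
        moreover have "?t k' \<le> b" using kk ab by (intro grid_bounds) auto
        ultimately have "dist (x s) (x z) < \<epsilon>"
          using s \<open>z < s\<close> z t0[of k] by (intro \<eta>(2)) auto
        then show False using s z by (simp add: dist_real_def)
      qed
      then have "?t k + \<eta> \<le> ?t k'" using \<open>z < s\<close> z s by (simp add: dist_real_def)
      then have "?t k / \<eta> + 1 \<le> ?t k' / \<eta>" using \<eta>(1) divide_right_mono[of "?t k + \<eta>" "?t k'" \<eta>]
        by (simp add: add_divide_distrib)
      then have "\<lfloor>?t k / \<eta>\<rfloor> + 1 \<le> \<lfloor>?t k' / \<eta>\<rfloor>" by linarith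
      moreover have "0 \<le> \<lfloor>?t k / \<eta>\<rfloor>" using t0[of k] \<eta>(1) by simp
      ultimately show ?thesis by (simp only: zless_nat_conj) linarith
    qed
    note less = this
    have "inj_on ?f ?S"
    proof (rule linorder_inj_onI)
      show "?f k \<noteq> ?f k'" if "k < k'" "k \<in> ?S" "k' \<in> ?S" for k k'
        using less[OF that(2,3,1)] by (rule less_imp_neq)
    qed linarith
    moreover have "?f ` ?S \<subseteq> {..nat \<lfloor>b / \<eta>\<rfloor>}"
      using grid_bounds(2)[OF ab(2), of _ n] \<eta>(1)
      by (auto intro!: nat_mono floor_mono divide_right_mono)
    ultimately show "card ?S \<le> card {..nat \<lfloor>b / \<eta>\<rfloor>}" by (intro card_inj_on_le) auto
  qed
qed

lemma continuous_on_grid_increments: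
  fixes g :: "real \<Rightarrow> real"
  assumes g: "continuous_on {0..} g" and ab: "0 \<le> a" "a < b" and e: "0 < e"
  shows "\<forall>\<^sub>F n in sequentially. \<forall>k<Suc n. \<forall>u\<in>{grid a b n k..grid a b n (Suc k)}. \<forall>v\<in>{grid a b n k..grid a b n (Suc k)}. \<bar>g u - g v\<bar> < e"
proof -
  have "uniformly_continuous_on {a..b} g"
    using g ab by (intro compact_uniformly_continuous) (auto intro: continuous_on_subset)
  then obtain \<eta> where \<eta>: "\<eta> > 0" "\<And>u v. u \<in> {a..b} \<Longrightarrow> v \<in> {a..b} \<Longrightarrow> dist u v < \<eta> \<Longrightarrow> dist (g u) (g v) < e"
    using e unfolding uniformly_continuous_on_def by metis
  have "(\<lambda>n. (b - a) / real (Suc n)) \<longlonglongrightarrow> 0"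
    by (intro LIMSEQ_Suc lim_const_over_n)
  then have "\<forall>\<^sub>F n in sequentially. (b - a) / real (Suc n) < \<eta>"
    using \<eta>(1) by (rule order_tendstoD)
  then show ?thesis
  proof eventually_elim
    case (elim n)
    show ?case
    proof (intro allI ballI impI)
      fix k u v assume k: "k < Suc n" and uv: "u \<in> {grid a b n k..grid a b n (Suc k)}" "v \<in> {grid a b n k..grid a b n (Suc k)}"
      have "a \<le> grid a b n k" "grid a b n (Suc k) \<le> b" using k ab by (auto intro!: grid_bounds)
      then have "dist (g u) (g v) < e"
        using uv elim by (intro \<eta>(2)) (auto simp: grid_Suc dist_real_def abs_less_iff)
      then show "\<bar>g u - g v\<bar> < e" by (simp add: dist_real_def)
    qed
  qed
qed

text \<open>
  The weight \<open>hysteresis \<epsilon> x\<close> jumps up at zeros of \<open>x\<close>, where \<open>D\<close> vanishes, so summation by parts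
  bounds the integral of the weight against \<open>D\<close> from below; and \<open>p\<close> only moves while the weight is 1.
\<close>

lemma hysteresis_riemann_sum_ineq:
  fixes x D p q iX iY :: "real \<Rightarrow> real"
  assumes x: "continuous_on {0..} x" and \<epsilon>: "0 < \<epsilon>" and ab: "0 \<le> a" "a < b"
    and D: "continuous_on {0..} D" "\<And>t. 0 \<le> t \<Longrightarrow> 0 \<le> D t" "\<And>t. 0 \<le> t \<Longrightarrow> x t = 0 \<Longrightarrow> D t = 0"
    and p: "continuous_on {0..} p"
      "\<And>u v. 0 \<le> u \<Longrightarrow> u < v \<Longrightarrow> (\<And>w. u < w \<Longrightarrow> w < v \<Longrightarrow> x w \<noteq> 0) \<Longrightarrow> p u = p v"
    and q: "mono_on {0..} q"
    and dec: "\<And>t. 0 \<le> t \<Longrightarrow> q t - p t = D t - iY t + iX t + c"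
    and r: "strict_mono r"
    and lX: "(\<lambda>n. riemann_sum a b (r n) (hysteresis \<epsilon> x) iX) \<longlonglongrightarrow> lX"
    and lY: "(\<lambda>n. riemann_sum a b (r n) (hysteresis \<epsilon> x) iY) \<longlonglongrightarrow> lY"
  shows "lX - lY - hysteresis \<epsilon> x a * D a \<le> (q b - p b) - (q a - p a)"
proof (rule field_le_epsilon)
  fix e :: real assume "0 < e"
  let ?W = "hysteresis \<epsilon> x"
  obtain N where N: "\<And>n. card {k. k < Suc n \<and> ?W (grid a b n k) = 0 \<and>
    (\<exists>z\<in>{grid a b n k..<grid a b n (Suc k)}. x z = 0)} \<le> N"
    using card_hysteresis_switches[OF x \<epsilon> ab] by blast
  \<comment> \<open>At most N cells lie in \<open>S\<close>, and each costs at most e' twice, once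
    for \<open>D\<close> and once for \<open>p\<close>.\<close>
  define e' where "e' = e / (2 * real (Suc N))"
  have e': "e' > 0" using \<open>0 < e\<close> by (simp add: e'_def)
  have Ne: "2 * (real N * e') \<le> e" using \<open>0 < e\<close> by (simp add: e'_def field_simps)
  have W: "0 \<le> ?W t" "?W t \<le> 1" for t by (auto simp: hysteresis_bounds)
  have main: "\<forall>\<^sub>F n in sequentially. riemann_sum a b n ?W iX - riemann_sum a b n ?W iY - ?W a * D a
     \<le> (q b - p b) - (q a - p a) + e"
    using continuous_on_grid_increments[OF D(1) ab e'] continuous_on_grid_increments[OF p(1) ab e']
  proof eventually_elim
    case (elim n)
    let ?t = "grid a b n"
    \<comment> \<open>The only cells across which the weight can switch from 0 to 1.\<close>
    define S where "S = {k. k < Suc n \<and> ?W (?t k) = 0 \<and> (\<exists>z\<in>{?t k..<?t (Suc k)}. x z = 0)}"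
    have S: "finite S" "S \<subseteq> {..<Suc n}" "card S \<le> N" using N[of n] by (auto simp: S_def)
    have t0: "0 \<le> ?t k" for k using grid_bounds(1)[OF ab(2), of n k] ab by linarith
    have ts: "?t k < ?t (Suc k)" for k using ab by (intro grid_less) auto
    have SN: "(\<Sum>k<Suc n. if k \<in> S then e' else 0) \<le> real N * e'"
    proof -
      have "(\<Sum>k<Suc n. if k \<in> S then e' else 0) = (\<Sum>k\<in>S. e')"
        using S by (intro sum.mono_neutral_cong_right) auto
      also have "\<dots> \<le> real N * e'" using S(3) e' by (simp add: mult_right_mono)
      finally show ?thesis .
    qed
    have "- (\<Sum>k<Suc n. if k \<in> S then e' else 0) - ?W a * D a \<le> riemann_sum a b n ?W D"
    proof -
      \<comment> \<open>Summation by parts. The boundary term at b is nonnegative, and as D \<ge> 0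
        only upward jumps of the weight count against the bound.\<close>
      have "riemann_sum a b n ?W D = (\<Sum>k<Suc n. ?W (?t (Suc k)) * D (?t (Suc k)) - ?W (?t k) * D (?t k))
          - (\<Sum>k<Suc n. (?W (?t (Suc k)) - ?W (?t k)) * D (?t (Suc k)))"
        unfolding riemann_sum_def sum_subtractf[symmetric] by (intro sum.cong) (auto simp: algebra_simps)
      also have "(\<Sum>k<Suc n. ?W (?t (Suc k)) * D (?t (Suc k)) - ?W (?t k) * D (?t k)) = ?W b * D b - ?W a * D a"
        by (subst sum_lessThan_telescope) simp
      finally have 1: "riemann_sum a b n ?W D = ?W b * D b - ?W a * D a
          - (\<Sum>k<Suc n. (?W (?t (Suc k)) - ?W (?t k)) * D (?t (Suc k)))" .
      have 2: "(\<Sum>k<Suc n. (?W (?t (Suc k)) - ?W (?t k)) * D (?t (Suc k))) \<le> (\<Sum>k<Suc n. if k \<in> S then e' else 0)"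
      proof (rule sum_mono)
        fix k assume k: "k \<in> {..<Suc n}"
        have D0: "0 \<le> D (?t (Suc k))" using D(2) t0 by blast
        show "(?W (?t (Suc k)) - ?W (?t k)) * D (?t (Suc k)) \<le> (if k \<in> S then e' else 0)"
        proof (cases "k \<in> S")
          case True
          then obtain z where z: "?t k \<le> z" "z < ?t (Suc k)" "x z = 0" by (auto simp: S_def)
          have "\<bar>D (?t (Suc k)) - D z\<bar> < e'" using elim(1) k z ts[of k] by auto
          moreover have "D z = 0" using D(3)[of z] z t0[of k] by simp
          ultimately have "D (?t (Suc k)) \<le> e'" by linarith
          moreover have "(?W (?t (Suc k)) - ?W (?t k)) * D (?t (Suc k)) \<le> 1 * D (?t (Suc k))"
            using D0 W(1)[of "?t k"] W(2)[of "?t (Suc k)"] by (intro mult_right_mono) auto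
          ultimately show ?thesis using True by simp
        next
          case False
          \<comment> \<open>Without a zero in the cell, a witness for weight 0 at its left end is
            still a witness at its right end.\<close>
          have "?W (?t (Suc k)) \<le> ?W (?t k)"
          proof (cases "?W (?t k) = 0")
            case True
            then obtain s where s: "0 \<le> s" "s < ?t k" "\<epsilon> < \<bar>x s\<bar>" "\<And>u. s \<le> u \<Longrightarrow> u < ?t k \<Longrightarrow> x u \<noteq> 0"
              by (rule hysteresis_eq_0D) blast
            have "x u \<noteq> 0" if "?t k \<le> u" "u < ?t (Suc k)" for u
              using False True k that by (auto simp: S_def)
            then have "x u \<noteq> 0" if "s \<le> u" "u < ?t (Suc k)" for u using s(4)[of u] that by force
            then have "?W (?t (Suc k)) = 0" using s ts[of k] by (intro hysteresis_eq_0I[of s]) auto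
            then show ?thesis using True by simp
          next
            case False
            then have "?W (?t k) = 1" using hysteresis_cases by blast
            then show ?thesis using W by simp
          qed
          then show ?thesis using False D0 by (simp add: mult_nonpos_nonneg)
        qed
      qed
      have "0 \<le> ?W b * D b" using W(1)[of b] D(2)[of b] ab by simp
      with 1 2 show ?thesis by linarith
    qed
    \<comment> \<open>Only cells with weight 0 lose an increment of \<open>p\<close>: without a zero
      in the cell \<open>p\<close> is constant there, and in a cell of \<open>S\<close> it moves by
      less than e'.\<close>
    moreover have "p b - p a - (\<Sum>k<Suc n. if k \<in> S then e' else 0) \<le> riemann_sum a b n ?W p"
    proof -
      have "p b - p a - (\<Sum>k<Suc n. if k \<in> S then e' else 0) =
        (\<Sum>k<Suc n. p (?t (Suc k)) - p (?t k) - (if k \<in> S then e' else 0))"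
        by (simp only: sum_subtractf[of "\<lambda>k. p (?t (Suc k)) - p (?t k)"] sum_lessThan_telescope[of "\<lambda>k. p (?t k)"] grid_0 grid_Suc_n)
      also have "\<dots> \<le> riemann_sum a b n ?W p"
        unfolding riemann_sum_def
      proof (rule sum_mono)
        fix k assume k: "k \<in> {..<Suc n}"
        show "p (?t (Suc k)) - p (?t k) - (if k \<in> S then e' else 0) \<le> ?W (?t k) * (p (?t (Suc k)) - p (?t k))"
        proof (cases "?W (?t k) = 0")
          case True
          show ?thesis
          proof (cases "k \<in> S")
            case True
            have "\<bar>p (?t (Suc k)) - p (?t k)\<bar> < e'" using elim(2) k ts[of k] by auto
            then show ?thesis using True \<open>?W (?t k) = 0\<close> by simp
          next
            case False
            then have "p (?t k) = p (?t (Suc k))"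
              using True k t0[of k] ts[of k] by (intro p(2)) (auto simp: S_def)
            then show ?thesis using True False by simp
          qed
        next
          case False
          then have "?W (?t k) = 1" using hysteresis_cases by blast
          then show ?thesis using e' by simp
        qed
      qed
      finally show ?thesis .
    qed
    moreover have "riemann_sum a b n ?W q \<le> q b - q a"
    proof -
      have "q (?t k) \<le> q (?t (Suc k))" for k
        using t0 less_imp_le[OF ts[of k]] by (intro mono_onD[OF q]) auto
      then have "riemann_sum a b n ?W q \<le> riemann_sum a b n (\<lambda>_. 1) q"
        unfolding riemann_sum_def using W by (intro sum_mono mult_right_mono) auto
      then show ?thesis by (simp add: riemann_sum_const)
    qed
    moreover have "riemann_sum a b n ?W q - riemann_sum a b n ?W p =
      riemann_sum a b n ?W D - riemann_sum a b n ?W iY + riemann_sum a b n ?W iX"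
    proof -
      have "(q (?t (Suc k)) - q (?t k)) - (p (?t (Suc k)) - p (?t k)) =
        (D (?t (Suc k)) - D (?t k)) - (iY (?t (Suc k)) - iY (?t k)) + (iX (?t (Suc k)) - iX (?t k))" for k
        using dec[OF t0[of k]] dec[OF t0[of "Suc k"]] by linarith
      then have "?W (?t k) * (q (?t (Suc k)) - q (?t k)) - ?W (?t k) * (p (?t (Suc k)) - p (?t k)) =
        ?W (?t k) * (D (?t (Suc k)) - D (?t k)) - ?W (?t k) * (iY (?t (Suc k)) - iY (?t k)) + ?W (?t k) * (iX (?t (Suc k)) - iX (?t k))" for k
        by (metis distrib_left right_diff_distrib)
      then show ?thesis
        unfolding riemann_sum_def sum_subtractf[symmetric] sum.distrib[symmetric] by (intro sum.cong refl)
    qed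
    ultimately show ?case using SN Ne by linarith
  qed
  \<comment> \<open>The inequality holds on all fine grids, whereas the sums are only known to
    converge along \<open>r\<close>.\<close>
  have "(\<lambda>n. riemann_sum a b (r n) ?W iX - riemann_sum a b (r n) ?W iY - ?W a * D a) \<longlonglongrightarrow> lX - lY - ?W a * D a"
    using lX lY by (intro tendsto_intros)
  then show "lX - lY - ?W a * D a \<le> (q b - p b) - (q a - p a) + e"
    using eventually_subseq[OF r main] by (rule tendsto_upperbound) simp
qed

subsection \<open>Predictable processes and convergence in probability\<close>

definition conv_in_prob :: "'a measure \<Rightarrow> (nat \<Rightarrow> 'a \<Rightarrow> real) \<Rightarrow> ('a \<Rightarrow> real) \<Rightarrow> bool" where
  "conv_in_prob M f g \<longleftrightarrow>
     (\<forall>\<epsilon>>0. (\<lambda>n. measure M {\<omega>\<in>space M. \<epsilon> < \<bar>f n \<omega> - g \<omega>\<bar>}) \<longlonglongrightarrow> 0)"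

lemma conv_in_prob_subseq: "conv_in_prob M f g \<Longrightarrow> strict_mono r \<Longrightarrow> conv_in_prob M (\<lambda>n. f (r n)) g"
  unfolding conv_in_prob_def by (auto intro: LIMSEQ_subseq_LIMSEQ[unfolded comp_def])

context prob_space
begin

text \<open>Borel-Cantelli, along indices at which a deviation above (1/2)^n has probability below
  (1/2)^n.\<close>

lemma conv_in_prob_AE_subseq:
  assumes f[measurable]: "\<And>n. f n \<in> borel_measurable M" and g[measurable]: "g \<in> borel_measurable M"
    and conv: "conv_in_prob M f g"
  obtains r where "strict_mono r" "AE \<omega> in M. (\<lambda>n. f (r n) \<omega>) \<longlonglongrightarrow> g \<omega>"
proof -
  define P where "P n k \<longleftrightarrow> prob {\<omega>\<in>space M. (1/2)^n < \<bar>f k \<omega> - g \<omega>\<bar>} < (1/2)^n" for n k :: nat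
  have "\<forall>\<^sub>F k in sequentially. P n k" for n
  proof -
    have "(\<lambda>k. prob {\<omega>\<in>space M. (1/2)^n < \<bar>f k \<omega> - g \<omega>\<bar>}) \<longlonglongrightarrow> 0"
      using conv by (simp add: conv_in_prob_def)
    then show ?thesis unfolding P_def by (rule order_tendstoD) simp
  qed
  then have "\<forall>\<^sub>F k in sequentially. P n k \<and> m < k" for n m
    using eventually_gt_at_top[of m] by (intro eventually_conj)
  then have ex: "\<exists>k. P n k \<and> m < k" for n m
    using eventually_happens'[OF sequentially_bot] by blast
  have "\<exists>r. \<forall>n. P n (r n) \<and> r n < r (Suc n)"
    by (rule dependent_nat_choice) (use ex in blast)+
  then obtain r where r: "\<And>n. P n (r n)" "\<And>n. r n < r (Suc n)" by blast
  have mono: "strict_mono r" using r(2) by (simp add: strict_mono_Suc_iff)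
  define A where "A n = {\<omega>\<in>space M. (1/2)^n < \<bar>f (r n) \<omega> - g \<omega>\<bar>}" for n
  have "AE \<omega> in M. eventually (\<lambda>n. \<omega> \<in> space M - A n) sequentially"
  proof (rule borel_cantelli_AE1)
    show "A n \<in> sets M" for n unfolding A_def by measurable
    show "emeasure M (A n) < \<infinity>" for n by (simp add: emeasure_eq_measure)
    show "summable (\<lambda>n. prob (A n))"
    proof (rule summable_comparison_test_ev)
      show "\<forall>\<^sub>F n in sequentially. norm (prob (A n)) \<le> (1/2)^n"
        using r(1) by (auto simp: A_def P_def intro!: always_eventually less_imp_le)
    qed simp
  qed
  then have "AE \<omega> in M. (\<lambda>n. f (r n) \<omega>) \<longlonglongrightarrow> g \<omega>"
  proof eventually_elim
    case (elim \<omega>)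
    have "(\<lambda>n. f (r n) \<omega> - g \<omega>) \<longlonglongrightarrow> 0"
    proof (rule Lim_null_comparison)
      show "\<forall>\<^sub>F n in sequentially. norm (f (r n) \<omega> - g \<omega>) \<le> (1/2)^n"
        using elim by eventually_elim (auto simp: A_def)
      show "(\<lambda>n. (1/2)^n :: real) \<longlonglongrightarrow> 0" by (intro LIMSEQ_realpow_zero) auto
    qed
    then show ?case by (simp add: LIM_zero_iff)
  qed
  with mono show thesis by (rule that)
qed

lemma conv_in_prob_unique:
  assumes [measurable]: "\<And>n. f n \<in> borel_measurable M" "g \<in> borel_measurable M" "h \<in> borel_measurable M"
    and "conv_in_prob M f g" "conv_in_prob M f h"
  shows "AE \<omega> in M. g \<omega> = h \<omega>"
proof -
  obtain r where r: "strict_mono r" "AE \<omega> in M. (\<lambda>n. f (r n) \<omega>) \<longlonglongrightarrow> g \<omega>"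
    using conv_in_prob_AE_subseq[of f g] assms by blast
  obtain r' where r': "strict_mono r'" "AE \<omega> in M. (\<lambda>n. f (r (r' n)) \<omega>) \<longlonglongrightarrow> h \<omega>"
    using conv_in_prob_AE_subseq[of "\<lambda>n. f (r n)" h] conv_in_prob_subseq[OF assms(5) r(1)] assms by blast
  from r(2) r'(2) show ?thesis
  proof eventually_elim
    case (elim \<omega>)
    have "(\<lambda>n. f (r (r' n)) \<omega>) \<longlonglongrightarrow> g \<omega>"
      using LIMSEQ_subseq_LIMSEQ[OF elim(1) r'(1)] by (simp add: comp_def)
    with elim(2) show ?case using LIMSEQ_unique by blast
  qed
qed

lemma conv_in_prob_cong_AE:
  assumes [measurable]: "\<And>n. f n \<in> borel_measurable M" "\<And>n. f' n \<in> borel_measurable M" "g \<in> borel_measurable M"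
    and eq: "\<And>n. AE \<omega> in M. f n \<omega> = f' n \<omega>" and conv: "conv_in_prob M f g"
  shows "conv_in_prob M f' g"
proof -
  have "prob {\<omega>\<in>space M. \<epsilon> < \<bar>f n \<omega> - g \<omega>\<bar>} = prob {\<omega>\<in>space M. \<epsilon> < \<bar>f' n \<omega> - g \<omega>\<bar>}" for \<epsilon> n
    using eq[of n] by (intro measure_eq_AE) auto
  with conv show ?thesis by (simp add: conv_in_prob_def)
qed

end

section \<open>The predictable sigma-algebra and its monotone class theorem\<close>

context usual_filtered_prob_space
begin

lemma space_F: "0 \<le> t \<Longrightarrow> space (F t) = space M"
  using subalgebra_F by (simp add: subalgebra_def)

lemma measurable_F_M: "0 \<le> t \<Longrightarrow> f \<in> borel_measurable (F t) \<Longrightarrow> f \<in> borel_measurable M"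
  using measurable_from_subalg[OF subalgebra_F] by blast

lemma measurable_F_mono:
  assumes "0 \<le> s" "s \<le> t" "f \<in> borel_measurable (F s)"
  shows "f \<in> borel_measurable (F t)"
proof (rule measurable_from_subalg)
  show "subalgebra (F t) (F s)" using assms F_mono space_F by (simp add: subalgebra_def)
qed (fact assms)

text \<open>This allows a process to be redefined on a null set without losing adaptedness, as is
  done wherever paths are regular only almost surely.\<close>

lemma null_sets_F: "N \<in> null_sets M \<Longrightarrow> 0 \<le> t \<Longrightarrow> N \<in> sets (F t)"
  using F_complete F_mono[of 0 t] by auto

abbreviation "\<P> \<equiv> predictable_sigma M F"

lemma predictable_generator:
  "{{0} \<times> A | A. A \<in> sets (F 0)} \<union> {{s<..t} \<times> A | s t A. 0 \<le> s \<and> s < t \<and> A \<in> sets (F s)}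
    \<subseteq> Pow ({0..} \<times> space M)"
  using sets.sets_into_space[of _ "F 0"] sets.sets_into_space[of _ "F _"] space_F by fastforce

lemma space_predictable: "space \<P> = {0..} \<times> space M"
  unfolding predictable_sigma_def using predictable_generator by (simp add: space_measure_of_conv)

lemma sets_predictable: "sets \<P> = sigma_sets ({0..} \<times> space M)
    ({{0} \<times> A | A. A \<in> sets (F 0)} \<union> {{s<..t} \<times> A | s t A. 0 \<le> s \<and> s < t \<and> A \<in> sets (F s)})"
  unfolding predictable_sigma_def using predictable_generator by (rule sets_measure_of)

lemma predictable_rectangle_0: "A \<in> sets (F 0) \<Longrightarrow> {0} \<times> A \<in> sets \<P>"
  unfolding sets_predictable by (intro sigma_sets.Basic) auto

lemma predictable_rectangle: "0 \<le> s \<Longrightarrow> A \<in> sets (F s) \<Longrightarrow> {s<..t} \<times> A \<in> sets \<P>"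
proof (cases "s < t")
  case True
  then show "0 \<le> s \<Longrightarrow> A \<in> sets (F s) \<Longrightarrow> {s<..t} \<times> A \<in> sets \<P>"
    unfolding sets_predictable by (intro sigma_sets.Basic) auto
qed auto

lemma predictable_indicator_times:
  assumes R: "\<And>A. A \<in> sets G \<Longrightarrow> R \<times> A \<in> sets \<P>" and G: "space G = space M" "U \<in> borel_measurable G"
  shows "predictable M F (\<lambda>t \<omega>. indicator R t * U \<omega>)"
  unfolding predictable_def
proof (rule measurableI)
  fix B :: "real set" assume B: "B \<in> sets borel"
  have R': "R \<subseteq> {0..} \<or> space M = {}"
    using sets.sets_into_space[OF R[OF sets.top]] by (auto simp: G space_predictable)
  have "(\<lambda>(t, \<omega>). indicator R t * U \<omega>) -` B \<inter> space \<P> =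
    (R \<times> (U -` B \<inter> space G)) \<union> (if 0 \<in> B then space \<P> - R \<times> space G else {})"
    using R' by (auto simp: space_predictable G split: split_indicator split_indicator_asm)
  also have "\<dots> \<in> sets \<P>"
    using R[OF measurable_sets[OF G(2) B]] R[OF sets.top] by auto
  finally show "(\<lambda>(t, \<omega>). indicator R t * U \<omega>) -` B \<inter> space \<P> \<in> sets \<P>" .
qed simp

lemma predictable_elementary:
  assumes "0 \<le> r" "U \<in> borel_measurable (F r)"
  shows "predictable M F (\<lambda>t \<omega>. indicator {r<..s} t * U \<omega>)"
  by (rule predictable_indicator_times[OF predictable_rectangle space_F]) (use assms in auto)

lemma predictable_elementary_0:
  assumes "U \<in> borel_measurable (F 0)"
  shows "predictable M F (\<lambda>t \<omega>. indicator {0} t * U \<omega>)"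
  by (rule predictable_indicator_times[OF predictable_rectangle_0 space_F]) (use assms in auto)

lemma predictable_cong:
  assumes "\<And>t \<omega>. 0 \<le> t \<Longrightarrow> \<omega> \<in> space M \<Longrightarrow> H t \<omega> = K t \<omega>"
  shows "predictable M F H \<longleftrightarrow> predictable M F K"
  unfolding predictable_def using assms by (intro measurable_cong) (auto simp: space_predictable)

lemma predictable_lim:
  assumes "\<And>n. predictable M F (H n)"
    and "\<And>t \<omega>. 0 \<le> t \<Longrightarrow> \<omega> \<in> space M \<Longrightarrow> (\<lambda>n. H n t \<omega>) \<longlonglongrightarrow> K t \<omega>"
  shows "predictable M F K"
  unfolding predictable_def
  by (rule borel_measurable_LIMSEQ_real[where u = "\<lambda>n (t, \<omega>). H n t \<omega>"])
     (use assms in \<open>auto simp: space_predictable predictable_def\<close>)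

lemma predictable_const [simp]: "predictable M F (\<lambda>t \<omega>. c)"
  by (simp add: predictable_def)

lemma predictable_compose2:
  assumes "predictable M F H" "predictable M F K" and f: "(\<lambda>(x, y). f x y) \<in> borel_measurable (borel \<Otimes>\<^sub>M borel)"
  shows "predictable M F (\<lambda>t \<omega>. f (H t \<omega>) (K t \<omega>) :: real)"
proof -
  have "(\<lambda>p. f (case p of (t, \<omega>) \<Rightarrow> H t \<omega>) (case p of (t, \<omega>) \<Rightarrow> K t \<omega>)) \<in> borel_measurable \<P>"
    using measurable_compose[OF measurable_Pair[OF assms(1,2)[unfolded predictable_def]] f] by simp
  then show ?thesis by (simp add: predictable_def split_def)
qed

lemma predictable_add: "predictable M F H \<Longrightarrow> predictable M F K \<Longrightarrow> predictable M F (\<lambda>t \<omega>. H t \<omega> + K t \<omega>)"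
  by (erule (1) predictable_compose2) measurable

lemma predictable_mult: "predictable M F H \<Longrightarrow> predictable M F K \<Longrightarrow> predictable M F (\<lambda>t \<omega>. H t \<omega> * K t \<omega>)"
  by (erule (1) predictable_compose2) measurable

lemma predictable_linear: "predictable M F H \<Longrightarrow> predictable M F K \<Longrightarrow> predictable M F (\<lambda>t \<omega>. a * H t \<omega> + b * K t \<omega>)"
  by (intro predictable_add predictable_mult predictable_const)

lemma predictable_sum:
  "(\<And>i. i \<in> I \<Longrightarrow> predictable M F (H i)) \<Longrightarrow> predictable M F (\<lambda>t \<omega>. \<Sum>i\<in>I. H i t \<omega>)"
  by (induction I rule: infinite_finite_induct) (auto intro: predictable_add)

lemma bounded_predictableI:
  "predictable M F H \<Longrightarrow> (\<And>t \<omega>. 0 \<le> t \<Longrightarrow> \<omega> \<in> space M \<Longrightarrow> \<bar>H t \<omega>\<bar> \<le> C) \<Longrightarrow> bounded_predictable M F H"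
  by (auto simp: bounded_predictable_def)

lemma bounded_predictable_const: "bounded_predictable M F (\<lambda>t \<omega>. c)"
  by (rule bounded_predictableI[where C = "\<bar>c\<bar>"]) auto

lemma bounded_predictable_mult:
  assumes "bounded_predictable M F H" "bounded_predictable M F K"
  shows "bounded_predictable M F (\<lambda>t \<omega>. H t \<omega> * K t \<omega>)"
proof -
  obtain C D where "\<And>t \<omega>. 0 \<le> t \<Longrightarrow> \<omega> \<in> space M \<Longrightarrow> \<bar>H t \<omega>\<bar> \<le> C" "\<And>t \<omega>. 0 \<le> t \<Longrightarrow> \<omega> \<in> space M \<Longrightarrow> \<bar>K t \<omega>\<bar> \<le> D"
    using assms unfolding bounded_predictable_def by meson
  then have "\<bar>H t \<omega> * K t \<omega>\<bar> \<le> C * D" if "0 \<le> t" "\<omega> \<in> space M" for t \<omega>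
    using that unfolding abs_mult by (intro mult_mono) (auto intro: order_trans[OF abs_ge_zero])
  with assms show ?thesis
    by (auto simp: bounded_predictable_def intro: predictable_mult)
qed

lemma bounded_predictable_linear:
  assumes "bounded_predictable M F H" "bounded_predictable M F K"
  shows "bounded_predictable M F (\<lambda>t \<omega>. a * H t \<omega> + b * K t \<omega>)"
proof -
  obtain C D where C: "\<And>t \<omega>. 0 \<le> t \<Longrightarrow> \<omega> \<in> space M \<Longrightarrow> \<bar>H t \<omega>\<bar> \<le> C" "\<And>t \<omega>. 0 \<le> t \<Longrightarrow> \<omega> \<in> space M \<Longrightarrow> \<bar>K t \<omega>\<bar> \<le> D"
    using assms unfolding bounded_predictable_def by meson
  have "\<bar>a * H t \<omega> + b * K t \<omega>\<bar> \<le> \<bar>a\<bar> * C + \<bar>b\<bar> * D" if "0 \<le> t" "\<omega> \<in> space M" for t \<omega>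
  proof -
    have "\<bar>a * H t \<omega> + b * K t \<omega>\<bar> \<le> \<bar>a\<bar> * \<bar>H t \<omega>\<bar> + \<bar>b\<bar> * \<bar>K t \<omega>\<bar>"
      using abs_triangle_ineq[of "a * H t \<omega>" "b * K t \<omega>"] by (simp add: abs_mult)
    also have "\<dots> \<le> \<bar>a\<bar> * C + \<bar>b\<bar> * D" using C[OF that] by (intro add_mono mult_left_mono) auto
    finally show ?thesis .
  qed
  with assms show ?thesis
    by (auto simp: bounded_predictable_def intro: predictable_linear)
qed

lemma Int_stable_predictable_generator:
  "Int_stable ({{0} \<times> A | A. A \<in> sets (F 0)} \<union> {{s<..t} \<times> A | s t A. 0 \<le> s \<and> s < t \<and> A \<in> sets (F s)})"
    (is "Int_stable (?A \<union> ?B)")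
proof (rule Int_stableI)
  have empty: "{} \<in> ?A \<union> ?B" by auto
  fix a b assume a: "a \<in> ?A \<union> ?B" and b: "b \<in> ?A \<union> ?B"
  have AB: "x \<inter> y = {}" if "x \<in> ?A" "y \<in> ?B" for x y using that by auto
  consider "a \<in> ?A" "b \<in> ?A" | "a \<in> ?A" "b \<in> ?B" | "a \<in> ?B" "b \<in> ?A" | "a \<in> ?B" "b \<in> ?B"
    using a b by blast
  then show "a \<inter> b \<in> ?A \<union> ?B"
  proof cases
    case 1
    then obtain A B where "a = {0} \<times> A" "b = {0} \<times> B" "A \<in> sets (F 0)" "B \<in> sets (F 0)" by auto
    then have "a \<inter> b = {0} \<times> (A \<inter> B)" "A \<inter> B \<in> sets (F 0)" by auto
    then show ?thesis by blast
  next
    case 4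
    then obtain s t A s' t' B where *: "a = {s<..t} \<times> A" "0 \<le> s" "A \<in> sets (F s)" "b = {s'<..t'} \<times> B" "0 \<le> s'" "B \<in> sets (F s')"
      by auto
    define u v where "u = max s s'" and "v = min t t'"
    have ab: "a \<inter> b = {u<..v} \<times> (A \<inter> B)" using * by (auto simp: u_def v_def)
    have "A \<inter> B \<in> sets (F u)" using F_mono[of s u] F_mono[of s' u] * by (auto simp: u_def)
    moreover have "0 \<le> u" using * by (simp add: u_def)
    ultimately show ?thesis using ab empty by (cases "u < v") auto
  qed (use AB empty in \<open>auto simp: Int_commute\<close>)
qed

text \<open>A functional monotone class theorem whose cases match the axioms of
  \<open>integral_operator\<close>, so that claims about all integrals reduce to elementary ones.
  Intersection stability of the generators gives indicators of predictable sets, sums and increasing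
  limits give nonnegative functions, and a shift by the bound gives the rest.\<close>

lemma bounded_predictable_induct [consumes 1, case_names initial interval linear lim]:
  assumes H: "bounded_predictable M F H"
    and initial: "\<And>A. A \<in> sets (F 0) \<Longrightarrow> P (\<lambda>t \<omega>. indicator {0} t * indicator A \<omega>)"
    and interval: "\<And>s t A. 0 \<le> s \<Longrightarrow> s < t \<Longrightarrow> A \<in> sets (F s) \<Longrightarrow> P (\<lambda>u \<omega>. indicator {s<..t} u * indicator A \<omega>)"
    and linear: "\<And>a b H K. bounded_predictable M F H \<Longrightarrow> bounded_predictable M F K \<Longrightarrow> P H \<Longrightarrow> P K \<Longrightarrow>
      P (\<lambda>t \<omega>. a * H t \<omega> + b * K t \<omega>)"
    and lim: "\<And>H K C. (\<And>n. predictable M F (H n)) \<Longrightarrow> predictable M F K \<Longrightarrow>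
      (\<And>n t \<omega>. 0 \<le> t \<Longrightarrow> \<omega> \<in> space M \<Longrightarrow> \<bar>H n t \<omega>\<bar> \<le> C) \<Longrightarrow>
      (\<And>t \<omega>. 0 \<le> t \<Longrightarrow> \<omega> \<in> space M \<Longrightarrow> (\<lambda>n::nat. H n t \<omega>) \<longlonglongrightarrow> K t \<omega>) \<Longrightarrow> (\<And>n. P (H n)) \<Longrightarrow> P K"
  shows "P H"
proof -
  have bp_ind: "bounded_predictable M F (\<lambda>t \<omega>. indicator E (t, \<omega>))" if "E \<in> sets \<P>" for E
    using that by (intro bounded_predictableI[where C = 1]) (auto simp: predictable_def split: split_indicator)
  \<comment> \<open>Constant sequences in \<open>lim\<close> make P insensitive to values at
    negative times or outside the space.\<close>
  have cong: "P K" if HK: "bounded_predictable M F H" "P H" "\<And>t \<omega>. 0 \<le> t \<Longrightarrow> \<omega> \<in> space M \<Longrightarrow> H t \<omega> = K t \<omega>" for H K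
  proof -
    obtain C where "\<And>t \<omega>. 0 \<le> t \<Longrightarrow> \<omega> \<in> space M \<Longrightarrow> \<bar>H t \<omega>\<bar> \<le> C" "predictable M F H"
      using HK(1) unfolding bounded_predictable_def by blast
    moreover from this(2) have "predictable M F K" using predictable_cong[of H K] HK(3) by blast
    ultimately show ?thesis using HK by (intro lim[of "\<lambda>_. H" K C]) auto
  qed
  \<comment> \<open>The whole space is not a generator, but the increasing limit of the sets {0}
    together with (0, n + 1], times \<open>space M\<close>.\<close>
  have P_space: "P (\<lambda>t \<omega>. indicator ({0..} \<times> space M) (t, \<omega>))"
  proof (rule lim[of _ _ 2])
    define G :: "nat \<Rightarrow> 'a process" where "G n = (\<lambda>t \<omega>. 1 * (indicator {0} t * indicator (space M) \<omega>) +
        1 * (indicator {0<..real (Suc n)} t * indicator (space M) \<omega>))" for n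
    have e0: "bounded_predictable M F (\<lambda>t \<omega>. indicator {0} t * indicator (space M) \<omega>)"
      using sets.top[of "F 0"]
      by (intro bounded_predictableI[where C = 1] predictable_elementary_0) (auto simp: space_F split: split_indicator)
    have e1: "bounded_predictable M F (\<lambda>t \<omega>. indicator {0<..real (Suc n)} t * indicator (space M) \<omega>)" for n
      using sets.top[of "F 0"]
      by (intro bounded_predictableI[where C = 1] predictable_elementary) (auto simp: space_F split: split_indicator)
    show "P (G n)" for n
      unfolding G_def using e0 e1 sets.top[of "F 0"] space_F[of 0]
      by (intro linear initial interval) auto
    show "predictable M F (G n)" for n
      using bounded_predictable_linear[OF e0 e1[of n], of 1 1] by (auto simp: G_def bounded_predictable_def)
    show "\<bar>G n t \<omega>\<bar> \<le> 2" for n t \<omega> by (auto simp: G_def split: split_indicator)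
    show "predictable M F (\<lambda>t \<omega>. indicator ({0..} \<times> space M) (t, \<omega>))"
      using bp_ind[OF sets.top] by (simp add: space_predictable bounded_predictable_def)
    fix t :: real and \<omega> assume t: "0 \<le> t" "\<omega> \<in> space M"
    obtain n0 where n0: "t \<le> real n0" using real_arch_simple by blast
    show "(\<lambda>n. G n t \<omega>) \<longlonglongrightarrow> indicator ({0..} \<times> space M) (t, \<omega>)"
      using t n0 by (intro tendsto_eventually eventually_sequentiallyI[of n0]) (auto simp: G_def split: split_indicator)
  qed
  have ind: "P (\<lambda>t \<omega>. indicator E (t, \<omega>))" if "E \<in> sets \<P>" for E
    using Int_stable_predictable_generator predictable_generator that[unfolded sets_predictable]
  proof (induction rule: sigma_sets_induct_disjoint)
    case (basic A)
    then consider B where "A = {0} \<times> B" "B \<in> sets (F 0)" | s t B where "A = {s<..t} \<times> B" "0 \<le> s" "s < t" "B \<in> sets (F s)" by auto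
    then show ?case
      by cases (use initial interval in \<open>auto simp: indicator_times\<close>)
  next
    case empty
    show ?case using linear[OF bounded_predictable_const bounded_predictable_const, of 0 0 0 0]
      initial[of "{}"] by simp
  next
    case (compl A)
    note A = compl(1)[folded sets_predictable]
    have "P (\<lambda>t \<omega>. 1 * indicator ({0..} \<times> space M) (t, \<omega>) + (- 1) * indicator A (t, \<omega>))"
      using bp_ind[OF A] bp_ind[OF sets.top] P_space compl by (intro linear) (auto simp: space_predictable)
    moreover have "bounded_predictable M F (\<lambda>t \<omega>. 1 * indicator ({0..} \<times> space M) (t, \<omega>) + (- 1) * indicator A (t, \<omega>))"
      using bp_ind[OF A] bp_ind[OF sets.top] by (intro bounded_predictable_linear) (auto simp: space_predictable)
    ultimately show ?case
      using cong by (force split: split_indicator)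
  next
    case (union A)
    then have A: "A i \<in> sets \<P>" for i by (auto simp: sets_predictable)
    have fin: "P (\<lambda>t \<omega>. indicator (\<Union>i<n. A i) (t, \<omega>))" for n :: nat
    proof (induction n)
      case 0
      show ?case using initial[of "{}"] by simp
    next
      case (Suc n)
      have U: "(\<Union>i<n. A i) \<in> sets \<P>" using A by auto
      have "P (\<lambda>t \<omega>. 1 * indicator (\<Union>i<n. A i) (t, \<omega>) + 1 * indicator (A n) (t, \<omega>))"
        using bp_ind[OF U] bp_ind[OF A] Suc union by (intro linear) auto
      moreover have "1 * indicator (\<Union>i<n. A i) p + 1 * indicator (A n) p = (indicator (\<Union>i<Suc n. A i) p :: real)" for p
      proof -
        have "A i \<inter> A n = {}" if "i < n" for i
          using union(1) that by (simp add: disjoint_family_on_def)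
        then show ?thesis by (auto simp: lessThan_Suc split: split_indicator)
      qed
      ultimately show ?case by simp
    qed
    show ?case
    proof (rule lim[of "\<lambda>n t \<omega>. indicator (\<Union>i<n. A i) (t, \<omega>)" _ 1])
      show "predictable M F (\<lambda>t \<omega>. indicator (\<Union>i<n. A i) (t, \<omega>))" for n
        using A by (intro bp_ind[unfolded bounded_predictable_def, THEN conjunct1]) auto
      show "predictable M F (\<lambda>t \<omega>. indicator (\<Union> (range A)) (t, \<omega>))"
        using A by (intro bp_ind[unfolded bounded_predictable_def, THEN conjunct1]) auto
      show "(\<lambda>n. indicator (\<Union>i<n. A i) (t, \<omega>)) \<longlonglongrightarrow> (indicator (\<Union> (range A)) (t, \<omega>) :: real)" for t \<omega>
        by (rule LIMSEQ_indicator_UN)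
    qed (auto intro: fin)
  qed
  have bp: "bounded_predictable M F (\<lambda>t \<omega>. u (t, \<omega>))"
    if "u \<in> borel_measurable \<P>" "\<And>x. 0 \<le> u x" "\<And>x. x \<in> space \<P> \<Longrightarrow> u x \<le> C" for u C
    using that by (intro bounded_predictableI[where C = C]) (auto simp: predictable_def space_predictable)
  have nonneg: "P (\<lambda>t \<omega>. u (t, \<omega>))"
    if "u \<in> borel_measurable \<P>" "\<And>x. 0 \<le> u x" "\<And>x. x \<in> space \<P> \<Longrightarrow> u x \<le> C" for u C
  proof -
    have "(\<exists>C. \<forall>x\<in>space \<P>. u x \<le> C) \<longrightarrow> P (\<lambda>t \<omega>. u (t, \<omega>))"
      using that(1,2)
    proof (induction rule: borel_measurable_induct_real)
      case (set A)
      then show ?case using ind by simp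
    next
      case (mult u c)
      show ?case
      proof (cases "c = 0")
        case True
        then show ?thesis using initial[of "{}"] by simp
      next
        case False
        then have c: "c > 0" using mult(1) by simp
        show ?thesis
        proof
          assume "\<exists>C. \<forall>x\<in>space \<P>. c * u x \<le> C"
          then obtain C where "\<forall>x\<in>space \<P>. c * u x \<le> C" by blast
          then have le: "\<forall>x\<in>space \<P>. u x \<le> C / c" using c by (simp add: field_simps)
          then have "P (\<lambda>t \<omega>. u (t, \<omega>))" using mult by blast
          then have "P (\<lambda>t \<omega>. c * u (t, \<omega>) + 0 * u (t, \<omega>))"
            using bp[of u "C / c"] mult le by (intro linear) auto
          then show "P (\<lambda>t \<omega>. c * u (t, \<omega>))" by simp
        qed
      qed
    next
      case (add u v)
      show ?case
      proof
        assume "\<exists>C. \<forall>x\<in>space \<P>. v x + u x \<le> C"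
        then obtain C where C: "\<forall>x\<in>space \<P>. v x + u x \<le> C" by blast
        have "u x \<le> C \<and> v x \<le> C" if "x \<in> space \<P>" for x
          using bspec[OF C that] add(2)[of x] add(4)[of x] by linarith
        then have le: "\<forall>x\<in>space \<P>. u x \<le> C" "\<forall>x\<in>space \<P>. v x \<le> C" by blast+
        then have "P (\<lambda>t \<omega>. 1 * v (t, \<omega>) + 1 * u (t, \<omega>))"
          using bp[of u C] bp[of v C] add by (intro linear) auto
        then show "P (\<lambda>t \<omega>. v (t, \<omega>) + u (t, \<omega>))" by simp
      qed
    next
      case (seq U)
      show ?case
      proof
        assume "\<exists>C. \<forall>x\<in>space \<P>. u x \<le> C"
        then obtain C where C: "\<forall>x\<in>space \<P>. u x \<le> C" by blast
        have le: "U i x \<le> C" if "x \<in> space \<P>" for i x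
        proof -
          have "incseq (\<lambda>i. U i x)" using seq(3) unfolding incseq_def le_fun_def by blast
          then have "U i x \<le> u x" using seq(4)[OF that] by (rule incseq_le)
          then show ?thesis using C that by force
        qed
        show "P (\<lambda>t \<omega>. u (t, \<omega>))"
        proof (rule lim[of "\<lambda>i t \<omega>. U i (t, \<omega>)" _ C])
          show "\<bar>U i (t, \<omega>)\<bar> \<le> C" if "0 \<le> t" "\<omega> \<in> space M" for i t \<omega>
            using le[of "(t, \<omega>)" i] seq(2)[of i "(t, \<omega>)"] that by (simp add: space_predictable)
          show "P (\<lambda>t \<omega>. U i (t, \<omega>))" for i
            using seq(5)[of i] le by blast
        qed (use seq that in \<open>auto simp: predictable_def space_predictable\<close>)
      qed
    qed
    then show ?thesis using that(3) by blast
  qed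
  obtain C0 where C0: "\<And>t \<omega>. 0 \<le> t \<Longrightarrow> \<omega> \<in> space M \<Longrightarrow> \<bar>H t \<omega>\<bar> \<le> C0" "predictable M F H"
    using H unfolding bounded_predictable_def by blast
  \<comment> \<open>The absolute value keeps the bound nonnegative even if the space is
    empty.\<close>
  define C where "C = \<bar>C0\<bar>"
  have C: "\<bar>H t \<omega>\<bar> \<le> C" if "0 \<le> t" "\<omega> \<in> space M" for t \<omega> using C0(1)[OF that] by (simp add: C_def)
  \<comment> \<open>The shift makes the function nonnegative on the space, the value 0 elsewhere
    makes it so on the whole type, as the induction demands.\<close>
  define u where "u p = (if p \<in> space \<P> then (case p of (t, \<omega>) \<Rightarrow> H t \<omega>) + C else 0)" for p
  have um: "u \<in> borel_measurable \<P>"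
    unfolding u_def using C0(2) by (intro measurable_If_set borel_measurable_add) (auto simp: predictable_def)
  have u: "0 \<le> u p" "u p \<le> 2 * C" for p
    using C[of "fst p" "snd p"] by (auto simp: u_def space_predictable C_def split: prod.splits)
  have "P (\<lambda>t \<omega>. (\<lambda>_. C) (t, \<omega>))" by (rule nonneg[of "\<lambda>_. C" C]) (auto simp: C_def)
  moreover have "P (\<lambda>t \<omega>. u (t, \<omega>))" using um u by (rule nonneg)
  ultimately have 1: "P (\<lambda>t \<omega>. 1 * u (t, \<omega>) + (- 1) * C)"
    using bp[OF um u] bounded_predictable_const by (intro linear) auto
  have 2: "bounded_predictable M F (\<lambda>t \<omega>. 1 * u (t, \<omega>) + (- 1) * C)"
    using bp[OF um u] bounded_predictable_const by (intro bounded_predictable_linear) auto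
  show "P H" by (rule cong[OF 2 1]) (auto simp: u_def space_predictable)
qed

end

section \<open>Step functions on grids and left-continuous integrands\<close>

lemma grid_step:
  assumes "a < b" "t \<in> {a<..b}"
  obtains k where "k < Suc n" "grid a b n k < t" "t \<le> grid a b n (Suc k)"
    "\<And>f :: nat \<Rightarrow> real. (\<Sum>j<Suc n. indicator {grid a b n j<..grid a b n (Suc j)} t * f j) = f k"
proof -
  let ?t = "grid a b n"
  define m where "m = (LEAST m. t \<le> ?t m)"
  have "t \<le> ?t (Suc n)" using assms by simp
  then have m: "t \<le> ?t m" "m \<le> Suc n"
    unfolding m_def by (rule LeastI[of "\<lambda>m. t \<le> ?t m"], rule Least_le)
  have "m \<noteq> 0" using m(1) assms by (cases m) auto
  then obtain k where k: "m = Suc k" by (cases m) auto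
  have lt: "?t k < t" using not_less_Least[of k "\<lambda>m. t \<le> ?t m"] k by (auto simp: m_def[symmetric])
  have "indicator {?t j<..?t (Suc j)} t = (if j = k then 1 else 0 :: real)" for j
  proof -
    have "\<not> (?t j < t \<and> t \<le> ?t (Suc j))" if "j \<noteq> k"
    proof (cases "j < k")
      case True
      then have "?t (Suc j) \<le> ?t k" using assms by (intro grid_le) auto
      then show ?thesis using lt by simp
    next
      case False
      then have "?t (Suc k) \<le> ?t j" using assms that by (intro grid_le) auto
      then show ?thesis using m k by simp
    qed
    then show ?thesis using lt m k by (auto split: split_indicator)
  qed
  then have "(\<Sum>j<Suc n. indicator {?t j<..?t (Suc j)} t * f j) = f k" for f :: "nat \<Rightarrow> real"
    using m(2) k by (simp add: if_distrib[of "\<lambda>x. x * _"] sum.delta cong: if_cong del: sum.lessThan_Suc)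
  with m k lt show thesis by (intro that[of k]) auto
qed

lemma grid_step_outside:
  assumes "a < b" "t \<notin> {a<..b}"
  shows "(\<Sum>j<Suc n. indicator {grid a b n j<..grid a b n (Suc j)} t * f j) = (0 :: real)"
proof (rule sum.neutral, intro ballI)
  fix j assume "j \<in> {..<Suc n}"
  then have "a \<le> grid a b n j" "grid a b n (Suc j) \<le> b" using assms by (auto intro!: grid_bounds)
  then show "indicator {grid a b n j<..grid a b n (Suc j)} t * f j = 0"
    using assms by (auto split: split_indicator)
qed

text \<open>Cells are open on the left, so the left endpoint of the cell containing t lies strictly
  before t and tends to t; a left limit is all that is used.\<close>

lemma grid_step_tendsto:
  fixes V :: "real \<Rightarrow> real"
  assumes ab: "a < b" and V: "t \<in> {a<..b} \<Longrightarrow> (V \<longlongrightarrow> V t) (at_left t)"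
  shows "(\<lambda>n. \<Sum>j<Suc n. indicator {grid a b n j<..grid a b n (Suc j)} t * V (grid a b n j))
    \<longlonglongrightarrow> indicator {a<..b} t * V t"
proof (cases "t \<in> {a<..b}")
  case False
  have "(\<Sum>j<Suc n. indicator {grid a b n j<..grid a b n (Suc j)} t * V (grid a b n j)) = 0" for n
    by (rule grid_step_outside[OF ab False])
  then show ?thesis using False by simp
next
  case True
  show ?thesis
  proof (rule tendstoI)
    fix e :: real assume "0 < e"
    then have "\<forall>\<^sub>F u in at_left t. dist (V u) (V t) < e" using V[OF True] by (simp add: tendsto_iff)
    then obtain s where s: "s < t" "\<And>u. s < u \<Longrightarrow> u < t \<Longrightarrow> dist (V u) (V t) < e"
      unfolding eventually_at_left_field by blast
    have "(\<lambda>n. (b - a) / real (Suc n)) \<longlonglongrightarrow> 0" by (intro LIMSEQ_Suc lim_const_over_n)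
    then have "\<forall>\<^sub>F n in sequentially. (b - a) / real (Suc n) < t - s"
      using s(1) by (intro order_tendstoD) auto
    then show "\<forall>\<^sub>F n in sequentially. dist (\<Sum>j<Suc n. indicator {grid a b n j<..grid a b n (Suc j)} t * V (grid a b n j))
        (indicator {a<..b} t * V t) < e"
    proof eventually_elim
      case (elim n)
      obtain k where k: "grid a b n k < t" "t \<le> grid a b n (Suc k)"
        "\<And>f :: nat \<Rightarrow> real. (\<Sum>j<Suc n. indicator {grid a b n j<..grid a b n (Suc j)} t * f j) = f k"
        by (rule grid_step[OF ab True, of n]) blast
      have "s < grid a b n k" using k(2) elim by (simp add: grid_Suc)
      then have "dist (V (grid a b n k)) (V t) < e" using k s by blast
      then show ?case unfolding k(3) using True by simp
    qed
  qed
qed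

context usual_filtered_prob_space
begin

lemma bounded_predictable_elementary:
  assumes "0 \<le> r" "U \<in> borel_measurable (F r)" and U: "\<And>\<omega>. \<omega> \<in> space M \<Longrightarrow> \<bar>U \<omega>\<bar> \<le> C"
  shows "bounded_predictable M F (\<lambda>t \<omega>. indicator {r<..s} t * U \<omega>)"
proof (rule bounded_predictableI[where C = "\<bar>C\<bar>"])
  show "\<bar>indicator {r<..s} t * U \<omega>\<bar> \<le> \<bar>C\<bar>" if "\<omega> \<in> space M" for t \<omega>
    using U[OF that] by (auto split: split_indicator)
qed (use assms in \<open>auto intro: predictable_elementary\<close>)

lemma predictable_left_continuous_interval:
  assumes ab: "0 \<le> a" "a < b" and V: "\<And>t. 0 \<le> t \<Longrightarrow> V t \<in> borel_measurable (F t)"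
    and left: "\<And>t \<omega>. \<omega> \<in> space M \<Longrightarrow> t \<in> {a<..b} \<Longrightarrow> ((\<lambda>u. V u \<omega>) \<longlongrightarrow> V t \<omega>) (at_left t)"
  shows "predictable M F (\<lambda>t \<omega>. indicator {a<..b} t * V t \<omega>)"
proof (rule predictable_lim)
  have t0: "0 \<le> grid a b n k" for n k using grid_bounds(1)[OF ab(2), of n k] ab by linarith
  show "predictable M F (\<lambda>t \<omega>. \<Sum>j<Suc n. indicator {grid a b n j<..grid a b n (Suc j)} t * V (grid a b n j) \<omega>)" for n
    using V t0 by (intro predictable_sum predictable_elementary) auto
  show "(\<lambda>n. \<Sum>j<Suc n. indicator {grid a b n j<..grid a b n (Suc j)} t * V (grid a b n j) \<omega>)
    \<longlonglongrightarrow> indicator {a<..b} t * V t \<omega>" if "\<omega> \<in> space M" for t \<omega>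
    using grid_step_tendsto[OF ab(2), of t "\<lambda>u. V u \<omega>"] left[OF that] by blast
qed

text \<open>Left-continuity says nothing at time 0, so that slice is added as an elementary process
  of its own; the intervals (0, n + 1] exhaust the rest.\<close>

lemma predictable_left_continuous:
  assumes V: "\<And>t. 0 \<le> t \<Longrightarrow> V t \<in> borel_measurable (F t)"
    and left: "\<And>t \<omega>. \<omega> \<in> space M \<Longrightarrow> 0 < t \<Longrightarrow> ((\<lambda>u. V u \<omega>) \<longlongrightarrow> V t \<omega>) (at_left t)"
  shows "predictable M F V"
proof (rule predictable_lim)
  show "predictable M F (\<lambda>t \<omega>. indicator {0} t * V 0 \<omega> + indicator {0<..real (Suc n)} t * V t \<omega>)" for n
    using assms by (intro predictable_add predictable_elementary_0 predictable_left_continuous_interval) auto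
  fix t :: real and \<omega> assume t: "0 \<le> t" "\<omega> \<in> space M"
  obtain n0 where n0: "t \<le> real n0" using real_arch_simple by blast
  show "(\<lambda>n. indicator {0} t * V 0 \<omega> + indicator {0<..real (Suc n)} t * V t \<omega>) \<longlonglongrightarrow> V t \<omega>"
    using t n0 by (intro tendsto_eventually eventually_sequentiallyI[of n0]) (auto split: split_indicator)
qed

end

section \<open>Consequences of the axioms of the stochastic integral\<close>

locale integral_operator_space = usual_filtered_prob_space M F
  for M :: "'a measure" and F :: "real \<Rightarrow> 'a measure" +
  fixes Z :: "'a process" and J :: "'a process \<Rightarrow> 'a process"
  assumes integral_operator: "integral_operator M F Z J"
begin

lemma J_measurable: "bounded_predictable M F H \<Longrightarrow> 0 \<le> t \<Longrightarrow> J H t \<in> borel_measurable M"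
  using integral_operator unfolding integral_operator_def adapted_def by (blast intro: measurable_F_M)

lemma J_elementary_0:
  assumes "U \<in> borel_measurable (F 0)" "\<And>\<omega>. \<omega> \<in> space M \<Longrightarrow> \<bar>U \<omega>\<bar> \<le> C" "0 \<le> t"
  shows "AE \<omega> in M. J (\<lambda>t \<omega>. indicator {0} t * U \<omega>) t \<omega> = 0"
proof -
  have "indistinguishable M (J (\<lambda>t \<omega>. indicator {0} t * U \<omega>)) (\<lambda>t \<omega>. 0)"
    using integral_operator assms unfolding integral_operator_def by blast
  then show ?thesis using assms(3) by (auto simp: indistinguishable_def)
qed

lemma J_elementary:
  assumes "0 \<le> r" "r < s" "U \<in> borel_measurable (F r)" "\<And>\<omega>. \<omega> \<in> space M \<Longrightarrow> \<bar>U \<omega>\<bar> \<le> C" "0 \<le> t"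
  shows "AE \<omega> in M. J (\<lambda>t \<omega>. indicator {r<..s} t * U \<omega>) t \<omega> = U \<omega> * (Z (min s t) \<omega> - Z (min r t) \<omega>)"
proof -
  have "indistinguishable M (J (\<lambda>t \<omega>. indicator {r<..s} t * U \<omega>))
          (\<lambda>t \<omega>. U \<omega> * (Z (min s t) \<omega> - Z (min r t) \<omega>))"
    using integral_operator assms unfolding integral_operator_def by blast
  then show ?thesis using assms(5) by (auto simp: indistinguishable_def)
qed

lemma J_linear:
  assumes "bounded_predictable M F H" "bounded_predictable M F K" "0 \<le> t"
  shows "AE \<omega> in M. J (\<lambda>t \<omega>. a * H t \<omega> + b * K t \<omega>) t \<omega> = a * J H t \<omega> + b * J K t \<omega>"
proof -
  have "indistinguishable M (J (\<lambda>t \<omega>. a * H t \<omega> + b * K t \<omega>)) (\<lambda>t \<omega>. a * J H t \<omega> + b * J K t \<omega>)"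
    using integral_operator assms unfolding integral_operator_def by blast
  then show ?thesis using assms(3) by (auto simp: indistinguishable_def)
qed

lemma J_lim:
  assumes H: "\<And>n. predictable M F (H n)" and K: "predictable M F K"
    and bound: "\<And>n t \<omega>. 0 \<le> t \<Longrightarrow> \<omega> \<in> space M \<Longrightarrow> \<bar>H n t \<omega>\<bar> \<le> C"
    and lim: "\<And>t \<omega>. 0 \<le> t \<Longrightarrow> \<omega> \<in> space M \<Longrightarrow> (\<lambda>n. H n t \<omega>) \<longlonglongrightarrow> K t \<omega>"
    and t: "0 \<le> t"
  shows "conv_in_prob M (\<lambda>n. J (H n) t) (J K t)"
proof -
  have "(\<forall>n. predictable M F (H n)) \<and> predictable M F K \<and>
        (\<forall>n. \<forall>t\<ge>0. \<forall>\<omega>\<in>space M. \<bar>H n t \<omega>\<bar> \<le> C) \<and>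
        (\<forall>t\<ge>0. \<forall>\<omega>\<in>space M. (\<lambda>n. H n t \<omega>) \<longlonglongrightarrow> K t \<omega>)"
    using assms by blast
  with integral_operator have "\<forall>t\<ge>0. \<forall>\<epsilon>>0. (\<lambda>n. measure M {\<omega>\<in>space M. \<epsilon> < \<bar>J (H n) t \<omega> - J K t \<omega>\<bar>}) \<longlonglongrightarrow> 0"
    unfolding integral_operator_def by blast
  with t show ?thesis by (auto simp: conv_in_prob_def)
qed

lemma bounded_predictable_lim:
  assumes "predictable M F K"
    and bound: "\<And>n t \<omega>. 0 \<le> t \<Longrightarrow> \<omega> \<in> space M \<Longrightarrow> \<bar>H n t \<omega>\<bar> \<le> C"
    and lim: "\<And>t \<omega>. 0 \<le> t \<Longrightarrow> \<omega> \<in> space M \<Longrightarrow> (\<lambda>n. H n t \<omega>) \<longlonglongrightarrow> K t \<omega>"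
  shows "bounded_predictable M F K"
proof (rule bounded_predictableI[OF assms(1)])
  fix t :: real and \<omega> assume "0 \<le> t" "\<omega> \<in> space M"
  then show "\<bar>K t \<omega>\<bar> \<le> C"
    using bound by (intro LIMSEQ_le_const2[OF tendsto_rabs[OF lim]]) auto
qed

text \<open>No axiom says directly that equal values on the half-line give the same integral. It
  follows from dominated convergence: the constant sequence H converges boundedly to K, and limits
  in probability are unique.\<close>

lemma J_cong:
  assumes H: "bounded_predictable M F H" and eq: "\<And>(t::real) \<omega>. 0 \<le> t \<Longrightarrow> \<omega> \<in> space M \<Longrightarrow> H t \<omega> = K t \<omega>" and t: "0 \<le> t"
  shows "AE \<omega> in M. J H t \<omega> = J K t \<omega>"
proof -
  obtain C where C: "\<And>t \<omega>. 0 \<le> t \<Longrightarrow> \<omega> \<in> space M \<Longrightarrow> \<bar>H t \<omega>\<bar> \<le> C" "predictable M F H"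
    using H unfolding bounded_predictable_def by blast
  have K: "predictable M F K" using predictable_cong[of H K] eq C(2) by blast
  have bK: "bounded_predictable M F K" using K C eq by (intro bounded_predictableI[where C = C]) auto
  have "conv_in_prob M (\<lambda>n. J H t) (J K t)"
    using C K eq t by (intro J_lim[where C = C]) auto
  moreover have "conv_in_prob M (\<lambda>n. J H t) (J H t)"
    by (simp add: conv_in_prob_def)
  ultimately have "AE \<omega> in M. J K t \<omega> = J H t \<omega>"
    using J_measurable[OF H t] J_measurable[OF bK t] by (intro conv_in_prob_unique) auto
  then show ?thesis by eventually_elim simp
qed

lemma J_zero: "0 \<le> t \<Longrightarrow> AE \<omega> in M. J (\<lambda>t \<omega>. 0) t \<omega> = 0"
  using J_linear[OF bounded_predictable_const bounded_predictable_const, of t 0 0 0 0] by simp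

lemma bounded_predictable_sum:
  "finite I \<Longrightarrow> (\<And>i. i \<in> I \<Longrightarrow> bounded_predictable M F (H i)) \<Longrightarrow>
    bounded_predictable M F (\<lambda>t \<omega>. \<Sum>i\<in>I. H i t \<omega>)"
proof (induction I rule: finite_induct)
  case (insert i I)
  then show ?case using bounded_predictable_linear[of "H i" "\<lambda>t \<omega>. \<Sum>i\<in>I. H i t \<omega>" 1 1] by simp
qed (simp add: bounded_predictable_const)

lemma J_sum:
  assumes "finite I" "\<And>i. i \<in> I \<Longrightarrow> bounded_predictable M F (H i)" and t: "0 \<le> t"
  shows "AE \<omega> in M. J (\<lambda>t \<omega>. \<Sum>i\<in>I. H i t \<omega>) t \<omega> = (\<Sum>i\<in>I. J (H i) t \<omega>)"
  using assms(1,2)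
proof (induction I rule: finite_induct)
  case empty
  then show ?case using J_zero[OF t] by simp
next
  case (insert i I)
  have "AE \<omega> in M. J (\<lambda>t \<omega>. 1 * H i t \<omega> + 1 * (\<Sum>i\<in>I. H i t \<omega>)) t \<omega> = 1 * J (H i) t \<omega> + 1 * J (\<lambda>t \<omega>. \<Sum>i\<in>I. H i t \<omega>) t \<omega>"
    using insert t by (intro J_linear bounded_predictable_sum) auto
  moreover have "AE \<omega> in M. J (\<lambda>t \<omega>. \<Sum>i\<in>I. H i t \<omega>) t \<omega> = (\<Sum>i\<in>I. J (H i) t \<omega>)"
    using insert by auto
  ultimately show ?case
  proof eventually_elim
    case (elim \<omega>)
    then show ?case using insert(1,2) by simp
  qed
qed

text \<open>Elementary integrals start at 0, and linear combinations and limits preserve this. It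
  yields that local times start at 0.\<close>

lemma J_initial:
  assumes "bounded_predictable M F K"
  shows "AE \<omega> in M. J K 0 \<omega> = 0"
  using assms
proof (induction rule: bounded_predictable_induct)
  case (initial A)
  then show ?case by (intro J_elementary_0[where C = 1]) (auto split: split_indicator)
next
  case (interval s t A)
  then have "AE \<omega> in M. J (\<lambda>u \<omega>. indicator {s<..t} u * indicator A \<omega>) 0 \<omega> = indicator A \<omega> * (Z (min t 0) \<omega> - Z (min s 0) \<omega>)"
    by (intro J_elementary[where C = 1]) (auto split: split_indicator)
  then show ?case using interval by (simp add: min_absorb2)
next
  case (linear a b H K)
  from J_linear[OF linear(1,2) order_refl, of a b] linear(3,4) show ?case by eventually_elim simp
next
  case (lim H K C)
  have bH: "bounded_predictable M F (H n)" for n using lim by (intro bounded_predictableI)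
  have bK: "bounded_predictable M F K" using lim by (intro bounded_predictable_lim)
  have "conv_in_prob M (\<lambda>n. J (H n) 0) (J K 0)" using lim by (intro J_lim) auto
  then have "conv_in_prob M (\<lambda>n \<omega>. 0) (J K 0)"
    by (rule conv_in_prob_cong_AE[OF J_measurable[OF bH order_refl] _ J_measurable[OF bK order_refl] lim(5), rotated]) simp
  moreover have "conv_in_prob M (\<lambda>n \<omega>. 0) (\<lambda>\<omega>. 0)" by (simp add: conv_in_prob_def)
  ultimately show ?case using J_measurable[OF bK order_refl] by (intro conv_in_prob_unique[of "\<lambda>n \<omega>. 0"]) auto
qed

text \<open>Associativity for an elementary outer integrand. The axioms evaluate elementary
  integrands against \<open>Z\<close>; this evaluates them against \<open>J K\<close>, which is what
  Riemann sums of the local time integrals require. The induction is over \<open>K\<close>.\<close>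

lemma J_localize:
  assumes K: "bounded_predictable M F K" and rs: "0 \<le> r" "r < s"
    and U: "U \<in> borel_measurable (F r)" "\<And>\<omega>. \<omega> \<in> space M \<Longrightarrow> \<bar>U \<omega>\<bar> \<le> C" and t: "0 \<le> t"
  shows "AE \<omega> in M. J (\<lambda>u \<omega>. indicator {r<..s} u * U \<omega> * K u \<omega>) t \<omega> =
    U \<omega> * (J K (min s t) \<omega> - J K (min r t) \<omega>)"
  using K
proof (induction rule: bounded_predictable_induct)
  case (initial A)
  \<comment> \<open>As r \<ge> 0, the interval (r,s] misses time 0.\<close>
  have z: "(\<lambda>u \<omega>. indicator {r<..s} u * U \<omega> * (indicator {0} u * indicator A \<omega>)) = (\<lambda>u \<omega>. 0 :: real)"
    using rs by (auto simp: fun_eq_iff split: split_indicator)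
  have *: "AE \<omega> in M. J (\<lambda>t \<omega>. indicator {0} t * indicator A \<omega>) v \<omega> = 0" if "0 \<le> v" for v
    using initial that by (intro J_elementary_0[where C = 1]) (auto split: split_indicator)
  have "AE \<omega> in M. J (\<lambda>t \<omega>. indicator {0} t * indicator A \<omega>) (min s t) \<omega> = 0"
    "AE \<omega> in M. J (\<lambda>t \<omega>. indicator {0} t * indicator A \<omega>) (min r t) \<omega> = 0"
    using rs t by (auto intro!: *)
  then show ?case unfolding z using J_zero[OF t] by eventually_elim simp
next
  case (interval s' t' A)
  \<comment> \<open>The product of two elementary integrands lives on the intersection (a,b], and
    both coefficients are measurable at the later starting time a.\<close>
  define a b where "a = max r s'" and "b = min s t'"
  have e: "(\<lambda>u \<omega>. indicator {r<..s} u * U \<omega> * (indicator {s'<..t'} u * indicator A \<omega>)) =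
      (\<lambda>u \<omega>. indicator {a<..b} u * (U \<omega> * indicator A \<omega>) :: real)"
    by (auto simp: fun_eq_iff a_def b_def split: split_indicator)
  have *: "AE \<omega> in M. J (\<lambda>t \<omega>. indicator {s'<..t'} t * indicator A \<omega>) v \<omega> = indicator A \<omega> * (Z (min t' v) \<omega> - Z (min s' v) \<omega>)"
    if "0 \<le> v" for v
    using interval that by (intro J_elementary[where C = 1]) (auto split: split_indicator)
  have v: "0 \<le> min s t" "0 \<le> min r t" using rs t by auto
  show ?case
  proof (cases "a < b")
    case True
    have m: "(\<lambda>\<omega>. U \<omega> * indicator A \<omega>) \<in> borel_measurable (F a)"
    proof (rule borel_measurable_times)
      show "U \<in> borel_measurable (F a)" using U rs by (intro measurable_F_mono[of r a]) (auto simp: a_def)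
      show "indicator A \<in> borel_measurable (F a)"
        using F_mono[of s' a] interval by (intro borel_measurable_indicator) (auto simp: a_def)
    qed
    have J_ab: "AE \<omega> in M. J (\<lambda>u \<omega>. indicator {a<..b} u * (U \<omega> * indicator A \<omega>)) t \<omega> =
        (U \<omega> * indicator A \<omega>) * (Z (min b t) \<omega> - Z (min a t) \<omega>)"
    proof (rule J_elementary[OF _ True m, where C = "\<bar>C\<bar>"])
      show "\<bar>U \<omega> * indicator A \<omega>\<bar> \<le> \<bar>C\<bar>" if "\<omega> \<in> space M" for \<omega>
        using U(2)[OF that] by (auto simp: abs_mult split: split_indicator)
    qed (use rs t in \<open>auto simp: a_def\<close>)
    have Zeq: "Z (min b t) \<omega> - Z (min a t) \<omega> = (Z (min t' (min s t)) \<omega> - Z (min s' (min s t)) \<omega>)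
        - (Z (min t' (min r t)) \<omega> - Z (min s' (min r t)) \<omega>)" for \<omega>
    proof -
      have "min t' (min s t) = min b t" "min s' (min s t) = min s' t" "min t' (min r t) = min r t"
        using True by (auto simp: a_def b_def)
      then show ?thesis
      proof (cases "s' \<le> r")
        case True
        then have "a = r" "min s' (min r t) = min s' t" by (simp_all add: a_def min.assoc[symmetric])
        then show ?thesis using \<open>min t' (min s t) = min b t\<close> \<open>min s' (min s t) = min s' t\<close> \<open>min t' (min r t) = min r t\<close> by simp
      next
        case False
        then have "a = s'" "min s' (min r t) = min r t" by (simp_all add: a_def min.assoc[symmetric] min_absorb2)
        then show ?thesis using \<open>min t' (min s t) = min b t\<close> \<open>min s' (min s t) = min s' t\<close> \<open>min t' (min r t) = min r t\<close> by simp
      qed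
    qed
    show ?thesis
      unfolding e using J_ab *[OF v(1)] *[OF v(2)] 
    proof eventually_elim
      case (elim \<omega>)
      show ?case unfolding elim Zeq by (simp only: mult.assoc right_diff_distrib)
    qed
  next
    case False
    then have z: "(\<lambda>u \<omega>. indicator {a<..b} u * (U \<omega> * indicator A \<omega>)) = (\<lambda>u \<omega>. 0)" by auto
    \<comment> \<open>The intervals do not meet, so the elementary integral over (s',t'] does not
      change between the times min r t and min s t.\<close>
    have Zeq: "(Z (min t' (min s t)) \<omega> - Z (min s' (min s t)) \<omega>) = (Z (min t' (min r t)) \<omega> - Z (min s' (min r t)) \<omega>)" for \<omega>
    proof -
      consider "s \<le> s'" | "t' \<le> r" using False rs interval by (auto simp: a_def b_def)
      then show ?thesis
      proof cases
        case 1
        then have "min t' (min s t) = min s t" "min s' (min s t) = min s t" "min t' (min r t) = min r t" "min s' (min r t) = min r t"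
          using interval rs by auto
        then show ?thesis by simp
      next
        case 2
        then have "min t' (min s t) = min t' t" "min s' (min s t) = min s' t" "min t' (min r t) = min t' t" "min s' (min r t) = min s' t"
          using interval rs by auto
        then show ?thesis by simp
      qed
    qed
    show ?thesis
      unfolding e z using J_zero[OF t] *[OF v(1)] *[OF v(2)] by eventually_elim (simp add: Zeq)
  qed
next
  case (linear a b H K)
  have bpU: "bounded_predictable M F (\<lambda>u \<omega>. indicator {r<..s} u * U \<omega>)"
    by (rule bounded_predictable_elementary[OF rs(1) U])
  have e: "(\<lambda>u \<omega>. indicator {r<..s} u * U \<omega> * (a * H u \<omega> + b * K u \<omega>)) =
      (\<lambda>u \<omega>. a * (indicator {r<..s} u * U \<omega> * H u \<omega>) + b * (indicator {r<..s} u * U \<omega> * K u \<omega>))"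
    by (auto simp: fun_eq_iff algebra_simps)
  have v: "0 \<le> min s t" "0 \<le> min r t" using rs t by auto
  show ?case
    unfolding e
    using J_linear[OF bounded_predictable_mult[OF bpU linear(1)] bounded_predictable_mult[OF bpU linear(2)] t, of a b]
      J_linear[OF linear(1,2) v(1), of a b] J_linear[OF linear(1,2) v(2), of a b] linear(3,4)
  proof eventually_elim
    case (elim \<omega>)
    show ?case unfolding elim by (simp add: algebra_simps)
  qed
next
  case (lim H K D)
  have bpU: "bounded_predictable M F (\<lambda>u \<omega>. indicator {r<..s} u * U \<omega>)"
    by (rule bounded_predictable_elementary[OF rs(1) U])
  have bH: "bounded_predictable M F (H n)" for n using lim by (intro bounded_predictableI)
  have bK: "bounded_predictable M F K" using lim by (intro bounded_predictable_lim)
  have v: "0 \<le> min s t" "0 \<le> min r t" using rs t by auto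
  note bUH = bounded_predictable_mult[OF bpU bH] and bUK = bounded_predictable_mult[OF bpU bK]
  have c1: "conv_in_prob M (\<lambda>n. J (\<lambda>u \<omega>. indicator {r<..s} u * U \<omega> * H n u \<omega>) t) (J (\<lambda>u \<omega>. indicator {r<..s} u * U \<omega> * K u \<omega>) t)"
  proof (rule J_lim[where C = "\<bar>C\<bar> * \<bar>D\<bar>"])
    fix n u \<omega> assume u: "0 \<le> (u::real)" "\<omega> \<in> space M"
    have "\<bar>indicator {r<..s} u * U \<omega>\<bar> \<le> \<bar>C\<bar>" using U(2)[OF u(2)] by (auto split: split_indicator)
    moreover have "\<bar>H n u \<omega>\<bar> \<le> \<bar>D\<bar>" using lim(3)[OF u, of n] by simp
    ultimately show "\<bar>indicator {r<..s} u * U \<omega> * H n u \<omega>\<bar> \<le> \<bar>C\<bar> * \<bar>D\<bar>"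
      by (subst abs_mult) (intro mult_mono, auto)
  next
    fix u \<omega> assume u: "0 \<le> (u::real)" "\<omega> \<in> space M"
    then show "(\<lambda>n. indicator {r<..s} u * U \<omega> * H n u \<omega>) \<longlonglongrightarrow> indicator {r<..s} u * U \<omega> * K u \<omega>"
      by (intro tendsto_intros lim)
  qed (use bUH bUK t in \<open>auto simp: bounded_predictable_def\<close>)
  \<comment> \<open>The identity involves three limits in probability; nested subsequences make all
    of them almost sure at once.\<close>
  obtain r1 where r1: "strict_mono r1" "AE \<omega> in M. (\<lambda>n. J (\<lambda>u \<omega>. indicator {r<..s} u * U \<omega> * H (r1 n) u \<omega>) t \<omega>) \<longlonglongrightarrow> J (\<lambda>u \<omega>. indicator {r<..s} u * U \<omega> * K u \<omega>) t \<omega>"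
    by (rule conv_in_prob_AE_subseq[OF J_measurable[OF bUH t] J_measurable[OF bUK t] c1])
  have c2: "conv_in_prob M (\<lambda>n. J (H (r1 n)) (min s t)) (J K (min s t))"
    by (rule conv_in_prob_subseq[OF J_lim[of H K D] r1(1)]) (fact lim(1-4) v(1))+
  obtain r2 where r2: "strict_mono r2" "AE \<omega> in M. (\<lambda>n. J (H (r1 (r2 n))) (min s t) \<omega>) \<longlonglongrightarrow> J K (min s t) \<omega>"
    by (rule conv_in_prob_AE_subseq[OF J_measurable[OF bH v(1)] J_measurable[OF bK v(1)] c2])
  have c3: "conv_in_prob M (\<lambda>n. J (H (r1 (r2 n))) (min r t)) (J K (min r t))"
    by (rule conv_in_prob_subseq[OF conv_in_prob_subseq[OF J_lim[of H K D] r1(1)] r2(1)]) (fact lim(1-4) v(2))+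
  obtain r3 where r3: "strict_mono r3" "AE \<omega> in M. (\<lambda>n. J (H (r1 (r2 (r3 n)))) (min r t) \<omega>) \<longlonglongrightarrow> J K (min r t) \<omega>"
    by (rule conv_in_prob_AE_subseq[OF J_measurable[OF bH v(2)] J_measurable[OF bK v(2)] c3])
  have "AE \<omega> in M. \<forall>n. J (\<lambda>u \<omega>. indicator {r<..s} u * U \<omega> * H n u \<omega>) t \<omega> =
    U \<omega> * (J (H n) (min s t) \<omega> - J (H n) (min r t) \<omega>)"
    using lim(5) by (simp add: AE_all_countable)
  then show ?case using r1(2) r2(2) r3(2)
  proof eventually_elim
    case (elim \<omega>)
    let ?R = "\<lambda>n. r1 (r2 (r3 n))"
    have "(\<lambda>n. J (\<lambda>u \<omega>. indicator {r<..s} u * U \<omega> * H (?R n) u \<omega>) t \<omega>) \<longlonglongrightarrow> J (\<lambda>u \<omega>. indicator {r<..s} u * U \<omega> * K u \<omega>) t \<omega>"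
      using LIMSEQ_subseq_LIMSEQ[OF LIMSEQ_subseq_LIMSEQ[OF elim(2) r2(1)] r3(1)] by (simp add: comp_def)
    moreover have "(\<lambda>n. J (H (?R n)) (min s t) \<omega>) \<longlonglongrightarrow> J K (min s t) \<omega>"
      using LIMSEQ_subseq_LIMSEQ[OF elim(3) r3(1)] by (simp add: comp_def)
    then have "(\<lambda>n. U \<omega> * (J (H (?R n)) (min s t) \<omega> - J (H (?R n)) (min r t) \<omega>)) \<longlonglongrightarrow> U \<omega> * (J K (min s t) \<omega> - J K (min r t) \<omega>)"
      using elim(4) by (intro tendsto_intros)
    ultimately show ?case using elim(1) LIMSEQ_unique by auto
  qed
qed

text \<open>The integrand 1 is reached through its restriction to (r,s], evaluated once by
  \<open>J_localize\<close> and once as an elementary integrand.\<close>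

lemma J_one:
  assumes "0 \<le> r" "r < s"
  shows "AE \<omega> in M. J (\<lambda>t \<omega>. 1) s \<omega> - J (\<lambda>t \<omega>. 1) r \<omega> = Z s \<omega> - Z r \<omega>"
proof -
  have "AE \<omega> in M. J (\<lambda>u \<omega>. indicator {r<..s} u * 1 * 1) s \<omega> = 1 * (J (\<lambda>t \<omega>. 1) (min s s) \<omega> - J (\<lambda>t \<omega>. 1) (min r s) \<omega>)"
    using assms by (intro J_localize[where C = 1] bounded_predictable_const) auto
  moreover have "AE \<omega> in M. J (\<lambda>u \<omega>. indicator {r<..s} u * 1) s \<omega> = 1 * (Z (min s s) \<omega> - Z (min r s) \<omega>)"
    using assms by (intro J_elementary[where C = 1]) auto
  ultimately show ?thesis
    by eventually_elim (use assms in \<open>simp add: min_absorb1\<close>)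
qed

text \<open>By \<open>J_localize\<close>, a left-endpoint sum against \<open>J K\<close> is almost
  surely \<open>J\<close> of \<open>K\<close> times a step function. The step functions tend to
  \<open>V\<close> on (a,b] by left-continuity, and dominated convergence applies.\<close>

lemma riemann_sum_conv_in_prob:
  assumes K: "bounded_predictable M F K" and ab: "0 \<le> a" "a < b"
    and V: "\<And>t. 0 \<le> t \<Longrightarrow> V t \<in> borel_measurable (F t)" "\<And>t \<omega>. \<bar>V t \<omega>\<bar> \<le> 1"
    and left: "\<And>t \<omega>. \<omega> \<in> space M \<Longrightarrow> t \<in> {a<..b} \<Longrightarrow> ((\<lambda>u. V u \<omega>) \<longlongrightarrow> V t \<omega>) (at_left t)"
  shows "bounded_predictable M F (\<lambda>t \<omega>. indicator {a<..b} t * V t \<omega> * K t \<omega>)"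
    and "conv_in_prob M (\<lambda>n \<omega>. riemann_sum a b n (\<lambda>t. V t \<omega>) (\<lambda>t. J K t \<omega>))
      (J (\<lambda>t \<omega>. indicator {a<..b} t * V t \<omega> * K t \<omega>) b)"
    and "(\<lambda>\<omega>. riemann_sum a b n (\<lambda>t. V t \<omega>) (\<lambda>t. J K t \<omega>)) \<in> borel_measurable M"
proof -
  let ?t = "grid a b"
  have t0: "0 \<le> ?t n k" for n k using grid_bounds(1)[OF ab(2), of n k] ab by linarith
  have b0: "0 \<le> b" using ab by simp
  obtain C where C: "\<And>t \<omega>. 0 \<le> t \<Longrightarrow> \<omega> \<in> space M \<Longrightarrow> \<bar>K t \<omega>\<bar> \<le> C"
    using K unfolding bounded_predictable_def by blast
  have "bounded_predictable M F (\<lambda>t \<omega>. indicator {a<..b} t * V t \<omega>)"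
    using V(2) by (intro bounded_predictableI[where C = 1] predictable_left_continuous_interval[OF ab V(1) left])
      (auto split: split_indicator)
  then show bp: "bounded_predictable M F (\<lambda>t \<omega>. indicator {a<..b} t * V t \<omega> * K t \<omega>)"
    using K by (rule bounded_predictable_mult)
  define S where "S n = (\<lambda>t \<omega>. (\<Sum>j<Suc n. indicator {?t n j<..?t n (Suc j)} t * V (?t n j) \<omega>) * K t \<omega>)" for n
  have S_eq: "S n = (\<lambda>t \<omega>. \<Sum>j<Suc n. indicator {?t n j<..?t n (Suc j)} t * V (?t n j) \<omega> * K t \<omega>)" for n
    by (simp only: S_def sum_distrib_right)
  have bpj: "bounded_predictable M F (\<lambda>t \<omega>. indicator {?t n j<..?t n (Suc j)} t * V (?t n j) \<omega> * K t \<omega>)" for n j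
    using V t0 by (intro bounded_predictable_mult[OF _ K] bounded_predictableI[where C = 1] predictable_elementary)
      (auto split: split_indicator)
  have bpS: "bounded_predictable M F (S n)" for n
    unfolding S_eq using bpj by (intro bounded_predictable_sum) auto
  have conv: "conv_in_prob M (\<lambda>n. J (S n) b) (J (\<lambda>t \<omega>. indicator {a<..b} t * V t \<omega> * K t \<omega>) b)"
  proof (rule J_lim[where C = C])
    show "predictable M F (S n)" for n using bpS by (simp add: bounded_predictable_def)
    show "predictable M F (\<lambda>t \<omega>. indicator {a<..b} t * V t \<omega> * K t \<omega>)" using bp by (simp add: bounded_predictable_def)
    fix t :: real and \<omega> assume t: "0 \<le> t" "\<omega> \<in> space M"
    \<comment> \<open>At each time at most one cell contributes, so the bound does not grow with
      n.\<close>
    show "\<bar>S n t \<omega>\<bar> \<le> C" for n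
    proof (cases "t \<in> {a<..b}")
      case True
      obtain k where "\<And>f :: nat \<Rightarrow> real. (\<Sum>j<Suc n. indicator {?t n j<..?t n (Suc j)} t * f j) = f k"
        by (rule grid_step[OF ab(2) True, of n]) blast
      then have "S n t \<omega> = V (?t n k) \<omega> * K t \<omega>" by (simp only: S_def)
      then show ?thesis
        using V(2)[of "?t n k" \<omega>] C[OF t] mult_mono[of "\<bar>V (?t n k) \<omega>\<bar>" 1 "\<bar>K t \<omega>\<bar>" C] by (simp add: abs_mult)
    next
      case False
      then have "S n t \<omega> = 0" by (simp only: S_def grid_step_outside[OF ab(2) False] mult_zero_left)
      then show ?thesis using C[OF t] by simp
    qed
    show "(\<lambda>n. S n t \<omega>) \<longlonglongrightarrow> indicator {a<..b} t * V t \<omega> * K t \<omega>"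
      unfolding S_def using left[OF t(2)]
      by (intro tendsto_mult grid_step_tendsto[OF ab(2), of t "\<lambda>u. V u \<omega>"] tendsto_const) auto
  qed (use ab in auto)
  have AE_eq: "AE \<omega> in M. J (S n) b \<omega> = riemann_sum a b n (\<lambda>t. V t \<omega>) (\<lambda>t. J K t \<omega>)" for n
  proof -
    have "AE \<omega> in M. \<forall>j<Suc n. J (\<lambda>t \<omega>. indicator {?t n j<..?t n (Suc j)} t * V (?t n j) \<omega> * K t \<omega>) b \<omega> =
      V (?t n j) \<omega> * (J K (?t n (Suc j)) \<omega> - J K (?t n j) \<omega>)"
    proof (intro AE_all_countable[THEN iffD2] allI AE_impI)
      fix j assume j: "j < Suc n"
      have le: "?t n j \<le> b" "?t n (Suc j) \<le> b" using j ab by (auto intro!: grid_bounds)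
      have "AE \<omega> in M. J (\<lambda>t \<omega>. indicator {?t n j<..?t n (Suc j)} t * V (?t n j) \<omega> * K t \<omega>) b \<omega> =
        V (?t n j) \<omega> * (J K (min (?t n (Suc j)) b) \<omega> - J K (min (?t n j) b) \<omega>)"
        using V t0 b0 ab by (intro J_localize[OF K, where C = 1] grid_less) auto
      then show "AE \<omega> in M. J (\<lambda>t \<omega>. indicator {?t n j<..?t n (Suc j)} t * V (?t n j) \<omega> * K t \<omega>) b \<omega> =
        V (?t n j) \<omega> * (J K (?t n (Suc j)) \<omega> - J K (?t n j) \<omega>)"
        using le by (simp add: min_absorb1)
    qed
    moreover have "AE \<omega> in M. J (S n) b \<omega> = (\<Sum>j<Suc n. J (\<lambda>t \<omega>. indicator {?t n j<..?t n (Suc j)} t * V (?t n j) \<omega> * K t \<omega>) b \<omega>)"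
      unfolding S_eq using bpj b0 by (intro J_sum) auto
    ultimately show ?thesis
    proof eventually_elim
      case (elim \<omega>)
      show ?case unfolding elim(2) riemann_sum_def using elim(1) by (intro sum.cong) auto
    qed
  qed
  have meas: "(\<lambda>\<omega>. riemann_sum a b n (\<lambda>t. V t \<omega>) (\<lambda>t. J K t \<omega>)) \<in> borel_measurable M" for n
    unfolding riemann_sum_def
    by (intro borel_measurable_sum borel_measurable_times borel_measurable_diff J_measurable[OF K] t0 measurable_F_M[OF _ V(1)])
  then show "(\<lambda>\<omega>. riemann_sum a b n (\<lambda>t. V t \<omega>) (\<lambda>t. J K t \<omega>)) \<in> borel_measurable M" .
  show "conv_in_prob M (\<lambda>n \<omega>. riemann_sum a b n (\<lambda>t. V t \<omega>) (\<lambda>t. J K t \<omega>))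
      (J (\<lambda>t \<omega>. indicator {a<..b} t * V t \<omega> * K t \<omega>) b)"
    using conv_in_prob_cong_AE[OF J_measurable[OF bpS b0] meas J_measurable[OF bp b0] AE_eq conv] .
qed

end

section \<open>Path properties decided at rational times\<close>

lemma continuous_on_halfline_near_right:
  fixes x :: "real \<Rightarrow> real"
  assumes x: "continuous_on {0..} x" and s: "0 \<le> s" and e: "0 < e" and t: "s < t"
  obtains r where "r \<in> \<rat>" "s < r" "r < t" "\<bar>x r - x s\<bar> < e"
proof -
  obtain d where d: "d > 0" "\<And>u. 0 \<le> u \<Longrightarrow> dist u s < d \<Longrightarrow> dist (x u) (x s) < e"
    using x s e unfolding continuous_on_iff by (metis atLeast_iff)
  obtain r where "r \<in> \<rat>" "s < r" "r < min (s + d) t"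
    using Rats_dense_in_real[of s "min (s + d) t"] d t by auto
  with d(2)[of r] s show thesis by (intro that[of r]) (auto simp: dist_real_def)
qed

text \<open>Compactness. Bounds of the form 1 / Suc k keep later quantifiers over bounds
  countable.\<close>

lemma nonzero_on_interval_bounded_away:
  fixes x :: "real \<Rightarrow> real"
  assumes x: "continuous_on {a..b} x" and nz: "\<And>w. a \<le> w \<Longrightarrow> w \<le> b \<Longrightarrow> x w \<noteq> 0"
  obtains k :: nat where "\<And>w. a \<le> w \<Longrightarrow> w \<le> b \<Longrightarrow> 1 / Suc k \<le> \<bar>x w\<bar>"
proof (cases "a \<le> b")
  case True
  have "continuous_on {a..b} (\<lambda>w. \<bar>x w\<bar>)" using x by (intro continuous_intros)
  then obtain c where c: "c \<in> {a..b}" "\<And>w. w \<in> {a..b} \<Longrightarrow> \<bar>x c\<bar> \<le> \<bar>x w\<bar>"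
    using continuous_attains_inf[of "{a..b}" "\<lambda>w. \<bar>x w\<bar>"] True by auto
  have "\<bar>x c\<bar> > 0" using c nz[of c] by auto
  then obtain k where "1 / Suc k < \<bar>x c\<bar>" using nat_approx_posE by blast
  then show thesis using c by (intro that[of k]) (meson atLeastAtMost_iff less_imp_le order_trans)
qed (auto intro: that)

lemma nonzero_on_interval_sign:
  fixes x :: "real \<Rightarrow> real"
  assumes x: "continuous_on {a..b} x" and nz: "\<And>w. a \<le> w \<Longrightarrow> w \<le> b \<Longrightarrow> x w \<noteq> 0"
  shows "(\<forall>w\<in>{a..b}. 0 < x w) \<or> (\<forall>w\<in>{a..b}. x w < 0)"
proof (rule ccontr)
  assume "\<not> ?thesis"
  then obtain v w where vw: "v \<in> {a..b}" "w \<in> {a..b}" "x v \<le> 0" "0 \<le> x w" by (auto simp: not_less)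
  have "is_interval (x ` {a..b})"
    using x by (simp add: is_interval_connected_1 connected_continuous_image)
  then have "0 \<in> x ` {a..b}" using vw mem_is_interval_1_I[of "x ` {a..b}" "x v" "x w" 0] by auto
  then show False using nz by auto
qed

text \<open>The assumption \<open>rat\<close> ranges over countably many cases, so it can be secured
  outside one null set. It suffices because on a compact interval inside an excursion x keeps its
  sign and stays away from 0.\<close>

lemma constant_on_excursions:
  fixes p x :: "real \<Rightarrow> real"
  assumes p: "continuous_on {0..} p" and x: "continuous_on {0..} x"
    and rat: "\<And>a b m. a \<in> \<rat> \<Longrightarrow> b \<in> \<rat> \<Longrightarrow> 0 \<le> a \<Longrightarrow> a < b \<Longrightarrow>
      (\<forall>t\<in>{a..b}. 1 / Suc m \<le> x t) \<or> (\<forall>t\<in>{a..b}. 1 / Suc m \<le> - x t) \<Longrightarrow> p a = p b"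
    and uv: "0 \<le> u" "u < v" and nz: "\<And>w. u < w \<Longrightarrow> w < v \<Longrightarrow> x w \<noteq> 0"
  shows "p u = p v"
proof -
  let ?S = "{u<..<v} \<inter> \<rat>"
  have eq: "p a = p b" if ab: "a \<in> ?S" "b \<in> ?S" "a < b" for a b
  proof -
    have xab: "continuous_on {a..b} x" using x ab uv by (auto intro: continuous_on_subset)
    have nz': "x w \<noteq> 0" if "a \<le> w" "w \<le> b" for w using that ab by (intro nz) auto
    obtain k :: nat where k: "\<And>w. a \<le> w \<Longrightarrow> w \<le> b \<Longrightarrow> 1 / Suc k \<le> \<bar>x w\<bar>"
      using nonzero_on_interval_bounded_away[OF xab nz'] by blast
    have "(\<forall>t\<in>{a..b}. 1 / Suc k \<le> x t) \<or> (\<forall>t\<in>{a..b}. 1 / Suc k \<le> - x t)"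
      using nonzero_on_interval_sign[OF xab nz']
    proof
      assume "\<forall>w\<in>{a..b}. 0 < x w"
      then have "1 / Suc k \<le> x t" if "t \<in> {a..b}" for t using k[of t] that by fastforce
      then show ?thesis by blast
    next
      assume "\<forall>w\<in>{a..b}. x w < 0"
      then have "1 / Suc k \<le> - x t" if "t \<in> {a..b}" for t using k[of t] that by fastforce
      then show ?thesis by blast
    qed
    then show ?thesis using ab uv by (intro rat) auto
  qed
  obtain c where c: "c \<in> \<rat>" "u < c" "c < v" using Rats_dense_in_real[OF uv(2)] by blast
  have const: "p w = p c" if "w \<in> ?S" for w
  proof -
    have "c \<in> ?S" using c by simp
    then show ?thesis using eq[of w c] eq[of c w] that by (metis linorder_less_linear)
  qed
  \<comment> \<open>Density of the rationals and continuity of \<open>p\<close> carry the constancy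
    to the endpoints, where x may vanish.\<close>
  have cl: "closure ?S = {u..v}"
    using uv(2) by (subst closure_open_Int_superset) (auto simp: Rats_closure_real)
  have pc: "continuous_on (closure ?S) p" unfolding cl using p uv by (auto intro: continuous_on_subset)
  have "p w = p c" if "w \<in> {u..v}" for w
    using continuous_constant_on_closure[OF pc const] that cl by blast
  then show ?thesis using uv by auto
qed

text \<open>Both times are approximated from the right, so time 0 is covered although only positive
  rationals are compared.\<close>

lemma mono_on_from_rationals:
  fixes f :: "real \<Rightarrow> real"
  assumes f: "continuous_on {0..} f"
    and rat: "\<And>a b. a \<in> \<rat> \<Longrightarrow> b \<in> \<rat> \<Longrightarrow> 0 < a \<Longrightarrow> a < b \<Longrightarrow> f a \<le> f b"
  shows "mono_on {0..} f"
proof (rule mono_onI)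
  fix u v :: real assume "u \<in> {0..}" "v \<in> {0..}" "u \<le> v"
  show "f u \<le> f v"
  proof (cases "u < v")
    case True
    have u0: "0 \<le> u" and v0: "0 \<le> v" using \<open>u \<in> {0..}\<close> \<open>v \<in> {0..}\<close> by auto
    show ?thesis
    proof (rule field_le_epsilon)
      fix e :: real assume "0 < e"
      then have e: "0 < e / 2" by simp
      obtain a where a: "a \<in> \<rat>" "u < a" "a < v" "\<bar>f a - f u\<bar> < e / 2"
        by (rule continuous_on_halfline_near_right[OF f u0 e True])
      obtain b where b: "b \<in> \<rat>" "v < b" "\<bar>f b - f v\<bar> < e / 2"
        by (rule continuous_on_halfline_near_right[OF f v0 e, of "v + 1"]) auto
      have "f a \<le> f b" using a b u0 by (intro rat) auto
      then show "f u \<le> f v + e" using a b by linarith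
    qed
  qed (use \<open>u \<le> v\<close> in auto)
qed

text \<open>Rational times can miss every zero of x, so nonvanishing has to be stated
  quantitatively: |x| is bounded away from 0 on the rationals of each [s,u] with u < t. By
  continuity this excludes zeros in all of [s,t).\<close>

lemma hysteresis_eq_0_iff_rational:
  fixes x :: "real \<Rightarrow> real"
  assumes x: "continuous_on {0..} x"
  shows "hysteresis \<epsilon> x t = 0 \<longleftrightarrow> (\<exists>s\<in>\<rat>. 0 \<le> s \<and> s < t \<and> \<epsilon> < \<bar>x s\<bar> \<and>
    (\<forall>u\<in>\<rat>. s \<le> u \<and> u < t \<longrightarrow> (\<exists>k::nat. \<forall>v\<in>\<rat>. s \<le> v \<and> v \<le> u \<longrightarrow> 1 / Suc k \<le> \<bar>x v\<bar>)))" (is "_ \<longleftrightarrow> ?R")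
proof
  assume "hysteresis \<epsilon> x t = 0"
  then obtain s where s: "0 \<le> s" "s < t" "\<epsilon> < \<bar>x s\<bar>" "\<And>u. s \<le> u \<Longrightarrow> u < t \<Longrightarrow> x u \<noteq> 0"
    by (rule hysteresis_eq_0D) blast
  obtain r where r: "r \<in> \<rat>" "s < r" "r < t" "\<bar>x r - x s\<bar> < \<bar>x s\<bar> - \<epsilon>"
    by (rule continuous_on_halfline_near_right[OF x s(1) _ s(2), of "\<bar>x s\<bar> - \<epsilon>"]) (use s in auto)
  have "\<exists>k::nat. \<forall>v\<in>\<rat>. r \<le> v \<and> v \<le> u \<longrightarrow> 1 / Suc k \<le> \<bar>x v\<bar>" if "u < t" for u
  proof -
    have c: "continuous_on {r..u} x" using x s r by (auto intro: continuous_on_subset)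
    have nz: "x w \<noteq> 0" if "r \<le> w" "w \<le> u" for w using that \<open>u < t\<close> r by (intro s(4)) auto
    obtain k :: nat where "\<And>w. r \<le> w \<Longrightarrow> w \<le> u \<Longrightarrow> 1 / Suc k \<le> \<bar>x w\<bar>"
      using nonzero_on_interval_bounded_away[OF c nz] by blast
    then show ?thesis by blast
  qed
  moreover have "\<epsilon> < \<bar>x r\<bar>" using r by linarith
  ultimately show ?R using r s by (intro bexI[of _ r]) auto
next
  assume ?R
  then obtain s where s: "s \<in> \<rat>" "0 \<le> s" "s < t" "\<epsilon> < \<bar>x s\<bar>"
    "\<And>u. u \<in> \<rat> \<Longrightarrow> s \<le> u \<Longrightarrow> u < t \<Longrightarrow> \<exists>k::nat. \<forall>v\<in>\<rat>. s \<le> v \<and> v \<le> u \<longrightarrow> 1 / Suc k \<le> \<bar>x v\<bar>"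
    by blast
  show "hysteresis \<epsilon> x t = 0"
  proof (rule hysteresis_eq_0I[of s t \<epsilon> x, OF s(2-4)])
    fix w assume w: "s \<le> w" "w < t"
    obtain u where u: "u \<in> \<rat>" "w < u" "u < t" using Rats_dense_in_real[OF w(2)] by blast
    then obtain k :: nat where k: "\<And>v. v \<in> \<rat> \<Longrightarrow> s \<le> v \<Longrightarrow> v \<le> u \<Longrightarrow> 1 / Suc k \<le> \<bar>x v\<bar>"
      using s(5)[of u] w by auto
    have w0: "0 \<le> w" using w s by simp
    obtain r where r: "r \<in> \<rat>" "w < r" "r < u" "\<bar>x r - x w\<bar> < 1 / Suc k"
      by (rule continuous_on_halfline_near_right[OF x w0 _ u(2), of "1 / Suc k"]) auto
    then show "x w \<noteq> 0" using k[of r] w by auto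
  qed
qed

text \<open>A violation at s persists just to the right of s, and the half-open interval leaves room
  there for a rational below t.\<close>

lemma bound_iff_rational:
  fixes x :: "real \<Rightarrow> real"
  assumes x: "continuous_on {0..} x" and a: "0 \<le> a"
  shows "(\<forall>s\<in>{a..<t}. \<delta> \<le> x s) \<longleftrightarrow> (\<forall>s\<in>\<rat>. a \<le> s \<and> s < t \<longrightarrow> \<delta> \<le> x s)"
proof (intro iffI ballI)
  fix s assume R: "\<forall>s\<in>\<rat>. a \<le> s \<and> s < t \<longrightarrow> \<delta> \<le> x s" and s: "s \<in> {a..<t}"
  show "\<delta> \<le> x s"
  proof (rule ccontr)
    assume "\<not> \<delta> \<le> x s"
    then have e: "0 < \<delta> - x s" by simp
    have s0: "0 \<le> s" and st: "s < t" using s a by auto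
    obtain r where "r \<in> \<rat>" "s < r" "r < t" "\<bar>x r - x s\<bar> < \<delta> - x s"
      by (rule continuous_on_halfline_near_right[OF x s0 e st])
    then show False using R s by fastforce
  qed
qed auto

section \<open>Adaptedness of the weights\<close>

context usual_filtered_prob_space
begin

lemma pred_Rats:
  assumes "\<And>r :: real. r \<in> \<rat> \<Longrightarrow> Measurable.pred N (\<lambda>\<omega>. Q \<omega> r)"
  shows "Measurable.pred N (\<lambda>\<omega>. \<forall>r\<in>\<rat>. Q \<omega> r)" "Measurable.pred N (\<lambda>\<omega>. \<exists>r\<in>\<rat>. Q \<omega> r)"
  using assms countable_rat unfolding pred_def
  by (auto intro!: sets.sets_Collect_countable_All' sets.sets_Collect_countable_Ex')

text \<open>With clipped times, measurability holds without a side condition on v, so formulas over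
  all rational times can be treated uniformly.\<close>

lemma clipped_measurable:
  assumes X: "adapted F X" and t: "0 \<le> t"
  shows "X (max 0 (min v t)) \<in> borel_measurable (F t)"
  using X t by (intro measurable_F_mono[of "max 0 (min v t)" t]) (auto simp: adapted_def)

text \<open>The countable description of the weight is valid for continuous paths only. On the
  exceptional set the value is 0, and completeness of the filtration keeps the result
  adapted.\<close>

lemma hysteresis_measurable:
  assumes X: "adapted F X" and N: "N \<in> null_sets M"
    and cont: "\<And>\<omega>. \<omega> \<in> space M - N \<Longrightarrow> continuous_on {0..} (\<lambda>t. X t \<omega>)" and t: "0 \<le> t"
  shows "(\<lambda>\<omega>. if \<omega> \<in> N then 0 else hysteresis \<epsilon> (\<lambda>u. X u \<omega>) t) \<in> borel_measurable (F t)"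
proof -
  define c where "c v = max 0 (min v t)" for v
  have [measurable]: "X (c v) \<in> borel_measurable (F t)" for v
    unfolding c_def using X t by (rule clipped_measurable)
  have [measurable]: "N \<in> sets (F t)" using null_sets_F N t by blast
  define Q where "Q \<omega> \<longleftrightarrow> (\<exists>s\<in>\<rat>. 0 \<le> s \<and> s < t \<and> \<epsilon> < \<bar>X (c s) \<omega>\<bar> \<and>
    (\<forall>u\<in>\<rat>. s \<le> u \<and> u < t \<longrightarrow> (\<exists>k::nat. \<forall>v\<in>\<rat>. s \<le> v \<and> v \<le> u \<longrightarrow> 1 / Suc k \<le> \<bar>X (c v) \<omega>\<bar>)))" for \<omega>
  have [measurable]: "Measurable.pred (F t) Q"
    unfolding Q_def[abs_def]
    by (intro pred_Rats pred_intros_countable pred_intros_logic pred_intros_countable) measurable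
  have "(\<lambda>\<omega>. if \<omega> \<in> N then 0 else if Q \<omega> then 0 else 1 :: real) \<in> borel_measurable (F t)"
    by measurable
  moreover have "(if \<omega> \<in> N then 0 else if Q \<omega> then 0 else 1) = (if \<omega> \<in> N then 0 else hysteresis \<epsilon> (\<lambda>u. X u \<omega>) t)"
    if \<omega>: "\<omega> \<in> space (F t)" for \<omega>
  proof (cases "\<omega> \<in> N")
    case False
    have "c v = v" if "0 \<le> v" "v < t" for v using that by (simp add: c_def)
    then have "Q \<omega> \<longleftrightarrow> (\<exists>s\<in>\<rat>. 0 \<le> s \<and> s < t \<and> \<epsilon> < \<bar>X s \<omega>\<bar> \<and>
      (\<forall>u\<in>\<rat>. s \<le> u \<and> u < t \<longrightarrow> (\<exists>k::nat. \<forall>v\<in>\<rat>. s \<le> v \<and> v \<le> u \<longrightarrow> 1 / Suc k \<le> \<bar>X v \<omega>\<bar>)))"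
      unfolding Q_def by (intro bex_cong conj_cong ball_cong imp_cong ex_cong1) auto
    then have "Q \<omega> \<longleftrightarrow> hysteresis \<epsilon> (\<lambda>u. X u \<omega>) t = 0"
      using hysteresis_eq_0_iff_rational[OF cont, of \<omega> \<epsilon> t] \<omega> False space_F[OF t] by simp
    then show ?thesis using False hysteresis_cases[of \<epsilon> "\<lambda>u. X u \<omega>" t] by auto
  qed simp
  ultimately show ?thesis by (simp cong: measurable_cong)
qed

lemma lower_bound_measurable:
  assumes X: "adapted F X" and N: "N \<in> null_sets M"
    and cont: "\<And>\<omega>. \<omega> \<in> space M - N \<Longrightarrow> continuous_on {0..} (\<lambda>t. X t \<omega>)" and a: "0 \<le> a" and t: "0 \<le> t"
  shows "(\<lambda>\<omega>. if \<omega> \<in> N then 0 else if \<forall>s\<in>{a..<t}. \<delta> \<le> X s \<omega> then 1 else 0 :: real) \<in> borel_measurable (F t)"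
proof -
  define c where "c v = max 0 (min v t)" for v
  have [measurable]: "X (c v) \<in> borel_measurable (F t)" for v
    unfolding c_def using X t by (rule clipped_measurable)
  have [measurable]: "N \<in> sets (F t)" using null_sets_F N t by blast
  define Q where "Q \<omega> \<longleftrightarrow> (\<forall>s\<in>\<rat>. a \<le> s \<and> s < t \<longrightarrow> \<delta> \<le> X (c s) \<omega>)" for \<omega>
  have [measurable]: "Measurable.pred (F t) Q"
    unfolding Q_def[abs_def]
    by (intro pred_Rats pred_intros_countable pred_intros_logic pred_intros_countable) measurable
  have "(\<lambda>\<omega>. if \<omega> \<in> N then 0 else if Q \<omega> then 1 else 0 :: real) \<in> borel_measurable (F t)"
    by measurable
  moreover have "(if \<omega> \<in> N then 0 else if Q \<omega> then 1 else 0) =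
    (if \<omega> \<in> N then 0 else if \<forall>s\<in>{a..<t}. \<delta> \<le> X s \<omega> then 1 else 0 :: real)"
    if \<omega>: "\<omega> \<in> space (F t)" for \<omega>
  proof (cases "\<omega> \<in> N")
    case False
    have "c v = v" if "a \<le> v" "v < t" for v using that a by (simp add: c_def)
    then have "Q \<omega> \<longleftrightarrow> (\<forall>s\<in>\<rat>. a \<le> s \<and> s < t \<longrightarrow> \<delta> \<le> X s \<omega>)"
      unfolding Q_def by (intro ball_cong imp_cong) auto
    also have "\<dots> \<longleftrightarrow> (\<forall>s\<in>{a..<t}. \<delta> \<le> X s \<omega>)"
      using bound_iff_rational[OF cont a, of \<omega> t \<delta>] \<omega> False space_F[OF t] by simp
    finally show ?thesis by simp
  qed simp
  ultimately show ?thesis by (simp cong: measurable_cong)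
qed

end

section \<open>Increments of an integral while its integrand is constant\<close>

context integral_operator_space
begin

text \<open>
  The indicator of the event that \<open>P\<close> is at least \<open>\<delta>\<close> on \<open>[a,t)\<close> is left-continuous and adapted in \<open>t\<close>;
  as an integrand it replaces the stochastic interval up to the first time \<open>P\<close> drops below \<open>\<delta>\<close>.
\<close>

lemma J_increment_on_constant:
  assumes K: "bounded_predictable M F K" and P: "adapted F P" and N: "N \<in> null_sets M"
    and cont: "\<And>\<omega>. \<omega> \<in> space M - N \<Longrightarrow> continuous_on {0..} (\<lambda>t. P t \<omega>)"
    and c: "\<And>t \<omega>. \<omega> \<in> space M - N \<Longrightarrow> 0 \<le> t \<Longrightarrow> \<delta> \<le> P t \<omega> \<Longrightarrow> K t \<omega> = c"
    and ab: "0 \<le> a" "a < b"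
  shows "AE \<omega> in M. (\<forall>t\<in>{a..b}. \<delta> \<le> P t \<omega>) \<longrightarrow> J K b \<omega> - J K a \<omega> = c * (Z b \<omega> - Z a \<omega>)"
proof -
  define V where "V t \<omega> = (if \<omega> \<in> N then 0 else if \<forall>s\<in>{a..<t}. \<delta> \<le> P s \<omega> then 1 else 0 :: real)" for t \<omega>
  have b0: "0 \<le> b" using ab by simp
  have V: "V t \<in> borel_measurable (F t)" if "0 \<le> t" for t
    unfolding V_def using lower_bound_measurable[OF P N cont ab(1) that] .
  have V1: "\<bar>V t \<omega>\<bar> \<le> 1" for t \<omega> by (simp add: V_def)
  have left: "((\<lambda>u. V u \<omega>) \<longlongrightarrow> V t \<omega>) (at_left t)" if "t \<in> {a<..b}" for t \<omega>
  proof (rule tendsto_eventually)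
    have "\<exists>s<t. \<forall>u\<in>{s<..<t}. V u \<omega> = V t \<omega>"
    proof (cases "\<forall>s\<in>{a..<t}. \<delta> \<le> P s \<omega>")
      case True
      then show ?thesis using that by (intro exI[of _ a]) (auto simp: V_def)
    next
      case False
      then obtain s where "s \<in> {a..<t}" "\<not> \<delta> \<le> P s \<omega>" by blast
      then show ?thesis by (intro exI[of _ s]) (auto simp: V_def)
    qed
    then obtain s where s: "s < t" "\<And>u. u \<in> {s<..<t} \<Longrightarrow> V u \<omega> = V t \<omega>" by blast
    show "\<forall>\<^sub>F u in at_left t. V u \<omega> = V t \<omega>"
      using eventually_at_left_real[OF s(1)] by (auto elim!: eventually_mono intro: s(2))
  qed
  note R = riemann_sum_conv_in_prob[OF K ab V V1 left]
  \<comment> \<open>The same sums with integrand 1 produce increments of \<open>Z\<close> by way of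
    \<open>J_one\<close>.\<close>
  note R1 = riemann_sum_conv_in_prob[OF bounded_predictable_const[of 1] ab V V1 left]
  \<comment> \<open>Where the weight is nonzero, \<open>K\<close> equals c. The summand 0 * 0 gives
    the right-hand side the shape that \<open>J_linear\<close> expects.\<close>
  have eq: "indicator {a<..b} t * V t \<omega> * K t \<omega> = c * (indicator {a<..b} t * V t \<omega> * 1) + 0 * (0::real)"
    if "0 \<le> t" "\<omega> \<in> space M" for t \<omega>
  proof (cases "t \<in> {a<..b} \<and> \<omega> \<notin> N \<and> (\<forall>s\<in>{a..<t}. \<delta> \<le> P s \<omega>)")
    case True
    \<comment> \<open>The weight controls \<open>P\<close> only before t; continuity of the path
      extends the bound to t itself.\<close>
    have "\<delta> \<le> P t \<omega>"
    proof (rule tendsto_lowerbound)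
      show "((\<lambda>s. P s \<omega>) \<longlongrightarrow> P t \<omega>) (at_left t)"
      proof (rule continuous_on_Icc_at_leftD)
        show "continuous_on {a..t} (\<lambda>s. P s \<omega>)"
        proof (rule continuous_on_subset[OF cont])
          show "\<omega> \<in> space M - N" using True that by simp
          show "{a..t} \<subseteq> {0..}" using ab by auto
        qed
      qed (use True in auto)
      show "\<forall>\<^sub>F s in at_left t. \<delta> \<le> P s \<omega>"
        using eventually_at_left_real[of a t] True by (auto elim!: eventually_mono)
    qed simp
    then have "K t \<omega> = c" using c[of \<omega> t] True that by auto
    then show ?thesis by simp
  next
    case False
    then have "t \<notin> {a<..b} \<or> V t \<omega> = 0" unfolding V_def by metis
    then show ?thesis by (elim disjE) simp_all
  qed
  have A1: "AE \<omega> in M. J (\<lambda>t \<omega>. indicator {a<..b} t * V t \<omega> * K t \<omega>) b \<omega> =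
      J (\<lambda>t \<omega>. c * (indicator {a<..b} t * V t \<omega> * 1) + 0 * 0) b \<omega>"
    using R(1) eq b0 by (rule J_cong)
  have A2: "AE \<omega> in M. J (\<lambda>t \<omega>. c * (indicator {a<..b} t * V t \<omega> * 1) + 0 * 0) b \<omega> =
      c * J (\<lambda>t \<omega>. indicator {a<..b} t * V t \<omega> * 1) b \<omega> + 0 * J (\<lambda>t \<omega>. 0) b \<omega>"
    using R1(1) b0 by (intro J_linear bounded_predictable_const)
  obtain r1 where r1: "strict_mono r1"
    "AE \<omega> in M. (\<lambda>n. riemann_sum a b (r1 n) (\<lambda>t. V t \<omega>) (\<lambda>t. J K t \<omega>)) \<longlonglongrightarrow> J (\<lambda>t \<omega>. indicator {a<..b} t * V t \<omega> * K t \<omega>) b \<omega>"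
    by (rule conv_in_prob_AE_subseq[OF R(3) J_measurable[OF R(1) b0] R(2)])
  obtain r2 where r2: "strict_mono r2"
    "AE \<omega> in M. (\<lambda>n. riemann_sum a b (r2 n) (\<lambda>t. V t \<omega>) (\<lambda>t. J (\<lambda>t \<omega>. 1) t \<omega>)) \<longlonglongrightarrow> J (\<lambda>t \<omega>. indicator {a<..b} t * V t \<omega> * 1) b \<omega>"
    by (rule conv_in_prob_AE_subseq[OF R1(3) J_measurable[OF R1(1) b0] R1(2)])
  have A3: "AE \<omega> in M. \<omega> \<notin> N" using N by (rule AE_not_in)
  show ?thesis using A1 A2 r1(2) r2(2) A3 J_one[OF ab]
  proof (eventually_elim, intro impI)
    fix \<omega>
    assume l: "J (\<lambda>t \<omega>. indicator {a<..b} t * V t \<omega> * K t \<omega>) b \<omega> = J (\<lambda>t \<omega>. c * (indicator {a<..b} t * V t \<omega> * 1) + 0 * 0) b \<omega>"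
      "J (\<lambda>t \<omega>. c * (indicator {a<..b} t * V t \<omega> * 1) + 0 * 0) b \<omega> =
        c * J (\<lambda>t \<omega>. indicator {a<..b} t * V t \<omega> * 1) b \<omega> + 0 * J (\<lambda>t \<omega>. 0) b \<omega>"
      and lim: "(\<lambda>n. riemann_sum a b (r1 n) (\<lambda>t. V t \<omega>) (\<lambda>t. J K t \<omega>)) \<longlonglongrightarrow> J (\<lambda>t \<omega>. indicator {a<..b} t * V t \<omega> * K t \<omega>) b \<omega>"
        "(\<lambda>n. riemann_sum a b (r2 n) (\<lambda>t. V t \<omega>) (\<lambda>t. J (\<lambda>t \<omega>. 1) t \<omega>)) \<longlonglongrightarrow> J (\<lambda>t \<omega>. indicator {a<..b} t * V t \<omega> * 1) b \<omega>"
      and "\<omega> \<notin> N" and one: "J (\<lambda>t \<omega>. 1) b \<omega> - J (\<lambda>t \<omega>. 1) a \<omega> = Z b \<omega> - Z a \<omega>"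
      and P: "\<forall>t\<in>{a..b}. \<delta> \<le> P t \<omega>"
    \<comment> \<open>On this event all left endpoints have weight 1, so every sum telescopes to the
      same increment, which is therefore its limit.\<close>
    have "V (grid a b n k) \<omega> = 1" if "k < Suc n" for n k
      using P \<open>\<omega> \<notin> N\<close> grid_bounds(2)[OF ab(2), of k n] that by (auto simp: V_def)
    then have rs: "riemann_sum a b n (\<lambda>t. V t \<omega>) g = g b - g a" for n g
      using riemann_sum_const[of a b n 1 g] by (simp add: riemann_sum_def del: sum.lessThan_Suc)
    have "J (\<lambda>t \<omega>. indicator {a<..b} t * V t \<omega> * K t \<omega>) b \<omega> = J K b \<omega> - J K a \<omega>"
      using lim(1) unfolding rs by (simp add: LIMSEQ_const_iff)
    moreover have "J (\<lambda>t \<omega>. indicator {a<..b} t * V t \<omega> * 1) b \<omega> = Z b \<omega> - Z a \<omega>"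
      using lim(2) one unfolding rs by (simp add: LIMSEQ_const_iff)
    ultimately show "J K b \<omega> - J K a \<omega> = c * (Z b \<omega> - Z a \<omega>)" using l by simp
  qed
qed

end

subsection \<open>Comparison of local times\<close>

context integral_operator_space
begin

text \<open>Dominated convergence gives the limit \<open>J 0\<close>, which vanishes almost
  surely.\<close>

lemma J_vanishing_limit:
  assumes K: "bounded_predictable M F K" and b: "0 \<le> b"
    and bp: "\<And>m::nat. bounded_predictable M F (\<lambda>t \<omega>. indicator {a<..b} t * V m t \<omega> * K t \<omega>)"
    and V1: "\<And>m t \<omega>. \<bar>V m t \<omega>\<bar> \<le> 1"
    and lim: "\<And>t \<omega>. \<omega> \<in> space M \<Longrightarrow> a < t \<Longrightarrow> t \<le> b \<Longrightarrow> (\<lambda>m. V m t \<omega> * K t \<omega>) \<longlonglongrightarrow> 0"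
  shows "conv_in_prob M (\<lambda>m. J (\<lambda>t \<omega>. indicator {a<..b} t * V m t \<omega> * K t \<omega>) b) (\<lambda>\<omega>. 0)"
proof -
  obtain C where C: "\<And>t \<omega>. 0 \<le> t \<Longrightarrow> \<omega> \<in> space M \<Longrightarrow> \<bar>K t \<omega>\<bar> \<le> C"
    using K unfolding bounded_predictable_def by blast
  have conv: "conv_in_prob M (\<lambda>m. J (\<lambda>t \<omega>. indicator {a<..b} t * V m t \<omega> * K t \<omega>) b) (J (\<lambda>t \<omega>. 0) b)"
  proof (rule J_lim[where C = C])
    fix t :: real and \<omega> assume t: "0 \<le> t" "\<omega> \<in> space M"
    show "\<bar>indicator {a<..b} t * V m t \<omega> * K t \<omega>\<bar> \<le> C" for m
      using mult_mono[OF V1[of m t \<omega>] C[OF t]] C[OF t] by (auto simp: abs_mult split: split_indicator)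
    show "(\<lambda>m. indicator {a<..b} t * V m t \<omega> * K t \<omega>) \<longlonglongrightarrow> 0"
      using lim[OF t(2), of t] by (auto split: split_indicator)
  qed (use bp b in \<open>auto simp: bounded_predictable_def\<close>)
  have eq: "prob {\<omega>\<in>space M. \<epsilon> < \<bar>J (\<lambda>t \<omega>. indicator {a<..b} t * V m t \<omega> * K t \<omega>) b \<omega> - J (\<lambda>t \<omega>. 0) b \<omega>\<bar>} =
    prob {\<omega>\<in>space M. \<epsilon> < \<bar>J (\<lambda>t \<omega>. indicator {a<..b} t * V m t \<omega> * K t \<omega>) b \<omega> - 0\<bar>}" for \<epsilon> m
  proof (rule measure_eq_AE)
    note [measurable] = J_measurable[OF bp b] J_measurable[OF bounded_predictable_const b]
    show "{\<omega>\<in>space M. \<epsilon> < \<bar>J (\<lambda>t \<omega>. indicator {a<..b} t * V m t \<omega> * K t \<omega>) b \<omega> - J (\<lambda>t \<omega>. 0) b \<omega>\<bar>} \<in> sets M"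
      "{\<omega>\<in>space M. \<epsilon> < \<bar>J (\<lambda>t \<omega>. indicator {a<..b} t * V m t \<omega> * K t \<omega>) b \<omega> - 0\<bar>} \<in> sets M"
      by measurable
  qed (use J_zero[OF b] in \<open>auto elim!: eventually_mono\<close>)
  show ?thesis using conv unfolding conv_in_prob_def eq .
qed

end

lemma continuous_on_halfline_at_left:
  fixes x :: "real \<Rightarrow> real"
  assumes "continuous_on {0..} x" "0 < t"
  shows "(x \<longlongrightarrow> x t) (at_left t)"
proof -
  have "continuous_on {0..t} x" using assms(1) by (rule continuous_on_subset) auto
  then show ?thesis using assms(2) by (rule continuous_on_Icc_at_leftD)
qed

context usual_filtered_prob_space
begin

lemma local_time_integral:
  assumes "local_time M F X L"
  obtains J K where "integral_operator M F X J" "bounded_predictable M F K"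
    "AE \<omega> in M. \<forall>t\<ge>0. K t \<omega> = indicator {0<..} (X t \<omega>)"
    "AE \<omega> in M. \<forall>t\<ge>0. 1/2 * L t \<omega> = max (X t \<omega>) 0 - max (X 0 \<omega>) 0 - J K t \<omega>"
proof -
  obtain I where I: "stochastic_integral M F X (\<lambda>s \<omega>. indicator {0<..} (X s \<omega>)) I"
    "AE \<omega> in M. \<forall>t\<ge>0. 1/2 * L t \<omega> = max (X t \<omega>) 0 - max (X 0 \<omega>) 0 - I t \<omega>"
    using assms unfolding local_time_def by blast
  obtain J K where JK: "integral_operator M F X J" "bounded_predictable M F K"
    "AE \<omega> in M. \<forall>t\<ge>0. indicator {0<..} (X t \<omega>) = K t \<omega>" "AE \<omega> in M. \<forall>t\<ge>0. I t \<omega> = J K t \<omega>"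
    using I(1) unfolding stochastic_integral_def indistinguishable_def by blast
  show thesis
  proof (rule that[OF JK(1,2)])
    show "AE \<omega> in M. \<forall>t\<ge>0. K t \<omega> = indicator {0<..} (X t \<omega>)"
      using JK(3) by eventually_elim simp
    show "AE \<omega> in M. \<forall>t\<ge>0. 1/2 * L t \<omega> = max (X t \<omega>) 0 - max (X 0 \<omega>) 0 - J K t \<omega>"
      using I(2) JK(4) by eventually_elim simp
  qed
qed

lemma AE_null_set:
  assumes "AE \<omega> in M. Q \<omega>"
  obtains N where "N \<in> null_sets M" "\<And>\<omega>. \<omega> \<in> space M - N \<Longrightarrow> Q \<omega>"
  using assms unfolding eventually_ae_filter by blast

text \<open>While X > 0 the integrand is 1 and the integral moves like X, that is like its positive
  part; while X < 0 the integrand is 0 and so is the positive part. Either way L stands still.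
  Rational endpoints and bounds 1 / Suc m leave countably many exceptional null sets.\<close>

lemma local_time_constant_on_excursions:
  assumes X: "adapted F X" and op: "integral_operator M F X J" and K: "bounded_predictable M F K"
    and N: "N \<in> null_sets M"
    and cont: "\<And>\<omega>. \<omega> \<in> space M - N \<Longrightarrow> continuous_on {0..} (\<lambda>t. X t \<omega>)"
      "\<And>\<omega>. \<omega> \<in> space M - N \<Longrightarrow> continuous_on {0..} (\<lambda>t. L t \<omega>)"
    and K_eq: "\<And>\<omega> t. \<omega> \<in> space M - N \<Longrightarrow> 0 \<le> t \<Longrightarrow> K t \<omega> = indicator {0<..} (X t \<omega>)"
    and L: "\<And>\<omega> t. \<omega> \<in> space M - N \<Longrightarrow> 0 \<le> t \<Longrightarrow> 1/2 * L t \<omega> = max (X t \<omega>) 0 - max (X 0 \<omega>) 0 - J K t \<omega>"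
  shows "AE \<omega> in M. \<forall>u v. 0 \<le> u \<longrightarrow> u < v \<longrightarrow> (\<forall>w. u < w \<longrightarrow> w < v \<longrightarrow> X w \<omega> \<noteq> 0) \<longrightarrow> L u \<omega> = L v \<omega>"
proof -
  interpret X: integral_operator_space M F X J by unfold_locales (fact op)
  have neg: "adapted F (\<lambda>t \<omega>. - X t \<omega>)" using X by (auto simp: adapted_def)
  have *: "AE \<omega> in M. 0 \<le> a \<longrightarrow> a < b \<longrightarrow> ((\<forall>t\<in>{a..b}. 1 / Suc m \<le> X t \<omega>) \<longrightarrow> J K b \<omega> - J K a \<omega> = 1 * (X b \<omega> - X a \<omega>)) \<and>
      ((\<forall>t\<in>{a..b}. 1 / Suc m \<le> - X t \<omega>) \<longrightarrow> J K b \<omega> - J K a \<omega> = 0 * (X b \<omega> - X a \<omega>))" for a b and m :: nat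
  proof (intro AE_impI AE_conjI)
    assume ab: "0 \<le> a" "a < b"
    have pos: "0 < 1 / real (Suc m)" by simp
    show "AE \<omega> in M. (\<forall>t\<in>{a..b}. 1 / Suc m \<le> X t \<omega>) \<longrightarrow> J K b \<omega> - J K a \<omega> = 1 * (X b \<omega> - X a \<omega>)"
    proof (rule X.J_increment_on_constant[OF K X N cont(1) _ ab])
      fix t \<omega> assume "\<omega> \<in> space M - N" "0 \<le> t" "1 / real (Suc m) \<le> X t \<omega>"
      then show "K t \<omega> = 1" using K_eq[of \<omega> t] pos by (simp del: of_nat_Suc)
    qed
    show "AE \<omega> in M. (\<forall>t\<in>{a..b}. 1 / Suc m \<le> - X t \<omega>) \<longrightarrow> J K b \<omega> - J K a \<omega> = 0 * (X b \<omega> - X a \<omega>)"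
    proof (rule X.J_increment_on_constant[OF K neg N _ _ ab])
      show "continuous_on {0..} (\<lambda>t. - X t \<omega>)" if "\<omega> \<in> space M - N" for \<omega>
        using cont(1)[OF that] by (intro continuous_intros)
      fix t \<omega> assume "\<omega> \<in> space M - N" "0 \<le> t" "1 / real (Suc m) \<le> - X t \<omega>"
      then show "K t \<omega> = 0" using K_eq[of \<omega> t] pos by (simp del: of_nat_Suc)
    qed
  qed
  have "AE \<omega> in M. \<forall>a\<in>\<rat>. \<forall>b\<in>\<rat>. \<forall>m::nat. 0 \<le> a \<longrightarrow> a < b \<longrightarrow>
      ((\<forall>t\<in>{a..b}. 1 / Suc m \<le> X t \<omega>) \<longrightarrow> J K b \<omega> - J K a \<omega> = 1 * (X b \<omega> - X a \<omega>)) \<and>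
      ((\<forall>t\<in>{a..b}. 1 / Suc m \<le> - X t \<omega>) \<longrightarrow> J K b \<omega> - J K a \<omega> = 0 * (X b \<omega> - X a \<omega>))"
    using * by (intro AE_ball_countable'[OF _ countable_rat] AE_all_countable[THEN iffD2] allI)
  moreover have "AE \<omega> in M. \<omega> \<notin> N" using N by (rule AE_not_in)
  ultimately show ?thesis using AE_space
  proof (eventually_elim, intro allI impI)
    fix \<omega> u v
    assume R: "\<forall>a\<in>\<rat>. \<forall>b\<in>\<rat>. \<forall>m::nat. 0 \<le> a \<longrightarrow> a < b \<longrightarrow>
      ((\<forall>t\<in>{a..b}. 1 / Suc m \<le> X t \<omega>) \<longrightarrow> J K b \<omega> - J K a \<omega> = 1 * (X b \<omega> - X a \<omega>)) \<and>
      ((\<forall>t\<in>{a..b}. 1 / Suc m \<le> - X t \<omega>) \<longrightarrow> J K b \<omega> - J K a \<omega> = 0 * (X b \<omega> - X a \<omega>))"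
      and "\<omega> \<notin> N" "\<omega> \<in> space M" and uv: "0 \<le> u" "u < v" "\<forall>w. u < w \<longrightarrow> w < v \<longrightarrow> X w \<omega> \<noteq> 0"
    then have \<omega>: "\<omega> \<in> space M - N" by simp
    show "L u \<omega> = L v \<omega>"
    proof (rule constant_on_excursions[OF cont(2)[OF \<omega>] cont(1)[OF \<omega>] _ uv(1,2)])
      fix a b :: real and m
      assume ab: "a \<in> \<rat>" "b \<in> \<rat>" "0 \<le> a" "a < b"
        and or: "(\<forall>t\<in>{a..b}. 1 / Suc m \<le> X t \<omega>) \<or> (\<forall>t\<in>{a..b}. 1 / Suc m \<le> - X t \<omega>)"
      note Rab = R[rule_format, OF ab(1,2,3,4), of m]
      have pos: "0 < 1 / real (Suc m)" by simp
      from or show "L a \<omega> = L b \<omega>"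
      proof
        assume *: "\<forall>t\<in>{a..b}. 1 / Suc m \<le> X t \<omega>"
        then have "1 / Suc m \<le> X a \<omega>" "1 / Suc m \<le> X b \<omega>" using ab by auto
        then have "0 < X a \<omega>" "0 < X b \<omega>" using pos by linarith+
        moreover have "J K b \<omega> - J K a \<omega> = X b \<omega> - X a \<omega>" using Rab * by simp
        ultimately show ?thesis using L[OF \<omega>, of a] L[OF \<omega>, of b] ab by simp
      next
        assume *: "\<forall>t\<in>{a..b}. 1 / Suc m \<le> - X t \<omega>"
        then have "1 / Suc m \<le> - X a \<omega>" "1 / Suc m \<le> - X b \<omega>" using ab by auto
        then have "0 < - X a \<omega>" "0 < - X b \<omega>" using pos by linarith+
        moreover have "J K b \<omega> - J K a \<omega> = 0" using Rab * by simp
        ultimately show ?thesis using L[OF \<omega>, of a] L[OF \<omega>, of b] ab by simp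
      qed
    qed (use uv(3) in blast)
  qed
qed

text \<open>Here a > 0 matters: at time 0 the weight is always 1, so the boundary term would not
  vanish as the threshold tends to 0. Continuity of the local times covers time 0 later.\<close>

lemma local_time_increments_le:
  assumes X: "adapted F X" and opX: "integral_operator M F X JX" and KX: "bounded_predictable M F KX"
    and opY: "integral_operator M F Y JY" and KY: "bounded_predictable M F KY"
    and N: "N \<in> null_sets M"
    and contX: "\<And>\<omega>. \<omega> \<in> space M - N \<Longrightarrow> continuous_on {0..} (\<lambda>t. X t \<omega>)"
    and contY: "\<And>\<omega>. \<omega> \<in> space M - N \<Longrightarrow> continuous_on {0..} (\<lambda>t. Y t \<omega>)"
    and contLX: "\<And>\<omega>. \<omega> \<in> space M - N \<Longrightarrow> continuous_on {0..} (\<lambda>t. LX t \<omega>)"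
    and monoLY: "\<And>\<omega>. \<omega> \<in> space M - N \<Longrightarrow> mono_on {0..} (\<lambda>t. LY t \<omega>)"
    and KX_eq: "\<And>\<omega> t. \<omega> \<in> space M - N \<Longrightarrow> 0 \<le> t \<Longrightarrow> KX t \<omega> = indicator {0<..} (X t \<omega>)"
    and KY_eq: "\<And>\<omega> t. \<omega> \<in> space M - N \<Longrightarrow> 0 \<le> t \<Longrightarrow> KY t \<omega> = indicator {0<..} (Y t \<omega>)"
    and LX: "\<And>\<omega> t. \<omega> \<in> space M - N \<Longrightarrow> 0 \<le> t \<Longrightarrow> 1/2 * LX t \<omega> = max (X t \<omega>) 0 - max (X 0 \<omega>) 0 - JX KX t \<omega>"
    and LY: "\<And>\<omega> t. \<omega> \<in> space M - N \<Longrightarrow> 0 \<le> t \<Longrightarrow> 1/2 * LY t \<omega> = max (Y t \<omega>) 0 - max (Y 0 \<omega>) 0 - JY KY t \<omega>"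
    and zeros: "\<And>\<omega> t. \<omega> \<in> space M - N \<Longrightarrow> 0 \<le> t \<Longrightarrow> X t \<omega> = 0 \<Longrightarrow> Y t \<omega> = 0"
    and le: "\<And>\<omega> t. \<omega> \<in> space M - N \<Longrightarrow> 0 \<le> t \<Longrightarrow> max (X t \<omega>) 0 \<le> max (Y t \<omega>) 0"
    and ab: "0 < a" "a < b"
  shows "AE \<omega> in M. LX b \<omega> - LX a \<omega> \<le> LY b \<omega> - LY a \<omega>"
proof -
  interpret X: integral_operator_space M F X JX by unfold_locales (fact opX)
  interpret Y: integral_operator_space M F Y JY by unfold_locales (fact opY)
  have ab': "0 \<le> a" "0 \<le> b" using ab by auto
  \<comment> \<open>Left-continuity and dominated convergence are required for every outcome, so the
    weight is 0 on N, where paths may be irregular.\<close>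
  define V where "V m t \<omega> = (if \<omega> \<in> N then 0 else hysteresis (1 / Suc m) (\<lambda>u. X u \<omega>) t)" for m t \<omega>
  have V: "V m t \<in> borel_measurable (F t)" if "0 \<le> t" for m t
    unfolding V_def by (rule hysteresis_measurable[OF X N contX that])
  have V1: "\<bar>V m t \<omega>\<bar> \<le> 1" for m t \<omega>
    using hysteresis_bounds[of "1 / Suc m" "\<lambda>u. X u \<omega>" t] by (simp add: V_def)
  have left: "((\<lambda>u. V m u \<omega>) \<longlongrightarrow> V m t \<omega>) (at_left t)" if "\<omega> \<in> space M" "t \<in> {a<..b}" for m t \<omega>
  proof (cases "\<omega> \<in> N")
    case False
    then have "continuous_on {0..} (\<lambda>u. X u \<omega>)" using contX that by blast
    then have "(hysteresis (1 / Suc m) (\<lambda>u. X u \<omega>) \<longlongrightarrow> hysteresis (1 / Suc m) (\<lambda>u. X u \<omega>) t) (at_left t)"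
      using that ab by (intro hysteresis_left_continuous) auto
    then show ?thesis using False by (simp add: V_def)
  qed (simp add: V_def)
  have Vlim: "(\<lambda>m. V m t \<omega>) \<longlonglongrightarrow> 0" if "\<omega> \<in> space M - N" "0 < t" "X t \<omega> \<noteq> 0" for t \<omega>
    using hysteresis_tendsto_0[OF contX[OF that(1)] that(2,3)] that(1) by (simp add: V_def)
  note RX = X.riemann_sum_conv_in_prob[OF KX ab'(1) ab(2) V V1 left]
  note RY = Y.riemann_sum_conv_in_prob[OF KY ab'(1) ab(2) V V1 left]
  define lX where "lX m = JX (\<lambda>t \<omega>. indicator {a<..b} t * V m t \<omega> * KX t \<omega>) b" for m
  define lY where "lY m = JY (\<lambda>t \<omega>. indicator {a<..b} t * V m t \<omega> * KY t \<omega>) b" for m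
  have lX_meas: "lX m \<in> borel_measurable M" for m unfolding lX_def by (rule X.J_measurable[OF RX(1) ab'(2)])
  have lY_meas: "lY m \<in> borel_measurable M" for m unfolding lY_def by (rule Y.J_measurable[OF RY(1) ab'(2)])
  have notN: "AE \<omega> in M. \<omega> \<notin> N" using N by (rule AE_not_in)
  have flat: "AE \<omega> in M. \<forall>u v. 0 \<le> u \<longrightarrow> u < v \<longrightarrow> (\<forall>w. u < w \<longrightarrow> w < v \<longrightarrow> X w \<omega> \<noteq> 0) \<longrightarrow> LX u \<omega> = LX v \<omega>"
    using X opX KX N
  proof (rule local_time_constant_on_excursions)
    fix \<omega> assume \<omega>: "\<omega> \<in> space M - N"
    show "continuous_on {0..} (\<lambda>t. X t \<omega>)" "continuous_on {0..} (\<lambda>t. LX t \<omega>)"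
      using contX[OF \<omega>] contLX[OF \<omega>] .
    show "KX t \<omega> = indicator {0<..} (X t \<omega>)" if "0 \<le> t" for t
      using KX_eq[OF \<omega> that] .
    show "1/2 * LX t \<omega> = max (X t \<omega>) 0 - max (X 0 \<omega>) 0 - JX KX t \<omega>" if "0 \<le> t" for t
      using LX[OF \<omega> that] .
  qed
  define D where "D t \<omega> = max (Y t \<omega>) 0 - max (X t \<omega>) 0" for t \<omega>
  have ineq: "AE \<omega> in M. lX m \<omega> - lY m \<omega> - V m a \<omega> * D a \<omega> \<le>
    (1/2 * LY b \<omega> - 1/2 * LX b \<omega>) - (1/2 * LY a \<omega> - 1/2 * LX a \<omega>)" for m
  proof -
    obtain r1 where r1: "strict_mono r1"
      "AE \<omega> in M. (\<lambda>n. riemann_sum a b (r1 n) (\<lambda>t. V m t \<omega>) (\<lambda>t. JX KX t \<omega>)) \<longlonglongrightarrow> lX m \<omega>"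
      unfolding lX_def by (rule conv_in_prob_AE_subseq[OF RX(3) X.J_measurable[OF RX(1) ab'(2)] RX(2)])
    \<comment> \<open>Extracted from \<open>r1\<close>, so that both integrals converge along the
      same grids.\<close>
    obtain r2 where r2: "strict_mono r2"
      "AE \<omega> in M. (\<lambda>n. riemann_sum a b (r1 (r2 n)) (\<lambda>t. V m t \<omega>) (\<lambda>t. JY KY t \<omega>)) \<longlonglongrightarrow> lY m \<omega>"
      unfolding lY_def
      by (rule conv_in_prob_AE_subseq[OF RY(3) Y.J_measurable[OF RY(1) ab'(2)] conv_in_prob_subseq[OF RY(2) r1(1)]])
    show ?thesis using r1(2) r2(2) notN flat AE_space
    proof eventually_elim
      case (elim \<omega>)
      then have \<omega>: "\<omega> \<in> space M - N" by simp
      have Vh: "V m t \<omega> = hysteresis (1 / Suc m) (\<lambda>u. X u \<omega>) t" for t using \<omega> by (simp add: V_def)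
      \<comment> \<open>The halves come from the local time formula, and the constant - D 0 collects
        the initial values of the positive parts.\<close>
      show ?case unfolding Vh
      proof (rule hysteresis_riemann_sum_ineq[where iX = "\<lambda>t. JX KX t \<omega>" and iY = "\<lambda>t. JY KY t \<omega>"
            and D = "\<lambda>t. D t \<omega>" and p = "\<lambda>t. 1/2 * LX t \<omega>" and q = "\<lambda>t. 1/2 * LY t \<omega>"
            and c = "- D 0 \<omega>" and r = "\<lambda>n. r1 (r2 n)"])
        show "continuous_on {0..} (\<lambda>t. X t \<omega>)" using contX \<omega> .
        show "continuous_on {0..} (\<lambda>t. D t \<omega>)"
          unfolding D_def using contX[OF \<omega>] contY[OF \<omega>] by (intro continuous_intros)
        show "0 \<le> D t \<omega>" if "0 \<le> t" for t using le[OF \<omega> that] by (simp add: D_def)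
        show "D t \<omega> = 0" if "0 \<le> t" "X t \<omega> = 0" for t using zeros[OF \<omega> that] that by (simp add: D_def)
        show "continuous_on {0..} (\<lambda>t. 1/2 * LX t \<omega>)" using contLX[OF \<omega>] by (intro continuous_intros)
        show "1/2 * LX u \<omega> = 1/2 * LX v \<omega>" if "0 \<le> u" "u < v" "\<And>w. u < w \<Longrightarrow> w < v \<Longrightarrow> X w \<omega> \<noteq> 0" for u v
          using elim(4) that by simp
        show "mono_on {0..} (\<lambda>t. 1/2 * LY t \<omega>)"
          using monoLY[OF \<omega>] by (auto simp: mono_on_def)
        show "1/2 * LY t \<omega> - 1/2 * LX t \<omega> = D t \<omega> - JY KY t \<omega> + JX KX t \<omega> + - D 0 \<omega>" if "0 \<le> t" for t
          unfolding LX[OF \<omega> that] LY[OF \<omega> that] D_def by simp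
        show "strict_mono (\<lambda>n. r1 (r2 n))" using r1(1) r2(1) by (simp add: strict_mono_def)
        show "(\<lambda>n. riemann_sum a b (r1 (r2 n)) (hysteresis (1 / real (Suc m)) (\<lambda>u. X u \<omega>)) (\<lambda>t. JX KX t \<omega>)) \<longlonglongrightarrow> lX m \<omega>"
          using LIMSEQ_subseq_LIMSEQ[OF elim(1) r2(1)] by (simp add: comp_def Vh)
        show "(\<lambda>n. riemann_sum a b (r1 (r2 n)) (hysteresis (1 / real (Suc m)) (\<lambda>u. X u \<omega>)) (\<lambda>t. JY KY t \<omega>)) \<longlonglongrightarrow> lY m \<omega>"
          using elim(2) by (simp add: Vh)
      qed (use ab in auto)
    qed
  qed
  have cX: "conv_in_prob M lX (\<lambda>\<omega>. 0)"
    unfolding lX_def[abs_def]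
  proof (rule X.J_vanishing_limit[OF KX ab'(2) RX(1) V1])
    fix t \<omega> assume t: "\<omega> \<in> space M" "a < t" "t \<le> b"
    \<comment> \<open>Off the zeros of X the weight tends to 0; at a zero \<open>KX\<close> is
      already 0.\<close>
    show "(\<lambda>m. V m t \<omega> * KX t \<omega>) \<longlonglongrightarrow> 0"
    proof (cases "\<omega> \<in> N")
      case False
      then show ?thesis
        using Vlim[of \<omega> t] KX_eq[of \<omega> t] t ab by (cases "X t \<omega> = 0") (auto intro: tendsto_mult_left_zero)
    qed (simp add: V_def)
  qed
  have cY: "conv_in_prob M lY (\<lambda>\<omega>. 0)"
    unfolding lY_def[abs_def]
  proof (rule Y.J_vanishing_limit[OF KY ab'(2) RY(1) V1])
    fix t \<omega> assume t: "\<omega> \<in> space M" "a < t" "t \<le> b"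
    \<comment> \<open>Here the inclusion of the zero sets enters: where X vanishes so does Y, and
      \<open>KY\<close> is 0.\<close>
    show "(\<lambda>m. V m t \<omega> * KY t \<omega>) \<longlonglongrightarrow> 0"
    proof (cases "\<omega> \<in> N")
      case False
      then show ?thesis
        using Vlim[of \<omega> t] KY_eq[of \<omega> t] zeros[of \<omega> t] t ab
        by (cases "X t \<omega> = 0") (auto intro: tendsto_mult_left_zero)
    qed (simp add: V_def)
  qed
  obtain r1 where r1: "strict_mono r1" "AE \<omega> in M. (\<lambda>m. lX (r1 m) \<omega>) \<longlonglongrightarrow> 0"
    by (rule conv_in_prob_AE_subseq[OF lX_meas borel_measurable_const cX])
  obtain r2 where r2: "strict_mono r2" "AE \<omega> in M. (\<lambda>m. lY (r1 (r2 m)) \<omega>) \<longlonglongrightarrow> 0"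
    by (rule conv_in_prob_AE_subseq[OF lY_meas borel_measurable_const conv_in_prob_subseq[OF cY r1(1)]])
  have "AE \<omega> in M. \<forall>m. lX m \<omega> - lY m \<omega> - V m a \<omega> * D a \<omega> \<le>
    (1/2 * LY b \<omega> - 1/2 * LX b \<omega>) - (1/2 * LY a \<omega> - 1/2 * LX a \<omega>)"
    using ineq by (simp add: AE_all_countable)
  then show ?thesis using r1(2) r2(2) notN AE_space
  proof eventually_elim
    case (elim \<omega>)
    then have \<omega>: "\<omega> \<in> space M - N" by simp
    \<comment> \<open>If X a = 0 then D a = 0; otherwise the weight at a > 0 tends to 0.\<close>
    have "(\<lambda>m. V m a \<omega> * D a \<omega>) \<longlonglongrightarrow> 0"
      using Vlim[OF \<omega> ab(1)] zeros[OF \<omega> ab'(1)]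
      by (cases "X a \<omega> = 0") (auto simp: D_def intro: tendsto_mult_left_zero)
    then have "(\<lambda>m. V (r1 (r2 m)) a \<omega> * D a \<omega>) \<longlonglongrightarrow> 0"
      using LIMSEQ_subseq_LIMSEQ[OF LIMSEQ_subseq_LIMSEQ[OF _ r1(1)] r2(1), of "\<lambda>m. V m a \<omega> * D a \<omega>"]
      by (simp add: comp_def)
    moreover have "(\<lambda>m. lX (r1 (r2 m)) \<omega>) \<longlonglongrightarrow> 0"
      using LIMSEQ_subseq_LIMSEQ[OF elim(2) r2(1)] by (simp add: comp_def)
    ultimately have "(\<lambda>m. lX (r1 (r2 m)) \<omega> - lY (r1 (r2 m)) \<omega> - V (r1 (r2 m)) a \<omega> * D a \<omega>) \<longlonglongrightarrow> 0 - 0 - 0"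
      using elim(3) by (intro tendsto_diff)
    then have "0 - 0 - 0 \<le> (1/2 * LY b \<omega> - 1/2 * LX b \<omega>) - (1/2 * LY a \<omega> - 1/2 * LX a \<omega>)"
      using elim(1) by (intro LIMSEQ_le_const2) auto
    then show ?case by simp
  qed
qed

text \<open>Each quotient combines continuous adapted processes with their backward shifts, which
  use earlier values only; limits and clamping preserve predictability.\<close>

lemma predictable_left_density:
  assumes L: "adapted F L" "\<And>\<omega>. \<omega> \<in> space M \<Longrightarrow> continuous_on {0..} (\<lambda>t. L t \<omega>)"
    and L': "adapted F L'" "\<And>\<omega>. \<omega> \<in> space M \<Longrightarrow> continuous_on {0..} (\<lambda>t. L' t \<omega>)"
  shows "predictable M F (\<lambda>t \<omega>. left_density (\<lambda>u. L u \<omega>) (\<lambda>u. L' u \<omega>) t)"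
proof -
  have 1: "predictable M F Z" "predictable M F (\<lambda>t \<omega>. Z (max 0 (t - 1 / Suc n)) \<omega>)"
    if Z: "adapted F Z" "\<And>\<omega>. \<omega> \<in> space M \<Longrightarrow> continuous_on {0..} (\<lambda>t. Z t \<omega>)" for Z :: "'a process" and n
  proof -
    show "predictable M F Z"
      using Z by (intro predictable_left_continuous) (auto simp: adapted_def intro: continuous_on_halfline_at_left)
    show "predictable M F (\<lambda>t \<omega>. Z (max 0 (t - 1 / Suc n)) \<omega>)"
    proof (rule predictable_left_continuous)
      fix t :: real assume t: "0 \<le> t"
      have "Z (max 0 (t - 1 / Suc n)) \<in> borel_measurable (F (max 0 (t - 1 / Suc n)))"
        using Z(1) by (auto simp: adapted_def)
      then show "(\<lambda>\<omega>. Z (max 0 (t - 1 / Suc n)) \<omega>) \<in> borel_measurable (F t)"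
        using t by (intro measurable_F_mono[of "max 0 (t - 1 / Suc n)" t]) auto
    next
      fix t :: real and \<omega> assume t: "\<omega> \<in> space M" "0 < t"
      have "continuous_on {0..} (\<lambda>t. Z (max 0 (t - 1 / Suc n)) \<omega>)"
        by (rule continuous_on_compose2[OF Z(2)[OF t(1)]]) (auto intro!: continuous_intros)
      then show "((\<lambda>u. Z (max 0 (u - 1 / Suc n)) \<omega>) \<longlongrightarrow> Z (max 0 (t - 1 / Suc n)) \<omega>) (at_left t)"
        using t(2) by (rule continuous_on_halfline_at_left)
    qed
  qed
  note [measurable] = 1[OF L, unfolded predictable_def] 1[OF L', unfolded predictable_def]
  show ?thesis unfolding predictable_def left_density_def split_def
    using 1[OF L, unfolded predictable_def split_def] 1[OF L', unfolded predictable_def split_def]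
    by (intro borel_measurable_max borel_measurable_min borel_measurable_const borel_measurable_lim_metric
        borel_measurable_divide borel_measurable_diff)
qed

end

theorem theorem2p3:
  fixes M :: "'a measure" and F :: "real \<Rightarrow> 'a measure"
    and X Y LX LY :: "real \<Rightarrow> 'a \<Rightarrow> real"
  assumes "usual_filtered_prob_space M F"
    and "continuous_semimartingale M F X" and "continuous_semimartingale M F Y"
    and "AE \<omega> in M. {s. 0 \<le> s \<and> X s \<omega> = 0} \<subseteq> {s. 0 \<le> s \<and> Y s \<omega> = 0}"
    and "AE \<omega> in M. \<forall>s\<ge>0. max (X s \<omega>) 0 \<le> max (Y s \<omega>) 0"
    and "local_time M F X LX" and "local_time M F Y LY"
  shows "(AE \<omega> in M. absolutely_continuous (stieltjes (\<lambda>t. LY t \<omega>)) (stieltjes (\<lambda>t. LX t \<omega>))) \<and>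
    (\<exists>\<theta>. predictable M F \<theta> \<and> (\<forall>s\<ge>0. \<forall>\<omega>\<in>space M. \<theta> s \<omega> \<in> {0..1}) \<and>
      (AE \<omega> in M. \<forall>t\<ge>0.
        LX t \<omega> = (LINT s:{0..t}|stieltjes (\<lambda>t. LY t \<omega>). \<theta> s \<omega>)))"
proof -
  interpret usual_filtered_prob_space M F by fact
  have X: "adapted F X" "AE \<omega> in M. continuous_on {0..} (\<lambda>t. X t \<omega>)"
    and Y: "AE \<omega> in M. continuous_on {0..} (\<lambda>t. Y t \<omega>)"
    using assms(2,3) by (auto simp: continuous_semimartingale_def continuous_paths_def)
  have LX: "adapted F LX" "AE \<omega> in M. continuous_on {0..} (\<lambda>t. LX t \<omega>)" "AE \<omega> in M. mono_on {0..} (\<lambda>t. LX t \<omega>)"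
    and LY: "adapted F LY" "AE \<omega> in M. continuous_on {0..} (\<lambda>t. LY t \<omega>)" "AE \<omega> in M. mono_on {0..} (\<lambda>t. LY t \<omega>)"
    using assms(6,7) by (auto simp: local_time_def continuous_paths_def)
  obtain JX KX where JX: "integral_operator M F X JX" "bounded_predictable M F KX"
    "AE \<omega> in M. \<forall>t\<ge>0. KX t \<omega> = indicator {0<..} (X t \<omega>)"
    "AE \<omega> in M. \<forall>t\<ge>0. 1/2 * LX t \<omega> = max (X t \<omega>) 0 - max (X 0 \<omega>) 0 - JX KX t \<omega>"
    using local_time_integral[OF assms(6)] by blast
  obtain JY KY where JY: "integral_operator M F Y JY" "bounded_predictable M F KY"
    "AE \<omega> in M. \<forall>t\<ge>0. KY t \<omega> = indicator {0<..} (Y t \<omega>)"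
    "AE \<omega> in M. \<forall>t\<ge>0. 1/2 * LY t \<omega> = max (Y t \<omega>) 0 - max (Y 0 \<omega>) 0 - JY KY t \<omega>"
    using local_time_integral[OF assms(7)] by blast
  interpret X: integral_operator_space M F X JX by unfold_locales (fact JX(1))
  define G where "G \<omega> \<longleftrightarrow> continuous_on {0..} (\<lambda>t. X t \<omega>) \<and> continuous_on {0..} (\<lambda>t. Y t \<omega>) \<and>
    continuous_on {0..} (\<lambda>t. LX t \<omega>) \<and> mono_on {0..} (\<lambda>t. LY t \<omega>) \<and>
    (\<forall>t\<ge>0. KX t \<omega> = indicator {0<..} (X t \<omega>)) \<and> (\<forall>t\<ge>0. KY t \<omega> = indicator {0<..} (Y t \<omega>)) \<and>
    (\<forall>t\<ge>0. 1/2 * LX t \<omega> = max (X t \<omega>) 0 - max (X 0 \<omega>) 0 - JX KX t \<omega>) \<and>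
    (\<forall>t\<ge>0. 1/2 * LY t \<omega> = max (Y t \<omega>) 0 - max (Y 0 \<omega>) 0 - JY KY t \<omega>) \<and>
    (\<forall>t\<ge>0. X t \<omega> = 0 \<longrightarrow> Y t \<omega> = 0) \<and> (\<forall>t\<ge>0. max (X t \<omega>) 0 \<le> max (Y t \<omega>) 0)" for \<omega>
  have "AE \<omega> in M. G \<omega>"
    using X(2) Y LX(2) LY(3) JX(3,4) JY(3,4) assms(4,5) unfolding G_def by eventually_elim blast
  then obtain N where N: "N \<in> null_sets M" "\<And>\<omega>. \<omega> \<in> space M - N \<Longrightarrow> G \<omega>" by (rule AE_null_set) blast
  have le: "AE \<omega> in M. LX b \<omega> - LX a \<omega> \<le> LY b \<omega> - LY a \<omega>" if "0 < a" "a < b" for a b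
    using X(1) JX(1,2) JY(1,2) N(1)
  proof (rule local_time_increments_le)
    fix \<omega> assume "\<omega> \<in> space M - N"
    note G = N(2)[OF this, unfolded G_def]
    show "continuous_on {0..} (\<lambda>t. X t \<omega>)" "continuous_on {0..} (\<lambda>t. Y t \<omega>)"
      "continuous_on {0..} (\<lambda>t. LX t \<omega>)" "mono_on {0..} (\<lambda>t. LY t \<omega>)"
      using G by blast+
    fix t :: real assume "0 \<le> t"
    then show "KX t \<omega> = indicator {0<..} (X t \<omega>)" "KY t \<omega> = indicator {0<..} (Y t \<omega>)"
      "1/2 * LX t \<omega> = max (X t \<omega>) 0 - max (X 0 \<omega>) 0 - JX KX t \<omega>"
      "1/2 * LY t \<omega> = max (Y t \<omega>) 0 - max (Y 0 \<omega>) 0 - JY KY t \<omega>"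
      "X t \<omega> = 0 \<Longrightarrow> Y t \<omega> = 0" "max (X t \<omega>) 0 \<le> max (Y t \<omega>) 0"
      using G by blast+
  qed (fact that)+
  have "AE \<omega> in M. \<forall>a\<in>\<rat>. \<forall>b\<in>\<rat>. 0 < a \<longrightarrow> a < b \<longrightarrow> LX b \<omega> - LX a \<omega> \<le> LY b \<omega> - LY a \<omega>"
    using le by (intro AE_ball_countable'[OF _ countable_rat] AE_impI)
  then have mono: "AE \<omega> in M. mono_on {0..} (\<lambda>t. LY t \<omega> - LX t \<omega>)"
    using LX(2) LY(2)
  proof eventually_elim
    case (elim \<omega>)
    show ?case
    proof (rule mono_on_from_rationals)
      show "continuous_on {0..} (\<lambda>t. LY t \<omega> - LX t \<omega>)"
        using elim(2,3) by (intro continuous_on_diff)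
      show "LY a \<omega> - LX a \<omega> \<le> LY b \<omega> - LX b \<omega>" if "a \<in> \<rat>" "b \<in> \<rat>" "0 < a" "a < b" for a b
        using elim(1)[rule_format, OF that] by linarith
    qed
  qed
  \<comment> \<open>The density reproduces only the increment of LX from time 0, so its initial
    value is determined separately.\<close>
  have L0: "AE \<omega> in M. LX 0 \<omega> = 0"
    using JX(4) X.J_initial[OF JX(2)] by eventually_elim force
  have "AE \<omega> in M. continuous_on {0..} (\<lambda>t. LX t \<omega>) \<and> continuous_on {0..} (\<lambda>t. LY t \<omega>)"
    using LX(2) LY(2) by eventually_elim blast
  then obtain N' where N': "N' \<in> null_sets M"
    "\<And>\<omega>. \<omega> \<in> space M - N' \<Longrightarrow> continuous_on {0..} (\<lambda>t. LX t \<omega>) \<and> continuous_on {0..} (\<lambda>t. LY t \<omega>)"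
    by (rule AE_null_set) blast
  \<comment> \<open>Predictability concerns every outcome, so both local times are replaced by 0
    where their paths may be discontinuous; almost surely this does not change \<theta>.\<close>
  define Z where "Z L t \<omega> = (if \<omega> \<in> N' then 0 else L t \<omega> :: real)" for L :: "'a process" and t \<omega>
  have Z: "adapted F (Z L)" if "adapted F L" for L
    unfolding adapted_def
  proof (intro allI impI)
    fix t :: real assume t: "0 \<le> t"
    have [measurable]: "L t \<in> borel_measurable (F t)" "N' \<in> sets (F t)"
      using that t null_sets_F[OF N'(1) t] by (auto simp: adapted_def)
    show "Z L t \<in> borel_measurable (F t)" unfolding Z_def by measurable
  qed
  define \<theta> where "\<theta> t \<omega> = left_density (\<lambda>u. Z LX u \<omega>) (\<lambda>u. Z LY u \<omega>) t" for t \<omega>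
  have "predictable M F \<theta>"
    unfolding \<theta>_def
  proof (rule predictable_left_density[OF Z[OF LX(1)] _ Z[OF LY(1)]])
    fix \<omega> assume "\<omega> \<in> space M"
    then show "continuous_on {0..} (\<lambda>t. Z LX t \<omega>)" "continuous_on {0..} (\<lambda>t. Z LY t \<omega>)"
      using N'(2)[of \<omega>] by (cases "\<omega> \<in> N'"; simp add: Z_def)+
  qed
  moreover have "\<forall>s\<ge>0. \<forall>\<omega>\<in>space M. \<theta> s \<omega> \<in> {0..1}"
    by (simp add: \<theta>_def left_density_bounds)
  moreover have "AE \<omega> in M. \<forall>t\<ge>0. LX t \<omega> = (LINT s:{0..t}|stieltjes (\<lambda>t. LY t \<omega>). \<theta> s \<omega>)"
    using LX(2,3) LY(2,3) mono L0 AE_not_in[OF N'(1)]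
  proof eventually_elim
    case (elim \<omega>)
    have "\<theta> s \<omega> = left_density (\<lambda>u. LX u \<omega>) (\<lambda>u. LY u \<omega>) s" for s
      using elim(7) by (simp add: \<theta>_def Z_def)
    then show ?case using stieltjes_left_density[OF elim(1-5)] elim(6) by simp
  qed
  moreover have "AE \<omega> in M. absolutely_continuous (stieltjes (\<lambda>t. LY t \<omega>)) (stieltjes (\<lambda>t. LX t \<omega>))"
    using LX(2,3) LY(2) mono by eventually_elim (rule absolutely_continuous_stieltjes)
  ultimately show ?thesis by blast
qed

end
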